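(* Let $(\vartheta_0,D)$ be one of the pairs $(0.924,6)$, $(0.739,8)$, $(0.643,12)$, $(0.584,16)$, $(0.544,20)$, $(0.516,26)$, and suppose some $\vartheta>\vartheta_0$ satisfies both conditions (A) and (B) below. Then there exist absolute constants $C$, $c>0$, an odd integer $b\le C$ and an even integer $d$ with $0<|d|\le D$ such that $P^-(p+d)>p^c$ and $\Omega(p+d)=b$ for infinitely many primes $p$.
   Context: $P^-(n)$ is the smallest prime factor of $n$; $\Omega(n)$ is the number of prime factors of $n$ counted with multiplicity and $\lambda(n)=(-1)^{\Omega(n)}$. Condition (A): for every $\varepsilon>0$, $A>0$, $\sum_{q\le N^{\vartheta-\varepsilon}}\max_{a:(a,q)=1}\bigl|\sum_{p\le N,\,p\equiv a\ (\mathrm{mod}\ q)}\log p-\frac{N}{\varphi(q)}\bigr|\ll_{\varepsilon,A}\frac{N}{(\log N)^A}$ ($p$ over primes). Condition (B): for every $\varepsilon>0$, $A>0$, $\sum_{q\le N^{\vartheta-\varepsilon}}\max_{y\le N}\max_a\bigl|\sum_{n\le y,\,n\equiv a\ (\mathrm{mod}\ q)}\lambda(n)\bigr|\ll_{\varepsilon,A}\frac{N}{(\log N)^A}$. *)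

theory Defs
  imports "HOL-Analysis.Analysis" "HOL-Number_Theory.Number_Theory"
begin

definition bigOmega :: "nat \<Rightarrow> nat" where
  "bigOmega n = size (prime_factorization n)"

definition liouville :: "nat \<Rightarrow> real" where
  "liouville n = (-1) ^ bigOmega n"

text \<open>Smallest prime factor P^-(n) (meaningful for n > 1).\<close>
definition least_prime_factor :: "nat \<Rightarrow> nat" where
  "least_prime_factor n = Min (prime_factors n)"

definition moduli :: "nat \<Rightarrow> real \<Rightarrow> nat set" where
  "moduli N e = {q. 1 \<le> q \<and> real q \<le> real N powr e}"

definition condA :: "real \<Rightarrow> bool" where
  "condA \<theta> \<longleftrightarrow> (\<forall>\<epsilon>>0. \<forall>A>0. \<exists>K. \<forall>N::nat. N \<ge> 2 \<longrightarrow>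
     (\<Sum>q\<in>moduli N (\<theta> - \<epsilon>).
        Max ((\<lambda>a. \<bar>(\<Sum>p | prime p \<and> p \<le> N \<and> [p = a] (mod q). ln (real p))
                    - real N / real (totient q)\<bar>) ` {a. a < q \<and> coprime a q}))
     \<le> K * real N / (ln (real N)) powr A)"

definition condB :: "real \<Rightarrow> bool" where
  "condB \<theta> \<longleftrightarrow> (\<forall>\<epsilon>>0. \<forall>A>0. \<exists>K. \<forall>N::nat. N \<ge> 2 \<longrightarrow>
     (\<Sum>q\<in>moduli N (\<theta> - \<epsilon>).
        Max ((\<lambda>(y, a). \<bar>\<Sum>n | 1 \<le> n \<and> n \<le> y \<and> [n = a] (mod q). liouville n\<bar>)
               ` ({..N} \<times> {..<q})))
     \<le> K * real N / (ln (real N)) powr A)"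

end

theory Submission
  imports Defs "HOL-Real_Asymp.Real_Asymp"
begin

text \<open>
  Fix an admissible tuple H of k even shifts and weight each n by a Selberg square
  \<open>w n = (\<Sum>d. \<lambda> d)\<^sup>2\<close> over the divisors d of \<open>\<Prod>h\<in>H. n + h\<close>, with d at most
  \<open>R = N powr (\<tau> / 2)\<close>. If no n whose shifts are all free of small primes has one shift prime and another with
  an odd number of prime factors, then for such n
  \<open>(k - 1) * #{h. n + h prime} \<le> k / 2 + (\<Sum>h. liouville (n + h)) / 2\<close>.
  Average this against w. Condition (B) removes the Liouville terms and condition (A) evaluates the prime terms.
  An n with a prime factor \<open>q \<le> N powr c\<close> of some shift contributes little, because the diagonalised form restricted
  to multiples of q only involves the differences \<open>y r - y (q * r)\<close>. What remains is an inequality between two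
  Beta integrals, which the choice \<open>y r = 1 + b * ln (R / r) / ln R\<close> violates for the listed exponents.

  Squarefree moduli are represented by the finite sets of their prime factors, so that divisibility, lcm and
  coprimality become inclusion, union and disjointness. All moments of the sieve weights are compared with the
  zeroth one by a recurrence, hence no singular series has to be evaluated.
\<close>

section \<open>Finite sets of primes as squarefree moduli\<close>

text \<open>Weights of dimension k count all n and weights of dimension k - 1 count the primes, so
  \<open>mo 0\<close> and \<open>mo1 0\<close> have to be compared to leading order. Writing k as (k
  - 1) + 1 makes \<open>mo 0\<close> a convolution and bounds it by about
  \<open>exp (2 * k / D) * Phi * ln R / k * mo1 0\<close>, while the prime sums are bounded from
  below without such a loss. One-sided bounds suffice, as the argument is by contradiction. After
  division by the common size the test is \<open>\<eta> * U < \<tau> * k * (k - 1) * L\<close> with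
  \<open>\<eta> = exp (2 * k / D)\<close>, where U and L stem from the Beta integrals. The order of
  choices matters: some \<tau> strictly between \<theta>0 and both \<theta> and 1 creates a margin,
  D is then enlarged until \<eta> fits into it, and c comes last because it depends on D. The
  constants C, b and d come from a pigeonhole: the prime factors of n + h' exceed
  \<open>N powr c\<close> and n + h' is at most N squared, so their number is at most 2 / c, and
  only finitely many pairs (b, d) compete. The six pairs belong to k = 3, ..., 8, with D the
  diameter of a narrowest admissible k-tuple.\<close>

definition sprod :: "nat set \<Rightarrow> nat" where
  "sprod A = (\<Prod>p\<in>A. p)"

lemma sprod_empty [simp]: "sprod {} = 1"
  by (simp add: sprod_def)

lemma sprod_insert [simp]: "finite A \<Longrightarrow> p \<notin> A \<Longrightarrow> sprod (insert p A) = p * sprod A"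
  by (simp add: sprod_def)

lemma sprod_Un_disjoint: "finite A \<Longrightarrow> finite B \<Longrightarrow> A \<inter> B = {} \<Longrightarrow> sprod (A \<union> B) = sprod A * sprod B"
  by (simp add: sprod_def prod.union_disjoint)

text \<open>A real bound lets the cofactors of \<open>A\<close> be collected as
  \<open>psets D (x / sprod A)\<close>. Once \<open>W\<close> is the product of the primes up to
  \<open>D\<close>, these sets are the squarefree moduli coprime to \<open>W\<close>.\<close>

definition psets :: "nat \<Rightarrow> real \<Rightarrow> nat set set" where
  "psets D x = {A. finite A \<and> (\<forall>p\<in>A. prime p \<and> D < p) \<and> real (sprod A) \<le> x}"

lemma psetsD:
  assumes "A \<in> psets D x"
  shows "finite A" "\<And>p. p \<in> A \<Longrightarrow> prime p" "\<And>p. p \<in> A \<Longrightarrow> D < p" "real (sprod A) \<le> x"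
  using assms by (auto simp: psets_def)

lemma sprod_pos:
  fixes A :: "nat set"
  assumes "\<And>p. p \<in> A \<Longrightarrow> prime p"
  shows "0 < sprod A"
  unfolding sprod_def using assms by (intro prod_pos) (auto simp: prime_gt_0_nat)

lemma psets_prod_pos: "A \<in> psets D x \<Longrightarrow> 0 < sprod A"
  by (rule sprod_pos) (auto dest: psetsD)

lemma psets_prod_ge1: "A \<in> psets D x \<Longrightarrow> 1 \<le> real (sprod A)"
  using psets_prod_pos[of A D x] by linarith

lemma sprod_mono:
  fixes A :: "nat set"
  assumes "finite B" "A \<subseteq> B" "\<And>p. p \<in> B \<Longrightarrow> prime p"
  shows "sprod A \<le> sprod B"
proof -
  have "sprod A dvd sprod B" unfolding sprod_def using assms by (intro prod_dvd_prod_subset)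
  then show ?thesis using sprod_pos[of B] assms(3) by (intro dvd_imp_le) auto
qed

lemma psets_mono_set: "B \<in> psets D x \<Longrightarrow> A \<subseteq> B \<Longrightarrow> A \<in> psets D x"
proof -
  assume B: "B \<in> psets D x" and A: "A \<subseteq> B"
  have "real (sprod A) \<le> real (sprod B)" using sprod_mono[of B A] A psetsD[OF B] by simp
  also have "\<dots> \<le> x" by (rule psetsD(4)[OF B])
  finally show ?thesis using A B finite_subset[OF A] unfolding psets_def by blast
qed

lemma empty_in_psets [simp]: "{} \<in> psets D x \<longleftrightarrow> 1 \<le> x"
  by (simp add: psets_def)

lemma finite_psets [simp]: "finite (psets D x)"
proof (rule finite_subset)
  show "psets D x \<subseteq> Pow {..nat \<lfloor>x\<rfloor>}"
  proof (intro subsetI PowI)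
    fix A p assume A: "A \<in> psets D x" and p: "p \<in> A"
    have "real (sprod {p}) \<le> real (sprod A)" using sprod_mono[of A "{p}"] A p by (auto dest: psetsD)
    then have "real p \<le> x" using psetsD(4)[OF A] by (simp add: sprod_def)
    then show "p \<in> {..nat \<lfloor>x\<rfloor>}" by (simp add: le_nat_floor)
  qed
qed simp

text \<open>Unique factorisation. Through it sums over sets of primes are bounded by sums over
  integers, so that conditions (A) and (B), which sum over integers q, apply to moduli given as
  sets.\<close>

lemma inj_on_sprod: "inj_on (\<lambda>A. sprod A) {A::nat set. finite A \<and> (\<forall>p\<in>A. prime p)}"
proof (rule inj_on_inverseI[where g = prime_factors])
  fix A :: "nat set" assume A: "A \<in> {A. finite A \<and> (\<forall>p\<in>A. prime p)}"
  have "prime_factors (sprod A) = (\<Union>p\<in>A. prime_factors p)"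
    using A unfolding sprod_def by (subst prime_factors_prod) auto
  also have "\<dots> = A" using A by (auto simp: prime_prime_factors)
  finally show "prime_factors (sprod A) = A" .
qed

text \<open>Least common multiple times greatest common divisor is the product. Pairs of sieve
  divisors up to R thus lead to moduli up to \<open>R * R\<close>, which is what the level of
  distribution has to cover.\<close>

lemma Un_in_psets:
  assumes "A \<in> psets D x" "B \<in> psets D y"
  shows "A \<union> B \<in> psets D (x * y)"
proof -
  have "sprod (A \<union> B) \<le> sprod A * sprod B"
    proof -
    have "sprod (A \<union> B) * sprod (A \<inter> B) = sprod A * sprod B"
      using prod.union_inter[of A B "\<lambda>x. x"] assms by (auto dest: psetsD simp: sprod_def)
    moreover have "1 \<le> sprod (A \<inter> B)"
      using sprod_pos[of "A \<inter> B"] psetsD(2)[OF assms(1)] by auto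
    ultimately show ?thesis by (metis mult.right_neutral mult_le_mono2)
  qed
  then have "real (sprod (A \<union> B)) \<le> real (sprod A) * real (sprod B)"
    by (metis of_nat_le_iff of_nat_mult)
  also have "\<dots> \<le> x * y"
    using psetsD(4)[OF assms(1)] psetsD(4)[OF assms(2)] psets_prod_ge1[OF assms(1)]
    by (intro mult_mono) auto
  finally show ?thesis using assms by (auto simp: psets_def)
qed

section \<open>Diagonalisation and inversion over downward closed families of sets\<close>

lemma prod_one_plus_Pow:
  fixes f :: "'a \<Rightarrow> 'b::comm_ring_1"
  assumes "finite C"
  shows "(\<Sum>A\<in>Pow C. \<Prod>p\<in>A. f p) = (\<Prod>p\<in>C. 1 + f p)"
  using prod_add[OF assms, of f "\<lambda>_. 1"] by (simp add: add.commute)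

text \<open>Selberg's diagonalisation. The products of g over union and intersection multiply to the
  product over A times the product over B, so A and B are coupled only through the inverse product
  over \<open>A \<inter> B\<close>. This inverse expands into the sum over
  \<open>C \<subseteq> A \<inter> B\<close> of the products of \<open>1 / g p - 1\<close>, and each
  C then contributes a square.\<close>

lemma quadratic_form_diagonal:
  fixes g :: "'a \<Rightarrow> real" and l :: "'a set \<Rightarrow> real"
  assumes fin: "finite \<D>" and finA: "\<And>A. A \<in> \<D> \<Longrightarrow> finite A"
    and down: "\<And>A B. B \<in> \<D> \<Longrightarrow> A \<subseteq> B \<Longrightarrow> A \<in> \<D>"
    and g: "\<And>A p. A \<in> \<D> \<Longrightarrow> p \<in> A \<Longrightarrow> g p \<noteq> 0"
  shows "(\<Sum>A\<in>\<D>. \<Sum>B\<in>\<D>. l A * l B * (\<Prod>p\<in>A \<union> B. g p))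
    = (\<Sum>C\<in>\<D>. (\<Prod>p\<in>C. 1 / g p - 1) * (\<Sum>A | A \<in> \<D> \<and> C \<subseteq> A. l A * (\<Prod>p\<in>A. g p))\<^sup>2)"
proof -
  let ?G = "\<lambda>A. \<Prod>p\<in>A. g p"
  let ?f = "\<lambda>C. \<Prod>p\<in>C. 1 / g p - 1"
  have key: "(\<Sum>C | C \<in> \<D> \<and> C \<subseteq> A \<and> C \<subseteq> B. ?f C) * (?G A * ?G B) = ?G (A \<union> B)"
    if A: "A \<in> \<D>" and B: "B \<in> \<D>" for A B
  proof -
    have e: "{C. C \<in> \<D> \<and> C \<subseteq> A \<and> C \<subseteq> B} = Pow (A \<inter> B)"
      using down A by auto
    have s1: "(\<Sum>C | C \<in> \<D> \<and> C \<subseteq> A \<and> C \<subseteq> B. ?f C) = 1 / ?G (A \<inter> B)"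
      unfolding e using prod_one_plus_Pow[of "A \<inter> B" "\<lambda>p. 1 / g p - 1"] finA A by (simp add: prod_dividef)
    have s2: "?G (A \<union> B) * ?G (A \<inter> B) = ?G A * ?G B"
      using prod.union_inter[of A B g] finA A B by simp
    have s3: "?G (A \<inter> B) \<noteq> 0" using g A finA by auto
    show ?thesis unfolding s1 s2[symmetric] using s3 by simp
  qed
  have "(\<Sum>C\<in>\<D>. ?f C * (\<Sum>A | A \<in> \<D> \<and> C \<subseteq> A. l A * ?G A)\<^sup>2)
      = (\<Sum>C\<in>\<D>. \<Sum>A\<in>\<D>. \<Sum>B\<in>\<D>. if C \<subseteq> A \<and> C \<subseteq> B then ?f C * (l A * ?G A) * (l B * ?G B) else 0)"
  proof (intro sum.cong refl)
    fix C assume "C \<in> \<D>"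
    have "(\<Sum>A | A \<in> \<D> \<and> C \<subseteq> A. l A * ?G A) = (\<Sum>A\<in>\<D>. if C \<subseteq> A then l A * ?G A else 0)"
      using fin by (simp add: sum.inter_filter)
    then show "?f C * (\<Sum>A | A \<in> \<D> \<and> C \<subseteq> A. l A * ?G A)\<^sup>2
      = (\<Sum>A\<in>\<D>. \<Sum>B\<in>\<D>. if C \<subseteq> A \<and> C \<subseteq> B then ?f C * (l A * ?G A) * (l B * ?G B) else 0)"
      by (auto simp: power2_eq_square sum_product sum_distrib_left mult_ac intro!: sum.cong)
  qed
  also have "\<dots> = (\<Sum>A\<in>\<D>. \<Sum>B\<in>\<D>. \<Sum>C\<in>\<D>. if C \<subseteq> A \<and> C \<subseteq> B then ?f C * (l A * ?G A) * (l B * ?G B) else 0)"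
    by (subst sum.swap, rule sum.cong[OF refl], rule sum.swap)
  also have "\<dots> = (\<Sum>A\<in>\<D>. \<Sum>B\<in>\<D>. l A * l B * ?G (A \<union> B))"
  proof (intro sum.cong refl)
    fix A B assume A: "A \<in> \<D>" and B: "B \<in> \<D>"
    have "(\<Sum>C\<in>\<D>. if C \<subseteq> A \<and> C \<subseteq> B then ?f C * (l A * ?G A) * (l B * ?G B) else 0)
       = (\<Sum>C | C \<in> \<D> \<and> C \<subseteq> A \<and> C \<subseteq> B. ?f C) * (?G A * ?G B) * (l A * l B)"
      unfolding sum.inter_filter[OF fin, symmetric] sum_distrib_right
      by (intro sum.cong refl) (simp add: mult_ac)
    then show "(\<Sum>C\<in>\<D>. if C \<subseteq> A \<and> C \<subseteq> B then ?f C * (l A * ?G A) * (l B * ?G B) else 0)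
       = l A * l B * ?G (A \<union> B)" using key[OF A B] by (simp add: mult_ac)
  qed
  finally show ?thesis ..
qed

text \<open>After interchanging the sums, the sets A between C and B contribute the product over C
  times an expansion over the subsets of \<open>B - C\<close>. For \<psi> = 1 this is Moebius
  inversion, where only B = C survives; a general \<psi> measures how far a local density deviates
  from the one for which \<open>lam\<close> is built.\<close>

lemma superset_inversion:
  fixes \<psi> :: "'a \<Rightarrow> real" and z :: "'a set \<Rightarrow> real"
  assumes fin: "finite \<D>" and finA: "\<And>A. A \<in> \<D> \<Longrightarrow> finite A"
    and down: "\<And>A B. B \<in> \<D> \<Longrightarrow> A \<subseteq> B \<Longrightarrow> A \<in> \<D>"
  shows "(\<Sum>A | A \<in> \<D> \<and> C \<subseteq> A. (\<Prod>p\<in>A. - \<psi> p) * (\<Sum>B | B \<in> \<D> \<and> A \<subseteq> B. z B))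
    = (\<Prod>p\<in>C. - \<psi> p) * (\<Sum>B | B \<in> \<D> \<and> C \<subseteq> B. z B * (\<Prod>p\<in>B - C. 1 - \<psi> p))"
proof -
  let ?P = "\<lambda>A. \<Prod>p\<in>A. - \<psi> p"
  have "(\<Sum>A | A \<in> \<D> \<and> C \<subseteq> A. ?P A * (\<Sum>B | B \<in> \<D> \<and> A \<subseteq> B. z B))
      = (\<Sum>A | A \<in> \<D> \<and> C \<subseteq> A. \<Sum>B | B \<in> \<D> \<and> A \<subseteq> B. ?P A * z B)"
    by (simp add: sum_distrib_left)
  also have "\<dots> = (\<Sum>B | B \<in> \<D> \<and> C \<subseteq> B. \<Sum>A | A \<in> \<D> \<and> C \<subseteq> A \<and> A \<subseteq> B. ?P A * z B)"
    using fin by (subst sum.Sigma, simp, simp, subst sum.Sigma, simp, simp,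
        intro sum.reindex_bij_witness[where i = "\<lambda>(x, y). (y, x)" and j = "\<lambda>(x, y). (y, x)"]) auto
  also have "\<dots> = (\<Sum>B | B \<in> \<D> \<and> C \<subseteq> B. ?P C * (z B * (\<Prod>p\<in>B - C. 1 - \<psi> p)))"
  proof (intro sum.cong refl)
    fix B assume "B \<in> {B. B \<in> \<D> \<and> C \<subseteq> B}"
    then have B: "B \<in> \<D>" "C \<subseteq> B" "finite B" using finA by auto
    have "(\<Sum>A | A \<in> \<D> \<and> C \<subseteq> A \<and> A \<subseteq> B. ?P A) = (\<Sum>E\<in>Pow (B - C). ?P C * ?P E)"
    proof (rule sum.reindex_bij_witness[where i = "\<lambda>E. C \<union> E" and j = "\<lambda>A. A - C"])
      fix A assume A: "A \<in> {A. A \<in> \<D> \<and> C \<subseteq> A \<and> A \<subseteq> B}"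
      then have "finite A" using B finite_subset by auto
      then have "?P A = ?P (A - C) * ?P C" using A by (intro prod.subset_diff) auto
      then show "?P C * ?P (A - C) = ?P A" by simp
    next
      fix E assume "E \<in> Pow (B - C)"
      then show "C \<union> E \<in> {A. A \<in> \<D> \<and> C \<subseteq> A \<and> A \<subseteq> B}" using B down[of B "C \<union> E"] by auto
    qed (use B in auto)
    also have "\<dots> = ?P C * (\<Prod>p\<in>B - C. 1 - \<psi> p)"
      using prod_one_plus_Pow[of "B - C" "\<lambda>p. - \<psi> p"] B by (simp add: sum_distrib_left[symmetric])
    finally show "(\<Sum>A | A \<in> \<D> \<and> C \<subseteq> A \<and> A \<subseteq> B. ?P A * z B) = ?P C * (z B * (\<Prod>p\<in>B - C. 1 - \<psi> p))"
      by (simp add: sum_distrib_right[symmetric])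
  qed
  finally show ?thesis by (simp add: sum_distrib_left)
qed

text \<open>Expanding the product splits C into A and \<open>C - A\<close>. On the right the
  disjointness of A and B is dropped, which only adds nonnegative terms; hence an inequality, and
  two independent summations.\<close>

lemma psets_convolution_le:
  fixes \<phi> \<psi> :: "nat \<Rightarrow> real"
  assumes \<phi>: "\<And>p. prime p \<Longrightarrow> D < p \<Longrightarrow> 0 \<le> \<phi> p" and \<psi>: "\<And>p. prime p \<Longrightarrow> D < p \<Longrightarrow> 0 \<le> \<psi> p"
    and F: "\<And>n. 0 \<le> F n"
  shows "(\<Sum>C\<in>psets D x. (\<Prod>p\<in>C. \<phi> p + \<psi> p) * F (sprod C))
     \<le> (\<Sum>A\<in>psets D x. (\<Prod>p\<in>A. \<phi> p) * (\<Sum>B\<in>psets D (x / sprod A). (\<Prod>p\<in>B. \<psi> p) * F (sprod A * sprod B)))"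
proof -
  have pos: "0 \<le> (\<Prod>p\<in>A. \<phi> p)" "0 \<le> (\<Prod>p\<in>A. \<psi> p)" if "A \<in> psets D y" for A y
    using that \<phi> \<psi> by (auto intro!: prod_nonneg dest: psetsD)
  let ?S = "Sigma (psets D x) Pow"
  let ?T = "Sigma (psets D x) (\<lambda>A. psets D (x / sprod A))"
  let ?t = "\<lambda>(A, B). (\<Prod>p\<in>A. \<phi> p) * ((\<Prod>p\<in>B. \<psi> p) * F (sprod A * sprod B))"
  let ?j = "\<lambda>(C, A). (A, C - A)"
  have split: "sprod C = sprod A * sprod (C - A)" if "C \<in> psets D x" "A \<subseteq> C" for C A
    using prod.subset_diff[of A C "\<lambda>x. x"] that psetsD(1)[OF that(1)] by (simp add: mult.commute sprod_def)
  have sub: "?j ` ?S \<subseteq> ?T"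
  proof (clarify)
    fix C A assume C: "C \<in> psets D x" and A: "A \<subseteq> C"
    have "real (sprod A) * real (sprod (C - A)) \<le> x" using split[OF C A] psetsD(4)[OF C] by simp
    moreover have "A \<in> psets D x" using C A psets_mono_set by blast
    ultimately have "real (sprod (C - A)) \<le> x / real (sprod A)"
      using psets_prod_ge1[of A D x] by (simp add: field_simps)
    then show "A \<in> psets D x \<and> C - A \<in> psets D (x / sprod A)"
      using C \<open>A \<in> psets D x\<close> by (auto simp: psets_def)
  qed
  have inj: "inj_on ?j ?S" by (auto simp: inj_on_def)
  have "(\<Sum>C\<in>psets D x. (\<Prod>p\<in>C. \<phi> p + \<psi> p) * F (sprod C)) = (\<Sum>C\<in>psets D x. \<Sum>A\<in>Pow C. ?t (?j (C, A)))"
  proof (intro sum.cong refl)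
    fix C assume C: "C \<in> psets D x"
    show "(\<Prod>p\<in>C. \<phi> p + \<psi> p) * F (sprod C) = (\<Sum>A\<in>Pow C. ?t (?j (C, A)))"
      unfolding prod_add[OF psetsD(1)[OF C]] sum_distrib_right
      by (intro sum.cong refl) (use split[OF C] in \<open>simp add: mult.assoc\<close>)
  qed
  also have "\<dots> = (\<Sum>y\<in>?S. ?t (?j y))"
    by (subst sum.Sigma) (auto dest: psetsD simp: case_prod_unfold)
  also have "\<dots> = sum ?t (?j ` ?S)" by (simp only: sum.reindex[OF inj] o_def)
  also have "\<dots> \<le> sum ?t ?T"
    using pos F by (intro sum_mono2[OF _ sub]) (auto intro!: mult_nonneg_nonneg)
  also have "\<dots> = (\<Sum>A\<in>psets D x. (\<Prod>p\<in>A. \<phi> p) * (\<Sum>B\<in>psets D (x / sprod A). (\<Prod>p\<in>B. \<psi> p) * F (sprod A * sprod B)))"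
    by (subst sum.Sigma[symmetric]) (auto simp: sum_distrib_left)
  finally show ?thesis .
qed

section \<open>Elementary divisor-sum bounds\<close>

lemma harmonic_le:
  assumes "1 \<le> x"
  shows "(\<Sum>n | 1 \<le> n \<and> real n \<le> x. 1 / real n) \<le> 1 + ln x"
proof -
  have e: "{n. 1 \<le> n \<and> real n \<le> x} = {1..nat \<lfloor>x\<rfloor>}" using assms by (auto simp: le_nat_floor) linarith
  have "(\<Sum>n=1..m. 1 / real n) \<le> 1 + ln m" if "m \<ge> 1" for m
    using that
  proof (induction m rule: dec_induct)
    case (step m)
    have "ln (real m / real (Suc m)) \<le> real m / real (Suc m) - 1"
      using step by (intro ln_le_minus_one) auto
    also have "\<dots> = - (1 / real (Suc m))" by (simp add: field_simps)
    finally have "ln (real m) - ln (real (Suc m)) \<le> - (1 / real (Suc m))" using step by (simp add: ln_div)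
    then show ?case using step by simp
  qed simp
  from this[of "nat \<lfloor>x\<rfloor>"] have "(\<Sum>n | 1 \<le> n \<and> real n \<le> x. 1 / real n) \<le> 1 + ln (nat \<lfloor>x\<rfloor>)"
    unfolding e using assms by (simp add: le_nat_floor)
  also have "\<dots> \<le> 1 + ln x" using assms by simp
  finally show ?thesis .
qed

lemma psets_sum_le_integers:
  fixes F :: "nat \<Rightarrow> real"
  assumes "\<And>n. n \<in> X \<Longrightarrow> 0 \<le> F n" and "\<And>C. C \<in> \<C> \<Longrightarrow> sprod C \<in> X" and "\<C> \<subseteq> psets D x"
    and "finite X"
  shows "(\<Sum>C\<in>\<C>. F (sprod C)) \<le> (\<Sum>n\<in>X. F n)"
proof -
  have inj: "inj_on sprod \<C>"
    by (rule inj_on_subset[OF inj_on_sprod]) (use assms in \<open>auto simp: psets_def\<close>)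
  have "(\<Sum>C\<in>\<C>. F (sprod C)) = (\<Sum>n\<in>sprod ` \<C>. F n)"
    by (simp add: sum.reindex[OF inj])
  also have "\<dots> \<le> (\<Sum>n\<in>X. F n)"
    using assms by (intro sum_mono2) auto
  finally show ?thesis .
qed

lemma psets_harmonic_le:
  assumes "1 \<le> x"
  shows "(\<Sum>C\<in>psets D x. 1 / real (sprod C)) \<le> 1 + ln x"
proof -
  have fin: "finite {n. 1 \<le> n \<and> real n \<le> x}"
    by (rule finite_subset[of _ "{..nat \<lfloor>x\<rfloor>}"]) (auto simp: le_nat_floor)
  have "(\<Sum>C\<in>psets D x. 1 / real (sprod C)) \<le> (\<Sum>n | 1 \<le> n \<and> real n \<le> x. 1 / real n)"
    by (rule psets_sum_le_integers[where D = D and x = x])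
       (use fin psets_prod_pos in \<open>auto dest: psetsD simp: Suc_le_eq\<close>)
  also have "\<dots> \<le> 1 + ln x" by (rule harmonic_le[OF assms])
  finally show ?thesis .
qed

text \<open>A bound for a K-fold divisor function on squarefree numbers.
  \<open>Suc K / p = K / p + 1 / p\<close> and the convolution bound peel off one harmonic sum,
  hence one factor \<open>1 + ln x\<close>, per induction step.\<close>

lemma psets_power_sum_le:
  assumes "1 \<le> x"
  shows "(\<Sum>C\<in>psets D x. real K ^ card C / real (sprod C)) \<le> (1 + ln x) ^ K"
proof -
  have e: "(\<Prod>p\<in>C. real K / real p) = real K ^ card C / real (sprod C)" for C K
    by (simp add: sprod_def prod_dividef)
  have "(\<Sum>C\<in>psets D x. \<Prod>p\<in>C. real K / real p) \<le> (1 + ln x) ^ K"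
  proof (induction K)
    case 0
    have "(\<Sum>C\<in>psets D x. \<Prod>p\<in>C. real 0 / real p) = (\<Sum>C\<in>psets D x. if C = {} then 1 else 0)"
      by (intro sum.cong refl) (auto dest: psetsD)
    then show ?case by simp
  next
    case (Suc K)
    have ee: "real (Suc K) / real p = real K / real p + 1 / real p" for p
      by (simp add: add_divide_distrib)
    have "(\<Sum>C\<in>psets D x. \<Prod>p\<in>C. real (Suc K) / real p)
        \<le> (\<Sum>A\<in>psets D x. (\<Prod>p\<in>A. real K / real p) * (\<Sum>B\<in>psets D (x / sprod A). \<Prod>p\<in>B. 1 / real p))"
      unfolding ee
      using psets_convolution_le[of D "\<lambda>p. real K / real p" "\<lambda>p. 1 / real p" "\<lambda>_. 1" x] by simp
    also have "\<dots> \<le> (\<Sum>A\<in>psets D x. (\<Prod>p\<in>A. real K / real p) * (1 + ln x))"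
    proof (intro sum_mono mult_left_mono prod_nonneg)
      fix A assume A: "A \<in> psets D x"
      then have b: "1 \<le> x / sprod A" "x / sprod A \<le> x"
        using psets_prod_ge1[OF A] psetsD(4)[OF A] by (auto simp: field_simps)
      have "(\<Sum>B\<in>psets D (x / sprod A). \<Prod>p\<in>B. 1 / real p) \<le> 1 + ln (x / sprod A)"
        using psets_harmonic_le[OF b(1), of D] e[of 1] by simp
      also have "\<dots> \<le> 1 + ln x" using b by simp
      finally show "(\<Sum>B\<in>psets D (x / sprod A). \<Prod>p\<in>B. 1 / real p) \<le> 1 + ln x" .
    qed auto
    also have "\<dots> \<le> (1 + ln x) ^ K * (1 + ln x)"
      unfolding sum_distrib_right[symmetric] using Suc assms by (intro mult_right_mono) auto
    finally show ?case by (simp add: mult.commute)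
  qed
  then show ?thesis by (simp add: e)
qed

section \<open>Harmonic sums\<close>

lemma smooth_inverse_sum_le:
  assumes "finite G" "\<And>p. p \<in> G \<Longrightarrow> prime (p::nat)" "finite X"
    "\<And>n. n \<in> X \<Longrightarrow> 0 < n \<and> prime_factors n \<subseteq> G"
  shows "(\<Sum>n\<in>X. 1 / real n) \<le> (\<Prod>p\<in>G. real p / (real p - 1))"
  using assms
proof (induction G arbitrary: X rule: finite_induct)
  case empty
  have "n = 1" if n: "n \<in> X" for n
  proof -
    have "prime_factorization n = {#}" "n \<noteq> 0" using empty.prems(3)[OF n] by auto
    then show ?thesis by (simp add: prime_factorization_empty_iff)
  qed
  then have "X \<subseteq> {1}" by auto
  then have "(\<Sum>n\<in>X. 1 / real n) \<le> (\<Sum>n\<in>{1}. 1 / real n)" by (intro sum_mono2) auto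
  then show ?case by simp
next
  case (insert p G)
  have p: "prime p" using insert.prems by auto
  then have p2: "2 \<le> p" by (rule prime_ge_2_nat)
  define c where "c n = n div p ^ multiplicity p n" for n
  define L where "L = Max (multiplicity p ` X)"
  have dec: "n = p ^ multiplicity p n * c n" for n
    unfolding c_def by (simp add: multiplicity_dvd)
  have cX: "0 < m \<and> prime_factors m \<subseteq> G" if "m \<in> c ` X" for m
  proof -
    from that obtain n where n: "n \<in> X" "m = c n" by auto
    have n0: "0 < n" "prime_factors n \<subseteq> insert p G" using insert.prems n by auto
    have m0: "0 < m" using dec[of n] n n0 by (metis gr0I mult_0_right)
    have mn: "m dvd n" using dec[of n] n by (metis dvd_triv_right)
    have "\<not> p dvd m" using multiplicity_decompose[of n p] n n0 p2 unfolding c_def by auto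
    then have "p \<notin> prime_factors m" by auto
    moreover have "prime_factors m \<subseteq> prime_factors n"
      using mn n0 by (intro dvd_prime_factors) auto
    ultimately show ?thesis using m0 n0 by auto
  qed
  have "(\<Sum>n\<in>X. 1 / real n) \<le> (\<Sum>y\<in>{..L} \<times> c ` X. (1 / real p) ^ fst y * (1 / real (snd y)))"
  proof (rule sum_le_included[where i = "\<lambda>(e, m). p ^ e * m"])
    show "\<forall>n\<in>X. \<exists>y\<in>{..L} \<times> c ` X. (case y of (e, m) \<Rightarrow> p ^ e * m) = n \<and> 1 / real n \<le> (1 / real p) ^ fst y * (1 / real (snd y))"
    proof
      fix n assume n: "n \<in> X"
      have "real n = real p ^ multiplicity p n * real (c n)"
        using arg_cong[OF dec[of n], of real] by simp
      then have "1 / real n = (1 / real p) ^ multiplicity p n * (1 / real (c n))"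
        by (simp add: power_one_over field_simps)
      moreover have "multiplicity p n \<le> L" unfolding L_def using n insert.prems by auto
      ultimately show "\<exists>y\<in>{..L} \<times> c ` X. (case y of (e, m) \<Rightarrow> p ^ e * m) = n \<and> 1 / real n \<le> (1 / real p) ^ fst y * (1 / real (snd y))"
        using n dec[of n] by (intro bexI[of _ "(multiplicity p n, c n)"]) auto
    qed
  qed (use insert.prems in auto)
  also have "\<dots> = (\<Sum>e\<le>L. (1 / real p) ^ e) * (\<Sum>m\<in>c ` X. 1 / real m)"
    by (simp add: sum_product sum.cartesian_product case_prod_unfold)
  also have "\<dots> \<le> (real p / (real p - 1)) * (\<Prod>p\<in>G. real p / (real p - 1))"
  proof (intro mult_mono)
    have "(\<Sum>e\<le>L. (1 / real p) ^ e) \<le> (\<Sum>e. (1 / real p) ^ e)"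
      using p2 by (intro sum_le_suminf summable_geometric) auto
    also have "\<dots> = 1 / (1 - 1 / real p)" using p2 by (subst suminf_geometric) auto
    also have "\<dots> = real p / (real p - 1)" using p2 by (simp add: field_simps)
    finally show "(\<Sum>e\<le>L. (1 / real p) ^ e) \<le> real p / (real p - 1)" .
    show "(\<Sum>m\<in>c ` X. 1 / real m) \<le> (\<Prod>p\<in>G. real p / (real p - 1))"
      using insert.prems cX by (intro insert.IH) auto
  qed (use p2 in \<open>auto intro!: sum_nonneg\<close>)
  finally show ?case using insert.hyps by simp
qed

lemma finite_nat_le_real [simp]: "finite {n. P n \<and> real n \<le> x}"
  by (rule finite_subset[of _ "{..nat \<lfloor>x\<rfloor>}"]) (auto simp: le_nat_floor)

text \<open>Serves as a lower bound for a sum over squarefree m avoiding the primes up to D and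
  those of C: up to an explicit Euler product it dominates a sum over all integers, which needs no
  sieve. The weights \<open>1 / (p - 1)\<close> are those for which repeated prime factors are
  accounted for exactly.\<close>

lemma antimono_harmonic_le_psets:
  fixes F :: "nat \<Rightarrow> real" and D :: nat
  assumes F0: "\<And>n. 1 \<le> n \<Longrightarrow> real n \<le> x \<Longrightarrow> 0 \<le> F n"
    and Fmono: "\<And>m n. 1 \<le> m \<Longrightarrow> m \<le> n \<Longrightarrow> real n \<le> x \<Longrightarrow> F n \<le> F m"
    and C: "finite C" "\<And>p. p \<in> C \<Longrightarrow> prime p"
  defines "G \<equiv> {p. prime p \<and> p \<le> D} \<union> C"
  shows "(\<Sum>n | 1 \<le> n \<and> real n \<le> x. F n / real n)
    \<le> (\<Prod>p\<in>G. real p / (real p - 1)) *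
       (\<Sum>m | m \<in> psets D x \<and> m \<inter> C = {}. (\<Prod>p\<in>m. 1 / (real p - 1)) * F (sprod m))"
proof -
  have fG: "finite G" unfolding G_def using C by auto
  let ?X = "{n. 1 \<le> n \<and> real n \<le> x}" and ?M = "{m. m \<in> psets D x \<and> m \<inter> C = {}}"
  let ?r = "\<lambda>n. prime_factors n - G"
  have rdvd: "sprod (?r n) dvd n" if "1 \<le> n" for n
  proof -
    have "\<Prod>(prime_factors n) dvd n"
    proof -
      have "\<Prod>(prime_factors n) dvd (\<Prod>p\<in>prime_factors n. p ^ multiplicity p n)"
        by (intro prod_dvd_prod dvd_power) (auto simp: prime_factors_multiplicity)
      then show ?thesis using prime_factorization_nat[of n] that by simp
    qed
    moreover have "sprod (?r n) dvd \<Prod>(prime_factors n)"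
      unfolding sprod_def by (intro prod_dvd_prod_subset) auto
    ultimately show ?thesis using dvd_trans by blast
  qed
  have rM: "?r n \<in> ?M" if n: "n \<in> ?X" for n
  proof -
    have "sprod (?r n) \<le> n" using rdvd[of n] n by (auto intro: dvd_imp_le)
    then have "real (sprod (?r n)) \<le> x" using n by (auto intro: order_trans[of _ "real n"])
    then show ?thesis unfolding psets_def G_def by (auto simp: not_le)
  qed
  \<comment> \<open>Group the n by the set m of their prime factors outside G, and use \<open>F n \<le> F (sprod m)\<close>.\<close>
  have "(\<Sum>n\<in>?X. F n / real n) = (\<Sum>m\<in>?M. \<Sum>n | n \<in> ?X \<and> ?r n = m. F n / real n)"
    using rM by (intro sum.group[symmetric]) auto
  also have "\<dots> \<le> (\<Sum>m\<in>?M. (\<Prod>p\<in>G. real p / (real p - 1)) * ((\<Prod>p\<in>m. 1 / (real p - 1)) * F (sprod m)))"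
  proof (intro sum_mono)
    fix m assume m: "m \<in> ?M"
    then have mp: "finite m" "\<And>p. p \<in> m \<Longrightarrow> prime p" "m \<inter> G = {}"
      by (auto dest: psetsD simp: G_def)
    have m1: "1 \<le> sprod m" "real (sprod m) \<le> x" using m psets_prod_pos[of m D x] by (auto dest: psetsD simp: Suc_le_eq)
    have Fm: "0 \<le> F (sprod m)" using F0 m1 by auto
    let ?Y = "{n. n \<in> ?X \<and> ?r n = m}"
    have "(\<Sum>n\<in>?Y. F n / real n) \<le> (\<Sum>n\<in>?Y. F (sprod m) * (1 / real n))"
    proof (intro sum_mono)
      fix n assume n: "n \<in> ?Y"
      then have "sprod m \<le> n" using rdvd[of n] by (auto intro: dvd_imp_le)
      then have "F n \<le> F (sprod m)" using Fmono[of "sprod m" n] n m1 by auto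
      then show "F n / real n \<le> F (sprod m) * (1 / real n)" by (simp add: divide_right_mono)
    qed
    also have "\<dots> = F (sprod m) * (\<Sum>n\<in>?Y. 1 / real n)" by (simp add: sum_distrib_left)
    also have "(\<Sum>n\<in>?Y. 1 / real n) = (\<Sum>n\<in>(\<lambda>n. n div sprod m) ` ?Y. 1 / real (sprod m) * (1 / real n))"
    proof (subst sum.reindex)
      show "inj_on (\<lambda>n. n div sprod m) ?Y"
      proof (rule inj_onI)
        fix a b assume ab: "a \<in> ?Y" "b \<in> ?Y" "a div sprod m = b div sprod m"
        then have "sprod m dvd a" "sprod m dvd b" using rdvd[of a] rdvd[of b] by auto
        then show "a = b" using ab(3) by (metis dvd_div_mult_self)
      qed
      show "(\<Sum>n\<in>?Y. 1 / real n) = sum ((\<lambda>n. 1 / real (sprod m) * (1 / real n)) \<circ> (\<lambda>n. n div sprod m)) ?Y"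
      proof (intro sum.cong refl)
        fix n assume n: "n \<in> ?Y"
        then have "sprod m dvd n" using rdvd[of n] by auto
        then have "n = sprod m * (n div sprod m)" by simp
        then have "real n = real (sprod m) * real (n div sprod m)" by (metis of_nat_mult)
        then show "1 / real n = ((\<lambda>n. 1 / real (sprod m) * (1 / real n)) \<circ> (\<lambda>n. n div sprod m)) n" by simp
      qed
    qed
    also have "\<dots> = 1 / real (sprod m) * (\<Sum>n\<in>(\<lambda>n. n div sprod m) ` ?Y. 1 / real n)"
      by (simp add: sum_distrib_left)
    \<comment> \<open>The quotient may still contain primes of m, so its prime factors lie in
      \<open>G \<union> m\<close>. The Euler factors at m times \<open>1 / sprod m\<close> become
      the weights \<open>1 / (p - 1)\<close>.\<close>
    also have "F (sprod m) * \<dots> \<le> F (sprod m) * (1 / real (sprod m) * (\<Prod>p\<in>G \<union> m. real p / (real p - 1)))"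
    proof (intro mult_left_mono smooth_inverse_sum_le)
      fix q assume "q \<in> (\<lambda>n. n div sprod m) ` ?Y"
      then obtain n where n: "n \<in> ?Y" "q = n div sprod m" by auto
      then have d: "sprod m dvd n" using rdvd[of n] by auto
      have "q dvd n" using d n by (metis dvd_div_mult_self dvd_triv_left)
      then have "prime_factors q \<subseteq> prime_factors n" using n by (intro dvd_prime_factors) auto
      moreover have "0 < q"
      proof -
        have "n = sprod m * q" "0 < n" using n d by auto
        then show ?thesis by (metis gr0I mult_0_right)
      qed
      ultimately show "0 < q \<and> prime_factors q \<subseteq> G \<union> m" using n by auto
    next
      show "finite ((\<lambda>n. n div sprod m) ` ?Y)"
        by (rule finite_imageI, rule finite_subset[of _ ?X]) auto
    qed (use Fm fG mp C in \<open>auto simp: G_def\<close>)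
    also have "1 / real (sprod m) * (\<Prod>p\<in>G \<union> m. real p / (real p - 1))
      = (\<Prod>p\<in>G. real p / (real p - 1)) * (\<Prod>p\<in>m. 1 / (real p - 1))"
    proof -
      have "(\<Prod>p\<in>m. real p / (real p - 1)) = real (sprod m) * (\<Prod>p\<in>m. 1 / (real p - 1))"
        by (simp add: sprod_def prod.distrib[symmetric])
      then show ?thesis using m1 mp fG
        by (simp add: prod.union_disjoint Int_commute)
    qed
    finally show "(\<Sum>n\<in>?Y. F n / real n) \<le> (\<Prod>p\<in>G. real p / (real p - 1)) * ((\<Prod>p\<in>m. 1 / (real p - 1)) * F (sprod m))"
      by (simp add: mult_ac)
  qed
  finally show ?thesis by (simp add: sum_distrib_left)
qed

text \<open>Comparison of a decreasing function g with its antiderivative G, normalised so that G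
  vanishes at y. The loss in the upper bound is the first term,
  \<open>g 1 = ln y ^ j\<close>.\<close>

lemma log_power_sum_bounds:
  fixes y :: real
  assumes "1 \<le> y"
  shows "ln y ^ (j + 1) / real (j + 1) \<le> (\<Sum>n | 1 \<le> n \<and> real n \<le> y. ln (y / real n) ^ j / real n)"
    and "(\<Sum>n | 1 \<le> n \<and> real n \<le> y. ln (y / real n) ^ j / real n) \<le> ln y ^ (j + 1) / real (j + 1) + ln y ^ j"
proof -
  define G where "G t = - (ln (y / t) ^ (j + 1)) / real (j + 1)" for t
  define g where "g t = ln (y / t) ^ j / t" for t
  have der: "(G has_real_derivative g t) (at t)" if "0 < t" for t
  proof -
    have "((\<lambda>t. ln (y / t)) has_real_derivative - (1 / t)) (at t)"
      using that assms by (auto intro!: derivative_eq_intros simp: field_simps)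
    from DERIV_power[OF this, of "j + 1"]
    have "((\<lambda>t. ln (y / t) ^ (j + 1)) has_real_derivative - (real (j + 1) * g t)) (at t)"
      by (simp add: g_def)
    from DERIV_cdivide[OF DERIV_minus[OF this], of "real (j + 1)"] show ?thesis
      unfolding G_def by simp
  qed
  have anti: "g b \<le> g a" if "1 \<le> a" "a \<le> b" "b \<le> y" for a b
    unfolding g_def using that assms
    by (intro frac_le power_mono ln_ge_zero zero_le_power) (auto simp: field_simps frac_le)
  have g0: "0 \<le> g t" if "1 \<le> t" "t \<le> y" for t
    unfolding g_def using that by (auto intro!: divide_nonneg_nonneg zero_le_power ln_ge_zero simp: field_simps)
  have mvt: "G b - G a \<le> g a" "(b - a) * g b \<le> G b - G a" if "1 \<le> a" "a \<le> b" "b \<le> y" "b \<le> a + 1" for a b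
  proof -
    have "G b - G a \<le> g a \<and> (b - a) * g b \<le> G b - G a"
    proof (cases "a = b")
      case True then show ?thesis using g0[of a] that by auto
    next
      case False
      then have "a < b" using that by simp
      have d: "(G has_real_derivative g t) (at t)" if "a \<le> t" "t \<le> b" for t
        using that \<open>1 \<le> a\<close> by (intro der) auto
      then obtain z where z: "a < z" "z < b" "G b - G a = (b - a) * g z"
        using MVT2[OF \<open>a < b\<close> d] by blast
      have "(b - a) * g z \<le> 1 * g a" using z that g0[of z] anti[of a z] by (intro mult_mono) auto
      moreover have "(b - a) * g b \<le> (b - a) * g z" using z that anti[of z b] by (intro mult_left_mono) auto
      ultimately show ?thesis using z by simp
    qed
    then show "G b - G a \<le> g a" "(b - a) * g b \<le> G b - G a" by auto
  qed
  define m where "m = nat \<lfloor>y\<rfloor>"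
  have m: "1 \<le> m" "real m \<le> y" "y \<le> real m + 1" unfolding m_def using assms by (auto simp: le_nat_floor)
  have e: "{n. 1 \<le> n \<and> real n \<le> y} = {1..m}" unfolding m_def using assms by (auto simp: le_nat_floor) linarith
  have ind: "G (real i) - G 1 + g i \<le> (\<Sum>n=1..i. g (real n)) \<and> (\<Sum>n=1..i. g (real n)) \<le> g 1 + G (real i) - G 1"
    if "1 \<le> i" "i \<le> m" for i
    using that
  proof (induction i rule: dec_induct)
    case (step i)
    have "real (Suc i) \<le> y" using step.prems m by linarith
    then show ?case using step.IH step.prems step.hyps
        mvt(1)[of "real i" "real (Suc i)"] mvt(2)[of "real i" "real (Suc i)"]
      by auto
  qed auto
  have "G y = 0" unfolding G_def using assms by simp
  moreover have "G 1 = - (ln y ^ (j + 1) / real (j + 1))" unfolding G_def by simp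
  moreover have "g 1 = ln y ^ j" unfolding g_def by simp
  moreover have "G (real m) \<le> 0" unfolding G_def using m assms
    by (auto intro!: divide_nonneg_nonneg mult_nonneg_nonneg zero_le_power ln_ge_zero simp: field_simps)
  moreover have "G y - G (real m) \<le> g (real m)" using m mvt(1)[of "real m" y] by auto
  ultimately show "ln y ^ (j + 1) / real (j + 1) \<le> (\<Sum>n | 1 \<le> n \<and> real n \<le> y. ln (y / real n) ^ j / real n)"
    "(\<Sum>n | 1 \<le> n \<and> real n \<le> y. ln (y / real n) ^ j / real n) \<le> ln y ^ (j + 1) / real (j + 1) + ln y ^ j"
    using ind[of m] m unfolding e by (auto simp: g_def[symmetric])
qed

lemma abel_bound:
  fixes e F :: "nat \<Rightarrow> real"
  assumes E: "\<And>i. i \<le> m \<Longrightarrow> \<bar>\<Sum>n=1..i. e n\<bar> \<le> E"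
    and F: "\<And>i. 1 \<le> i \<Longrightarrow> i < m \<Longrightarrow> F (Suc i) \<le> F i" "0 \<le> F m" and m: "1 \<le> m"
  shows "\<bar>\<Sum>n=1..m. e n * F n\<bar> \<le> E * F 1"
proof -
  have *: "(\<Sum>n=1..m. e n * F n) = (\<Sum>n=1..<m. (\<Sum>i=1..n. e i) * (F n - F (Suc n))) + (\<Sum>i=1..m. e i) * F m"
    using m by (induction m rule: dec_induct) (auto simp: algebra_simps)
  have "\<bar>\<Sum>n=1..m. e n * F n\<bar> \<le> (\<Sum>n=1..<m. \<bar>(\<Sum>i=1..n. e i) * (F n - F (Suc n))\<bar>) + \<bar>(\<Sum>i=1..m. e i) * F m\<bar>"
    unfolding * by (rule order_trans[OF abs_triangle_ineq]) auto
  also have "\<dots> \<le> (\<Sum>n=1..<m. E * (F n - F (Suc n))) + E * F m"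
    unfolding abs_mult using F E by (intro add_mono sum_mono mult_mono) (auto intro: order_trans[OF abs_ge_zero])
  also have "\<dots> = E * F 1"
  proof -
    have "(\<Sum>n=1..<m. F n - F (Suc n)) = F 1 - F m"
      using m by (induction m rule: dec_induct) auto
    then have "(\<Sum>n=1..<m. E * (F n - F (Suc n))) = E * (F 1 - F m)"
      by (simp only: sum_distrib_left[symmetric])
    then show ?thesis by (simp add: algebra_simps)
  qed
  finally show ?thesis .
qed

section \<open>Mertens-type estimates and moments of sieve weights\<close>

lemma summable_ln_div_square: "summable (\<lambda>n::nat. ln (real n) / real n ^ 2)"
proof (rule summable_comparison_test)
  show "summable (\<lambda>n::nat. 2 * real n powr (-3/2))"
    by (intro summable_mult) (simp add: summable_real_powr_iff)
  show "\<exists>N. \<forall>n\<ge>N. norm (ln (real n) / real n ^ 2) \<le> 2 * real n powr (-3/2)"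
  proof (intro exI[of _ 1] allI impI)
    fix n :: nat assume n: "1 \<le> n"
    have "ln (real n) = 2 * ln (sqrt (real n))" using n by (simp add: ln_sqrt)
    also have "\<dots> \<le> 2 * sqrt (real n)" using n ln_le_minus_one[of "sqrt (real n)"] by simp
    also have "\<dots> = 2 * real n powr (1/2)" using n by (simp add: powr_half_sqrt)
    finally have "ln (real n) / real n ^ 2 \<le> 2 * real n powr (1/2) / real n ^ 2"
      by (rule divide_right_mono) simp
    also have "real n ^ 2 = real n powr 2" using n by (subst powr_numeral) auto
    also have "2 * real n powr (1/2) / real n powr 2 = 2 * (real n powr (1/2) / real n powr 2)" by simp
    also have "real n powr (1/2) / real n powr 2 = real n powr (-3/2)" by (simp only: powr_diff[symmetric]) simp
    finally show "norm (ln (real n) / real n ^ 2) \<le> 2 * real n powr (-3/2)" using n by simp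
  qed
qed

lemma ln_div_square_sum_bound:
  obtains Z :: real where "\<And>A::nat set. finite A \<Longrightarrow> (\<Sum>n\<in>A. ln (real n) / real n ^ 2) \<le> Z" "0 \<le> Z"
proof
  show "(\<Sum>n\<in>A. ln (real n) / real n ^ 2) \<le> (\<Sum>n::nat. ln (real n) / real n ^ 2)" if "finite A" for A :: "nat set"
  proof -
    have "0 \<le> ln (real n)" for n :: nat by (cases n) auto
    then show ?thesis using that by (intro sum_le_suminf summable_ln_div_square) auto
  qed
  from this[of "{}"] show "0 \<le> (\<Sum>n::nat. ln (real n) / real n ^ 2)" by simp
qed

text \<open>The series telescopes against \<open>1 / ln n\<close>. The factor 2 pays for replacing
  one \<open>ln n\<close> by \<open>ln (n + 1)\<close>, which is at most \<open>2 * ln n\<close>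
  since n + 1 is at most n squared from 2 on.\<close>

lemma inverse_ln_square_sum_le:
  assumes "2 \<le> m"
  shows "(\<Sum>n=2..<m. 1 / ((real n + 1) * ln (real n) ^ 2)) \<le> 2 * (1 / ln 2 - 1 / ln (real m))"
  using assms
proof (induction m rule: dec_induct)
  case (step n)
  have n: "2 \<le> n" using step by simp
  let ?a = "ln (real n)" and ?b = "ln (real n + 1)"
  have a0: "0 < ?a" and b0: "0 < ?b" using n by auto
  have "ln (real n + 1) \<le> ln (real n ^ 2)"
  proof -
    have "real n + 1 \<le> real n * 2" using n by simp
    also have "\<dots> \<le> real n * real n" using n by (intro mult_left_mono) auto
    finally show ?thesis using n by (subst ln_le_cancel_iff) (auto simp: power2_eq_square)
  qed
  then have b: "?b \<le> 2 * ?a" using n by (simp add: ln_realpow)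
  have "ln (real n / (real n + 1)) \<le> real n / (real n + 1) - 1" using n by (intro ln_le_minus_one) auto
  also have "\<dots> = - (1 / (real n + 1))" by (simp add: field_simps)
  finally have d: "1 / (real n + 1) \<le> ?b - ?a" using n by (simp add: ln_div)
  have "1 / ((real n + 1) * ?a ^ 2) = 1 / (real n + 1) * (1 / (?a * ?a))" by (simp add: power2_eq_square)
  also have "\<dots> \<le> (?b - ?a) * (2 / (?a * ?b))"
  proof (intro mult_mono d)
    have "1 / (?a * ?a) = 2 / (?a * (2 * ?a))" by simp
    also have "\<dots> \<le> 2 / (?a * ?b)" using a0 b0 b n by (intro divide_left_mono mult_left_mono mult_pos_pos) auto
    finally show "1 / (?a * ?a) \<le> 2 / (?a * ?b)" .
    show "0 \<le> ?b - ?a" using n by simp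
  qed (use a0 in auto)
  also have "\<dots> = 2 * (1 / ?a - 1 / ?b)" using a0 b0 by (simp add: field_simps)
  finally show ?case using step by (simp add: add.commute)
qed simp

text \<open>Partial summation turns the error of the prime number theorem into a sum over n of
  \<open>\<bar>S n\<bar> / (n * (n + 1))\<close>. A saving of two logarithms makes it comparable to
  the convergent sum of \<open>1 / (n * (ln n)\<^sup>2)\<close>; a single logarithm would not
  do.\<close>

lemma mertens_bounded:
  fixes K :: real
  assumes "\<And>N::nat. 2 \<le> N \<Longrightarrow> \<bar>(\<Sum>p | prime p \<and> p \<le> N. ln (real p)) - real N\<bar> \<le> K * real N / (ln (real N))\<^sup>2"
  obtains E where "\<And>m::nat. \<bar>\<Sum>n=1..m. (if prime n then ln (real n) else 0) / real n - 1 / real n\<bar> \<le> E"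
proof -
  have "0 \<le> K * real (2::nat) / (ln (real (2::nat)))\<^sup>2"
    by (rule order_trans[OF abs_ge_zero assms]) simp
  then have K: "0 \<le> K" by (simp add: zero_le_divide_iff zero_le_mult_iff)
  define t where "t n = (if prime n then ln (real n) else 0) - 1" for n :: nat
  define S where "S m = (\<Sum>n=1..m. t n)" for m :: nat
  have S: "S m = (\<Sum>p | prime p \<and> p \<le> m. ln (real p)) - real m" for m
  proof -
    have "{n \<in> {1..m}. prime n} = {p. prime p \<and> p \<le> m}" by (auto simp: Suc_le_eq prime_gt_0_nat)
    then have "(\<Sum>n=1..m. if prime n then ln (real n) else 0) = (\<Sum>p | prime p \<and> p \<le> m. ln (real p))"
      by (simp add: sum.inter_filter[symmetric])
    then show ?thesis unfolding S_def t_def by (simp add: sum_subtractf)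
  qed
  have Sb: "\<bar>S m\<bar> / real m \<le> K / (ln 2)\<^sup>2" "\<bar>S m\<bar> * (1 / real m - 1 / real (Suc m)) \<le> K * (1 / ((real m + 1) * ln (real m) ^ 2))"
    if m: "2 \<le> m" for m
  proof -
    have l: "0 < ln (real m)" "ln 2 \<le> ln (real m)" using m by auto
    have b: "\<bar>S m\<bar> \<le> K * real m / (ln (real m))\<^sup>2" using assms[OF m] S by simp
    then have b2: "\<bar>S m\<bar> / real m \<le> K / (ln (real m))\<^sup>2" using m by (simp add: field_simps)
    also have "\<dots> \<le> K / (ln 2)\<^sup>2" using l K by (intro divide_left_mono power_mono) auto
    finally show "\<bar>S m\<bar> / real m \<le> K / (ln 2)\<^sup>2" .
    have "\<bar>S m\<bar> * (1 / real m - 1 / real (Suc m)) = \<bar>S m\<bar> / real m * (1 / (real m + 1))"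
      using m by (simp add: field_simps)
    also have "\<dots> \<le> K / (ln (real m))\<^sup>2 * (1 / (real m + 1))" by (intro mult_right_mono b2) auto
    finally show "\<bar>S m\<bar> * (1 / real m - 1 / real (Suc m)) \<le> K * (1 / ((real m + 1) * ln (real m) ^ 2))"
      by (simp add: mult.commute)
  qed
  have abel: "(\<Sum>n=1..m. t n / real n) = (\<Sum>n=1..<m. S n * (1 / real n - 1 / real (Suc n))) + S m / real m"
    if "1 \<le> m" for m
    using that by (induction m rule: dec_induct) (auto simp: S_def algebra_simps add_divide_distrib)
  have "\<bar>\<Sum>n=1..m. t n / real n\<bar> \<le> 1 + 2 * K / ln 2 + K / (ln 2)\<^sup>2" for m
  proof (cases "2 \<le> m")
    case True
    have "\<bar>\<Sum>n=1..m. t n / real n\<bar> \<le> (\<Sum>n=1..<m. \<bar>S n\<bar> * (1 / real n - 1 / real (Suc n))) + \<bar>S m\<bar> / real m"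
    proof -
      have "\<bar>\<Sum>n=1..<m. S n * (1 / real n - 1 / real (Suc n))\<bar> \<le> (\<Sum>n=1..<m. \<bar>S n * (1 / real n - 1 / real (Suc n))\<bar>)"
        by (rule sum_abs)
      also have "\<dots> = (\<Sum>n=1..<m. \<bar>S n\<bar> * (1 / real n - 1 / real (Suc n)))"
        by (intro sum.cong refl) (auto simp: abs_mult field_simps)
      finally show ?thesis using abel[of m] True abs_triangle_ineq[of "\<Sum>n=1..<m. S n * (1 / real n - 1 / real (Suc n))" "S m / real m"]
        by simp
    qed
    also have "(\<Sum>n=1..<m. \<bar>S n\<bar> * (1 / real n - 1 / real (Suc n))) = 1 / 2 + (\<Sum>n=2..<m. \<bar>S n\<bar> * (1 / real n - 1 / real (Suc n)))"
      using True by (subst sum.atLeast_Suc_lessThan) (auto simp: S_def t_def numeral_2_eq_2)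
    also have "(\<Sum>n=2..<m. \<bar>S n\<bar> * (1 / real n - 1 / real (Suc n))) \<le> (\<Sum>n=2..<m. K * (1 / ((real n + 1) * ln (real n) ^ 2)))"
      using Sb(2) by (intro sum_mono) auto
    also have "\<dots> \<le> K * (2 * (1 / ln 2 - 1 / ln (real m)))"
      unfolding sum_distrib_left[symmetric] by (intro mult_left_mono inverse_ln_square_sum_le True K)
    also have "\<dots> \<le> 2 * K / ln 2" using K True by (simp add: algebra_simps)
    also have "\<bar>S m\<bar> / real m \<le> K / (ln 2)\<^sup>2" using Sb(1) True by simp
    finally show ?thesis by simp
  next
    case False
    then have "m = 0 \<or> m = 1" by auto
    then show ?thesis using K by (auto simp: t_def)
  qed
  then show ?thesis by (intro that) (simp add: t_def diff_divide_distrib)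
qed

text \<open>The coefficients at primes minus \<kappa> / n have bounded partial sums by Mertens, so
  partial summation against the decreasing \<open>ln (y / n) ^ j\<close> costs only its first value
  \<open>ln y ^ j\<close>. What remains is the harmonic sum with logarithmic powers.\<close>

lemma prime_log_weight_sum:
  fixes \<kappa> :: real and k D j :: nat
  assumes PNT: "\<And>N::nat. 2 \<le> N \<Longrightarrow> \<bar>(\<Sum>p | prime p \<and> p \<le> N. ln (real p)) - real N\<bar> \<le> K * real N / (ln (real N))\<^sup>2"
    and D: "2 * k \<le> D" and \<kappa>: "0 \<le> \<kappa>"
  obtains E where "0 \<le> E" "\<And>y. 1 \<le> y \<Longrightarrow>
    \<bar>(\<Sum>p | (prime p \<and> D < p) \<and> real p \<le> y. \<kappa> / (real p - real k) * ln (real p) * ln (y / real p) ^ j)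
       - \<kappa> * ln y ^ (j + 1) / real (j + 1)\<bar> \<le> E * ln y ^ j"
proof -
  obtain E0 where E0: "\<And>m::nat. \<bar>\<Sum>n=1..m. (if prime n then ln (real n) else 0) / real n - 1 / real n\<bar> \<le> E0"
    using mertens_bounded[OF PNT] by blast
  obtain Z where Z: "\<And>A::nat set. finite A \<Longrightarrow> (\<Sum>n\<in>A. ln (real n) / real n ^ 2) \<le> Z" "0 \<le> Z"
    using ln_div_square_sum_bound by blast
  define a where "a n = (if prime n \<and> D < n then \<kappa> / (real n - real k) * ln (real n) else 0)" for n :: nat
  define e where "e n = a n - \<kappa> / real n" for n :: nat
  define t where "t n = (if prime n then ln (real n) else 0) / real n - 1 / real n" for n :: nat
  \<comment> \<open>The part 2 * k pays for replacing p - k by p, the part D for the omitted primes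
    up to D, where 1 / n is at most D / n squared. Both belong to a convergent series.\<close>
  have r: "\<bar>e n - \<kappa> * t n\<bar> \<le> \<kappa> * (2 * k + D) * (ln (real n) / real n ^ 2)" if n: "1 \<le> n" for n
  proof -
    have ln0: "0 \<le> ln (real n)" using n by simp
    consider "\<not> prime n" | "prime n" "n \<le> D" | "prime n" "D < n" by linarith
    then show ?thesis
    proof cases
      case 1 then show ?thesis using ln0 \<kappa> by (simp add: e_def t_def a_def)
    next
      case 2
      have "\<bar>e n - \<kappa> * t n\<bar> = \<kappa> * real n * (ln (real n) / real n ^ 2)"
        using 2 n ln0 \<kappa> by (simp add: e_def t_def a_def power2_eq_square field_simps abs_mult)
      also have "\<dots> \<le> \<kappa> * (2 * k + D) * (ln (real n) / real n ^ 2)"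
        using 2 ln0 \<kappa> by (intro mult_right_mono mult_left_mono) auto
      finally show ?thesis .
    next
      case 3
      then have nk: "real n \<le> 2 * (real n - real k)" "0 < real n - real k" using D by auto
      have "e n - \<kappa> * t n = \<kappa> * ln (real n) * (1 / (real n - real k) - 1 / real n)"
        using 3 by (simp add: e_def t_def a_def algebra_simps)
      also have "1 / (real n - real k) - 1 / real n = real k / ((real n - real k) * real n)"
        using nk n by (simp add: field_simps)
      finally have eq: "e n - \<kappa> * t n = \<kappa> * ln (real n) * (real k / ((real n - real k) * real n))" .
      have "real k / ((real n - real k) * real n) \<le> 2 * real k / real n ^ 2"
        using nk n mult_right_mono[OF nk(1), of "real k * real n"] by (simp add: field_simps power2_eq_square)
      also have "\<dots> \<le> (2 * k + D) / real n ^ 2" by (intro divide_right_mono) auto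
      finally have "\<kappa> * ln (real n) * (real k / ((real n - real k) * real n)) \<le> \<kappa> * ln (real n) * ((2 * k + D) / real n ^ 2)"
        using \<kappa> ln0 by (intro mult_left_mono) auto
      moreover have "0 \<le> \<kappa> * ln (real n) * (real k / ((real n - real k) * real n))" using \<kappa> ln0 nk by auto
      ultimately show ?thesis unfolding eq by (simp only: abs_of_nonneg) (simp add: mult_ac)
    qed
  qed
  define E where "E = \<kappa> * E0 + \<kappa> * (2 * k + D) * Z"
  have Eb: "\<bar>\<Sum>n=1..m. e n\<bar> \<le> E" for m
  proof -
    have "(\<Sum>n=1..m. e n) = \<kappa> * (\<Sum>n=1..m. t n) + (\<Sum>n=1..m. e n - \<kappa> * t n)"
      by (simp add: sum_subtractf sum_distrib_left)
    also have "\<bar>\<dots>\<bar> \<le> \<kappa> * \<bar>\<Sum>n=1..m. t n\<bar> + (\<Sum>n=1..m. \<bar>e n - \<kappa> * t n\<bar>)"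
      using \<kappa> by (intro order_trans[OF abs_triangle_ineq] add_mono sum_abs) (simp add: abs_mult)
    also have "\<dots> \<le> \<kappa> * E0 + (\<Sum>n=1..m. \<kappa> * (2 * k + D) * (ln (real n) / real n ^ 2))"
      using E0[of m] \<kappa> r by (intro add_mono mult_left_mono sum_mono) (auto simp: t_def)
    also have "\<dots> \<le> E" unfolding E_def sum_distrib_left[symmetric]
      using Z(1)[of "{1..m}"] \<kappa> by (intro add_mono mult_left_mono) auto
    finally show ?thesis .
  qed
  have E0': "0 \<le> E" using Eb[of 0] by simp
  show ?thesis
  proof (rule that[of "E + \<kappa>"])
    show "0 \<le> E + \<kappa>" using E0' \<kappa> by simp
  next
    fix y :: real assume y: "1 \<le> y"
    define m where "m = nat \<lfloor>y\<rfloor>"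
    have m: "1 \<le> m" "real m \<le> y" unfolding m_def using y by (auto simp: le_nat_floor)
    have eset: "{n. 1 \<le> n \<and> real n \<le> y} = {1..m}" unfolding m_def using y by (auto simp: le_nat_floor) linarith
    have le: "ln (y / real b) ^ j \<le> ln (y / real c) ^ j" if "1 \<le> c" "c \<le> b" "b \<le> m" for b c
    proof -
      have b: "1 \<le> y / real b" using that m by (subst pos_le_divide_eq) auto
      have "y / real b \<le> y / real c" using that y by (intro divide_left_mono) auto
      then have "ln (y / real b) \<le> ln (y / real c)" using b by simp
      then show ?thesis using b by (intro power_mono ln_ge_zero)
    qed
    have ab: "\<bar>\<Sum>n=1..m. e n * ln (y / real n) ^ j\<bar> \<le> E * ln (y / real 1) ^ j"
    proof (rule abel_bound)
      have "1 \<le> y / real m" using m by (subst pos_le_divide_eq) auto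
      then show "0 \<le> ln (y / real m) ^ j" by simp
    next
      fix i assume "1 \<le> i" "i < m"
      then show "ln (y / real (Suc i)) ^ j \<le> ln (y / real i) ^ j" using le[of i "Suc i"] by simp
    qed (use Eb m in auto)
    have asum: "(\<Sum>n=1..m. a n * ln (y / real n) ^ j)
        = (\<Sum>p | (prime p \<and> D < p) \<and> real p \<le> y. \<kappa> / (real p - real k) * ln (real p) * ln (y / real p) ^ j)"
    proof -
      have "{p. (prime p \<and> D < p) \<and> real p \<le> y} = {n \<in> {1..m}. prime n \<and> D < n}"
      proof (rule Set.set_eqI)
        fix n :: nat
        have "n \<in> {1..m} \<longleftrightarrow> 1 \<le> n \<and> real n \<le> y" unfolding eset[symmetric] by simp
        then show "n \<in> {p. (prime p \<and> D < p) \<and> real p \<le> y} \<longleftrightarrow> n \<in> {n \<in> {1..m}. prime n \<and> D < n}"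
          using prime_ge_1_nat[of n] by blast
      qed
      then have "(\<Sum>p | (prime p \<and> D < p) \<and> real p \<le> y. \<kappa> / (real p - real k) * ln (real p) * ln (y / real p) ^ j)
        = (\<Sum>n=1..m. if prime n \<and> D < n then \<kappa> / (real n - real k) * ln (real n) * ln (y / real n) ^ j else 0)"
        by (simp only: sum.inter_filter finite_atLeastAtMost)
      also have "\<dots> = (\<Sum>n=1..m. a n * ln (y / real n) ^ j)"
        by (intro sum.cong refl) (simp add: a_def)
      finally show ?thesis by (rule sym)
    qed
    have esum: "(\<Sum>n=1..m. e n * ln (y / real n) ^ j)
       = (\<Sum>n=1..m. a n * ln (y / real n) ^ j) - \<kappa> * (\<Sum>n=1..m. ln (y / real n) ^ j / real n)"
      by (simp add: e_def algebra_simps sum_subtractf sum_distrib_left)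
    have dsum: "\<bar>\<kappa> * (\<Sum>n=1..m. ln (y / real n) ^ j / real n) - \<kappa> * ln y ^ (j + 1) / real (j + 1)\<bar> \<le> \<kappa> * ln y ^ j"
    proof -
      have "\<bar>(\<Sum>n=1..m. ln (y / real n) ^ j / real n) - ln y ^ (j + 1) / real (j + 1)\<bar> \<le> ln y ^ j"
        using log_power_sum_bounds[OF y, of j] unfolding eset by linarith
      then have "\<kappa> * \<bar>(\<Sum>n=1..m. ln (y / real n) ^ j / real n) - ln y ^ (j + 1) / real (j + 1)\<bar> \<le> \<kappa> * ln y ^ j"
        using \<kappa> by (intro mult_left_mono)
      moreover have "\<bar>\<kappa> * x - \<kappa> * u / v\<bar> = \<kappa> * \<bar>x - u / v\<bar>" for x u v :: real
        using \<kappa> by (metis abs_mult abs_of_nonneg right_diff_distrib times_divide_eq_right)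
      ultimately show ?thesis by simp
    qed
    show "\<bar>(\<Sum>p | (prime p \<and> D < p) \<and> real p \<le> y. \<kappa> / (real p - real k) * ln (real p) * ln (y / real p) ^ j)
       - \<kappa> * ln y ^ (j + 1) / real (j + 1)\<bar> \<le> (E + \<kappa>) * ln y ^ j"
      using ab dsum unfolding esum asum distrib_right by simp
  qed
qed

text \<open>Marking one prime of C: the pair (C, p) is exchanged for C without p together with a new
  prime p that still fits below the bound. This is the combinatorial form of
  \<open>ln n = (\<Sum>p. ln p)\<close> for squarefree n.\<close>

lemma sum_psets_elements:
  fixes f :: "nat set \<Rightarrow> nat \<Rightarrow> real"
  shows "(\<Sum>C\<in>psets D x. \<Sum>p\<in>C. f C p)
    = (\<Sum>C\<in>psets D x. \<Sum>p\<in>{p. (prime p \<and> D < p) \<and> real p \<le> x / sprod C} - C. f (insert p C) p)"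
proof -
  let ?Q = "\<lambda>C. {p. (prime p \<and> D < p) \<and> real p \<le> x / sprod C} - C"
  have "(\<Sum>C\<in>psets D x. \<Sum>p\<in>C. f C p) = (\<Sum>(C, p)\<in>Sigma (psets D x) (\<lambda>C. C). f C p)"
    by (subst sum.Sigma) (auto dest: psetsD)
  also have "\<dots> = (\<Sum>(C, p)\<in>Sigma (psets D x) ?Q. f (insert p C) p)"
  proof (rule sum.reindex_bij_witness[where i = "\<lambda>(C, p). (insert p C, p)" and j = "\<lambda>(C, p). (C - {p}, p)"], goal_cases)
    case (2 a)
    then obtain C p where a: "a = (C, p)" "C \<in> psets D x" "p \<in> C" by auto
    have "sprod C = p * sprod (C - {p})"
      using a psetsD(1)[OF a(2)] sprod_insert[of "C - {p}" p] by (simp add: insert_absorb)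
    then have "real p * real (sprod (C - {p})) \<le> x" using psetsD(4)[OF a(2)] by simp
    moreover have d: "C - {p} \<in> psets D x" using a psets_mono_set by blast
    ultimately have "real p \<le> x / sprod (C - {p})"
      using psets_prod_ge1[OF d] by (simp add: field_simps)
    then show ?case using a d psetsD[OF a(2)] by auto
  next
    case (4 b)
    then obtain C p where b: "b = (C, p)" "C \<in> psets D x" "p \<notin> C" "prime p" "D < p" "real p \<le> x / sprod C" by auto
    then have "real (p * sprod C) \<le> x" using psets_prod_ge1[OF b(2)] by (simp add: field_simps)
    then show ?case using b psetsD[OF b(2)] by (auto simp: psets_def)
  qed (auto simp: insert_absorb)
  also have "\<dots> = (\<Sum>C\<in>psets D x. \<Sum>p\<in>?Q C. f (insert p C) p)"
    by (subst sum.Sigma) auto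
  finally show ?thesis .
qed

text \<open>The numerator \<kappa> is the dimension. Both dimensions in use, k and k - 1, keep the
  denominator p - k, so that the two weight functions differ by a simple factor at each
  prime.\<close>

definition moment :: "nat \<Rightarrow> nat \<Rightarrow> real \<Rightarrow> nat \<Rightarrow> real \<Rightarrow> real" where
  "moment D k \<kappa> j x = (\<Sum>C\<in>psets D x. (\<Prod>p\<in>C. \<kappa> / (real p - real k)) * ln (x / sprod C) ^ j)"

lemma psets_weight_nonneg:
  assumes "C \<in> psets D x" "k \<le> D" "0 \<le> \<kappa>"
  shows "0 \<le> (\<Prod>p\<in>C. \<kappa> / (real p - real k))"
proof (intro prod_nonneg divide_nonneg_nonneg assms(3))
  fix p assume "p \<in> C"
  then have "D < p" using psetsD(3)[OF assms(1)] by auto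
  then show "0 \<le> real p - real k" using assms(2) by simp
qed

lemma psets_quotient_ge1: "C \<in> psets D x \<Longrightarrow> 1 \<le> x / sprod C"
  using psets_prod_ge1[of C D x] psetsD(4)[of C D x] by (simp add: field_simps)

lemma moment_nonneg: "k \<le> D \<Longrightarrow> 0 \<le> \<kappa> \<Longrightarrow> 0 \<le> moment D k \<kappa> j x"
  unfolding moment_def
  by (intro sum_nonneg mult_nonneg_nonneg psets_weight_nonneg zero_le_power ln_ge_zero psets_quotient_ge1)

lemma moment_zero_ge1:
  assumes "k \<le> D" "0 \<le> \<kappa>" "1 \<le> x"
  shows "1 \<le> moment D k \<kappa> 0 x"
proof -
  have "(\<Sum>C\<in>{{}}. (\<Prod>p\<in>C. \<kappa> / (real p - real k))) \<le> (\<Sum>C\<in>psets D x. (\<Prod>p\<in>C. \<kappa> / (real p - real k)))"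
    using assms psets_weight_nonneg[of _ D x k \<kappa>] by (intro sum_mono2) auto
  then show ?thesis unfolding moment_def by simp
qed

text \<open>Split \<open>ln x\<close> as \<open>ln (x / sprod C) + ln (sprod C)\<close>; the first
  part raises j by one, and the second, summed over the primes of C, reproduces the next moment with
  factor \<kappa> / (j + 1). The error is relative to the moment itself, so consecutive moments have
  ratio about \<open>ln x * (j + 1) / (j + 1 + \<kappa>)\<close> although no moment is
  evaluated.\<close>

lemma moment_recurrence:
  fixes \<kappa> :: real and k D j :: nat
  assumes PNT: "\<And>N::nat. 2 \<le> N \<Longrightarrow> \<bar>(\<Sum>p | prime p \<and> p \<le> N. ln (real p)) - real N\<bar> \<le> K * real N / (ln (real N))\<^sup>2"
    and D: "2 * k \<le> D" and \<kappa>: "0 \<le> \<kappa>"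
  obtains E where "\<And>x. 1 \<le> x \<Longrightarrow>
    \<bar>ln x * moment D k \<kappa> j x - (1 + \<kappa> / real (j + 1)) * moment D k \<kappa> (j + 1) x\<bar> \<le> E * moment D k \<kappa> j x"
proof -
  obtain E where E: "0 \<le> E" "\<And>y. 1 \<le> y \<Longrightarrow>
    \<bar>(\<Sum>p | (prime p \<and> D < p) \<and> real p \<le> y. \<kappa> / (real p - real k) * ln (real p) * ln (y / real p) ^ j)
       - \<kappa> * ln y ^ (j + 1) / real (j + 1)\<bar> \<le> E * ln y ^ j"
    using prime_log_weight_sum[OF PNT D \<kappa>, of j] by blast
  obtain Z where Z: "\<And>A::nat set. finite A \<Longrightarrow> (\<Sum>n\<in>A. ln (real n) / real n ^ 2) \<le> Z" "0 \<le> Z"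
    using ln_div_square_sum_bound by blast
  define a where "a p = \<kappa> / (real p - real k)" for p :: nat
  define w where "w C = (\<Prod>p\<in>C. a p)" for C
  have kD: "k \<le> D" using D by simp
  have a0: "0 \<le> a p" if "D < p" for p using that kD \<kappa> by (auto simp: a_def)
  have a2: "a p ^ 2 * ln (real p) \<le> 4 * \<kappa>\<^sup>2 * (ln (real p) / real p ^ 2)" if "D < p" for p
  proof -
    have nk: "real p \<le> 2 * (real p - real k)" "0 < real p - real k" using D that by auto
    then have "a p \<le> 2 * \<kappa> / real p"
      using \<kappa> mult_right_mono[OF nk(1) \<kappa>] that by (simp add: a_def field_simps)
    then have "a p ^ 2 \<le> (2 * \<kappa> / real p) ^ 2" using a0[OF that] by (intro power_mono)
    then have "a p ^ 2 * ln (real p) \<le> (2 * \<kappa> / real p) ^ 2 * ln (real p)"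
      using that by (intro mult_right_mono) auto
    then show ?thesis by (simp add: power_divide power_mult_distrib)
  qed
  have w0: "0 \<le> w C" if "C \<in> psets D x" for C x
    unfolding w_def a_def by (rule psets_weight_nonneg[OF that kD \<kappa>])
  show ?thesis
  proof (rule that[of "E + 4 * \<kappa>\<^sup>2 * Z"])
    fix x :: real assume x: "1 \<le> x"
    let ?Q = "\<lambda>C. {p. (prime p \<and> D < p) \<and> real p \<le> x / sprod C}"
    define L where "L C = ln (x / sprod C)" for C
    define T where "T i = moment D k \<kappa> i x" for i
    have T: "T i = (\<Sum>C\<in>psets D x. w C * L C ^ i)" for i
      unfolding T_def moment_def w_def a_def L_def ..
    have T0: "0 \<le> T j" unfolding T_def by (rule moment_nonneg[OF kD \<kappa>])
    have L0: "0 \<le> L C" if "C \<in> psets D x" for C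
      unfolding L_def using psets_quotient_ge1[OF that] by simp
    have Lins: "L (insert p C) = ln (x / sprod C / real p)" "0 \<le> L (insert p C)" "L (insert p C) \<le> L C"
      if C: "C \<in> psets D x" and p: "p \<in> ?Q C - C" for C p
    proof -
      have *: "x / sprod (insert p C) = x / sprod C / real p"
        using p psetsD(1)[OF C] by (simp add: mult.commute)
      have p0: "1 \<le> real p" using p prime_gt_0_nat[of p] by auto
      show "L (insert p C) = ln (x / sprod C / real p)" unfolding L_def * ..
      have "1 \<le> x / sprod C / real p" using p p0 by (subst pos_le_divide_eq) auto
      moreover have "x / sprod C / real p \<le> x / sprod C" using frac_le[of "x / sprod C" "x / sprod C" 1 "real p"] p0 psets_quotient_ge1[OF C] by simp
      ultimately show "0 \<le> L (insert p C)" "L (insert p C) \<le> L C" unfolding L_def * by auto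
    qed
    have wins: "w (insert p C) = a p * w C" if "C \<in> psets D x" "p \<notin> C" for p C
      using that psetsD(1)[OF that(1)] by (simp add: w_def)
    \<comment> \<open>Split \<open>ln (sprod C)\<close> over the primes of C and remove one prime; Y collects the primes dividing twice.\<close>
    define X where "X = (\<Sum>C\<in>psets D x. w C * ln (sprod C) * L C ^ j)"
    have X1: "ln x * T j - T (j + 1) = X"
    proof -
      have lnC: "ln (sprod C) = ln x - L C" if "C \<in> psets D x" for C
        unfolding L_def using x psets_prod_ge1[OF that] by (simp add: ln_div)
      have "X = (\<Sum>C\<in>psets D x. ln x * (w C * L C ^ j) - w C * L C ^ (j + 1))"
        unfolding X_def by (intro sum.cong refl, subst lnC, assumption) (simp add: algebra_simps)
      then show ?thesis unfolding T by (simp add: sum_subtractf sum_distrib_left)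
    qed
    have lnsprod: "ln (sprod C) = (\<Sum>p\<in>C. ln (real p))" if "C \<in> psets D x" for C
    proof -
      have "ln (\<Prod>p\<in>C. real p) = (\<Sum>p\<in>C. ln (real p))"
        using psetsD[OF that] prime_gt_0_nat by (intro ln_prod) auto
      then show ?thesis by (simp add: sprod_def)
    qed
    define f where "f C p = a p * ln (real p) * ln (x / sprod C / real p) ^ j" for C p
    have X2: "X = (\<Sum>C\<in>psets D x. w C * (\<Sum>p\<in>?Q C - C. f C p))"
    proof -
      have "X = (\<Sum>C\<in>psets D x. \<Sum>p\<in>C. w C * ln (real p) * L C ^ j)"
        unfolding X_def by (intro sum.cong refl) (simp add: lnsprod sum_distrib_left sum_distrib_right)
      also have "\<dots> = (\<Sum>C\<in>psets D x. \<Sum>p\<in>?Q C - C. w (insert p C) * ln (real p) * L (insert p C) ^ j)"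
        by (rule sum_psets_elements)
      also have "\<dots> = (\<Sum>C\<in>psets D x. \<Sum>p\<in>?Q C - C. w C * f C p)"
        by (intro sum.cong refl) (use Lins(1) wins in \<open>auto simp: f_def\<close>)
      finally show ?thesis by (simp add: sum_distrib_left)
    qed
    define V where "V C = (\<Sum>p\<in>?Q C. f C p)" for C
    define Y where "Y = (\<Sum>C\<in>psets D x. w C * (\<Sum>p\<in>?Q C \<inter> C. f C p))"
    have XY: "X = (\<Sum>C\<in>psets D x. w C * V C) - Y"
    proof -
      have "(\<Sum>p\<in>?Q C - C. f C p) = V C - (\<Sum>p\<in>?Q C \<inter> C. f C p)" for C
        unfolding V_def by (subst sum.Int_Diff[of "?Q C" _ C]) auto
      then show ?thesis unfolding X2 Y_def by (simp add: right_diff_distrib sum_subtractf)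
    qed
    have V: "\<bar>(\<Sum>C\<in>psets D x. w C * V C) - \<kappa> / real (j + 1) * T (j + 1)\<bar> \<le> E * T j"
    proof -
      have "\<bar>(\<Sum>C\<in>psets D x. w C * V C) - \<kappa> / real (j + 1) * T (j + 1)\<bar>
          = \<bar>\<Sum>C\<in>psets D x. w C * (V C - \<kappa> * L C ^ (j + 1) / real (j + 1))\<bar>"
        unfolding T sum_distrib_left sum_subtractf[symmetric] by (intro arg_cong[of _ _ abs] sum.cong refl) (simp add: algebra_simps)
      also have "\<dots> \<le> (\<Sum>C\<in>psets D x. w C * (E * L C ^ j))"
      proof (intro order_trans[OF sum_abs] sum_mono)
        fix C assume C: "C \<in> psets D x"
        have "\<bar>V C - \<kappa> * L C ^ (j + 1) / real (j + 1)\<bar> \<le> E * L C ^ j"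
          unfolding V_def f_def a_def L_def using E(2)[OF psets_quotient_ge1[OF C]] by simp
        then show "\<bar>w C * (V C - \<kappa> * L C ^ (j + 1) / real (j + 1))\<bar> \<le> w C * (E * L C ^ j)"
          using w0[OF C] by (simp add: abs_mult mult_left_mono)
      qed
      also have "\<dots> = E * T j" unfolding T by (simp add: sum_distrib_left mult_ac)
      finally show ?thesis .
    qed
    have f0: "0 \<le> f C p" if "C \<in> psets D x" "p \<in> ?Q C" for C p
    proof -
      have p0: "1 \<le> real p" using that prime_gt_0_nat[of p] by auto
      then have "1 \<le> x / sprod C / real p" using that by (subst pos_le_divide_eq) auto
      then show ?thesis unfolding f_def using a0 that p0 by (intro mult_nonneg_nonneg zero_le_power ln_ge_zero) auto
    qed
    have Y0: "0 \<le> Y" unfolding Y_def by (intro sum_nonneg mult_nonneg_nonneg w0 f0) auto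
    \<comment> \<open>Marking the repeated prime once more produces a second factor
      \<open>a p\<close>; the squares of \<open>a p\<close> times \<open>ln p\<close> sum to a
      constant, so Y is only of the order of the error term.\<close>
    have Y1: "Y \<le> 4 * \<kappa>\<^sup>2 * Z * T j"
    proof -
      have "Y \<le> (\<Sum>C\<in>psets D x. \<Sum>p\<in>C. w C * (a p * ln (real p) * L C ^ j))"
        unfolding Y_def
      proof (intro sum_mono)
        fix C assume C: "C \<in> psets D x"
        have "(\<Sum>p\<in>?Q C \<inter> C. f C p) \<le> (\<Sum>p\<in>?Q C \<inter> C. a p * ln (real p) * L C ^ j)"
        proof (intro sum_mono)
          fix p assume p: "p \<in> ?Q C \<inter> C"
          then have p0: "1 \<le> real p" using prime_gt_0_nat[of p] by auto
          have 1: "1 \<le> x / sprod C / real p" using p p0 by (subst pos_le_divide_eq) auto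
          have 2: "x / sprod C / real p \<le> x / sprod C" using frac_le[of "x / sprod C" "x / sprod C" 1 "real p"] p0 psets_quotient_ge1[OF C] by simp
          have "ln (x / sprod C / real p) ^ j \<le> L C ^ j"
            unfolding L_def using 1 2 by (intro power_mono) auto
          then show "f C p \<le> a p * ln (real p) * L C ^ j" unfolding f_def
            using a0 p p0 by (intro mult_left_mono) auto
        qed
        also have "\<dots> \<le> (\<Sum>p\<in>C. a p * ln (real p) * L C ^ j)"
          using psetsD[OF C] a0 L0[OF C] prime_gt_0_nat
          by (intro sum_mono2) (auto intro!: mult_nonneg_nonneg simp: Suc_le_eq)
        finally show "w C * (\<Sum>p\<in>?Q C \<inter> C. f C p) \<le> (\<Sum>p\<in>C. w C * (a p * ln (real p) * L C ^ j))"
          using w0[OF C] by (simp add: sum_distrib_left[symmetric] mult_left_mono)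
      qed
      also have "\<dots> = (\<Sum>C\<in>psets D x. \<Sum>p\<in>?Q C - C. w (insert p C) * (a p * ln (real p) * L (insert p C) ^ j))"
        by (rule sum_psets_elements)
      also have "\<dots> \<le> (\<Sum>C\<in>psets D x. \<Sum>p\<in>?Q C - C. w C * L C ^ j * (4 * \<kappa>\<^sup>2 * (ln (real p) / real p ^ 2)))"
      proof (intro sum_mono)
        fix C p assume C: "C \<in> psets D x" and p: "p \<in> ?Q C - C"
        have p0: "D < p" using p by auto
        have "w (insert p C) * (a p * ln (real p) * L (insert p C) ^ j) = w C * L (insert p C) ^ j * (a p ^ 2 * ln (real p))"
          using wins[OF C] p by (simp add: power2_eq_square)
        also have "\<dots> \<le> w C * L C ^ j * (4 * \<kappa>\<^sup>2 * (ln (real p) / real p ^ 2))"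
        proof (rule mult_mono[OF _ a2[OF p0]])
          show "w C * L (insert p C) ^ j \<le> w C * L C ^ j"
            using Lins(2,3)[OF C p] w0[OF C] by (intro mult_left_mono power_mono)
        qed (use w0[OF C] L0[OF C] p0 in auto)
        finally show "w (insert p C) * (a p * ln (real p) * L (insert p C) ^ j) \<le> w C * L C ^ j * (4 * \<kappa>\<^sup>2 * (ln (real p) / real p ^ 2))" .
      qed
      also have "\<dots> \<le> (\<Sum>C\<in>psets D x. w C * L C ^ j * (4 * \<kappa>\<^sup>2 * Z))"
        unfolding sum_distrib_left[symmetric]
        using w0 L0 Z by (intro sum_mono mult_left_mono) auto
      also have "\<dots> = 4 * \<kappa>\<^sup>2 * Z * T j" unfolding T by (simp add: sum_distrib_left mult_ac)
      finally show ?thesis .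
    qed
    have "ln x * T j - (1 + \<kappa> / real (j + 1)) * T (j + 1) = ((\<Sum>C\<in>psets D x. w C * V C) - \<kappa> / real (j + 1) * T (j + 1)) - Y"
      using X1 XY by (simp add: algebra_simps)
    then have "\<bar>ln x * T j - (1 + \<kappa> / real (j + 1)) * T (j + 1)\<bar> \<le> E * T j + 4 * \<kappa>\<^sup>2 * Z * T j"
      using V Y0 Y1 by linarith
    then show "\<bar>ln x * moment D k \<kappa> j x - (1 + \<kappa> / real (j + 1)) * moment D k \<kappa> (j + 1) x\<bar> \<le> (E + 4 * \<kappa>\<^sup>2 * Z) * moment D k \<kappa> j x"
      unfolding T_def by (simp add: distrib_right)
  qed
qed

section \<open>Residue classes\<close>

lemma card_residues_coprime:
  fixes m n :: nat
  assumes co: "coprime m n" and X: "X \<subseteq> {..<m}" and Y: "Y \<subseteq> {..<n}" and m: "0 < m" and n: "0 < n"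
  shows "card {a. a < m * n \<and> a mod m \<in> X \<and> a mod n \<in> Y} = card X * card Y"
proof -
  have "bij_betw (\<lambda>a. (a mod m, a mod n)) {a. a < m * n \<and> a mod m \<in> X \<and> a mod n \<in> Y} (X \<times> Y)"
  proof (rule bij_betwI')
    fix a b assume a: "a \<in> {a. a < m * n \<and> a mod m \<in> X \<and> a mod n \<in> Y}"
      and b: "b \<in> {a. a < m * n \<and> a mod m \<in> X \<and> a mod n \<in> Y}"
    show "((a mod m, a mod n) = (b mod m, b mod n)) = (a = b)"
    proof
      assume "(a mod m, a mod n) = (b mod m, b mod n)"
      then have "[a = b] (mod m)" "[a = b] (mod n)" by (auto simp: cong_def)
      then have "[a = b] (mod m * n)" using co by (intro coprime_cong_mult_nat)
      then show "a = b" using a b by (auto simp: cong_def)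
    qed auto
  next
    fix y assume "y \<in> X \<times> Y"
    then obtain u v where y: "y = (u, v)" "u \<in> X" "v \<in> Y" by auto
    obtain a where a: "a < m * n" "[a = u] (mod m)" "[a = v] (mod n)"
      using binary_chinese_remainder_unique_nat[OF co, of u v] m n by auto
    have "u < m" "v < n" using y X Y by auto
    then have "a mod m = u" "a mod n = v" using a by (auto simp: cong_def)
    then show "\<exists>a\<in>{a. a < m * n \<and> a mod m \<in> X \<and> a mod n \<in> Y}. y = (a mod m, a mod n)"
      using y a by auto
  qed auto
  from bij_betw_same_card[OF this] show ?thesis by (simp add: card_cartesian_product)
qed

definition res_classes :: "nat \<Rightarrow> nat \<Rightarrow> (nat \<Rightarrow> nat set) \<Rightarrow> nat set \<Rightarrow> nat set" where
  "res_classes W v S C = {a. a < W * sprod C \<and> a mod W = v \<and> (\<forall>p\<in>C. a mod p \<in> S p)}"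

lemma card_res_classes:
  assumes "finite C" "\<And>p. p \<in> C \<Longrightarrow> prime p" "\<And>p. p \<in> C \<Longrightarrow> \<not> p dvd W" "v < W"
    "\<And>p. p \<in> C \<Longrightarrow> S p \<subseteq> {..<p}"
  shows "card (res_classes W v S C) = (\<Prod>p\<in>C. card (S p))"
  using assms
proof (induction C rule: finite_induct)
  case empty
  then have "res_classes W v S {} = {v}" by (auto simp: res_classes_def)
  then show ?case by simp
next
  case (insert q C)
  have q: "prime q" "\<not> q dvd W" "q \<notin> C" using insert by auto
  have pos: "0 < sprod C" using insert.prems by (intro sprod_pos) auto
  have co: "coprime (W * sprod C) q"
  proof -
    have "coprime (sprod C) q" unfolding sprod_def
    proof (rule prod_coprime_left)
      fix p assume p: "p \<in> C"
      then have "p \<noteq> q" "prime p" using q insert.prems by auto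
      then show "coprime p q" using q by (intro primes_coprime) auto
    qed
    moreover have "coprime W q" using q by (metis coprime_commute prime_imp_coprime)
    ultimately show ?thesis by simp
  qed
  have "res_classes W v S (insert q C) = {a. a < W * sprod C * q \<and> a mod (W * sprod C) \<in> res_classes W v S C \<and> a mod q \<in> S q}"
  proof -
    have mm: "a mod (W * sprod C) mod W = a mod W" for a by (simp add: mod_mod_cancel)
    have mp: "a mod (W * sprod C) mod p = a mod p" if "p \<in> C" for a p
    proof -
      have "p dvd sprod C" unfolding sprod_def using that insert.hyps by (intro dvd_prodI) auto
      then show ?thesis by (intro mod_mod_cancel) auto
    qed
    have lt: "a mod (W * sprod C) < W * sprod C" for a using pos insert.prems(3) by auto
    show ?thesis unfolding res_classes_def using insert.hyps q mm mp lt by (auto simp: mult_ac)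
  qed
  also have "card \<dots> = card (res_classes W v S C) * card (S q)"
    using insert.prems pos q prime_gt_0_nat[of q] by (intro card_residues_coprime co) (auto simp: res_classes_def)
  also have "\<dots> = (\<Prod>p\<in>insert q C. card (S p))" using insert by simp
  finally show ?case .
qed

lemma card_mod_less:
  fixes q a y :: nat
  assumes "a < q"
  shows "card {n. n < y \<and> n mod q = a} = y div q + (if a < y mod q then 1 else 0)"
proof (induction y)
  case (Suc y)
  have "{n. n < Suc y \<and> n mod q = a} = (if y mod q = a then insert y {n. n < y \<and> n mod q = a} else {n. n < y \<and> n mod q = a})"
    by (auto simp: less_Suc_eq)
  then have "card {n. n < Suc y \<and> n mod q = a} = (if y mod q = a then 1 else 0) + card {n. n < y \<and> n mod q = a}"
    by auto
  moreover have "y mod q < q" using assms by auto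
  ultimately show ?case using Suc assms by (auto simp: div_Suc mod_Suc)
qed simp

text \<open>The error 1, rather than one error per endpoint, comes from a common range for the
  fluctuations of both initial counts.\<close>

lemma card_mod_interval:
  fixes q a N M :: nat
  assumes "a < q" "N \<le> M"
  shows "\<bar>real (card {n. N < n \<and> n \<le> M \<and> n mod q = a}) - (real M - real N) / real q\<bar> \<le> 1"
proof -
  have f: "real (y div q) = real y / real q - real (y mod q) / real q" for y
  proof -
    have "real (y div q) * real q + real (y mod q) = real y"
      unfolding of_nat_mult[symmetric] of_nat_add[symmetric] by simp
    then show ?thesis using assms by (simp add: field_simps)
  qed
  define c where "c y = card {n. n < y \<and> n mod q = a}" for y
  have un: "{n. n < Suc M \<and> n mod q = a} = {n. n < Suc N \<and> n mod q = a} \<union> {n. N < n \<and> n \<le> M \<and> n mod q = a}"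
    using assms by auto
  have "c (Suc M) = c (Suc N) + card {n. N < n \<and> n \<le> M \<and> n mod q = a}"
  proof -
    have "card ({n. n < Suc N \<and> n mod q = a} \<union> {n. N < n \<and> n \<le> M \<and> n mod q = a})
        = card {n. n < Suc N \<and> n mod q = a} + card {n. N < n \<and> n \<le> M \<and> n mod q = a}"
      by (rule card_Un_disjoint) auto
    then show ?thesis unfolding c_def un .
  qed
  then have e: "real (card {n. N < n \<and> n \<le> M \<and> n mod q = a}) = real (c (Suc M)) - real (c (Suc N))" by simp
  define u where "u y = (if a < y mod q then 1 else 0) - real (y mod q) / real q" for y
  have cu: "real (c y) = real y / real q + u y" for y
    unfolding c_def u_def card_mod_less[OF assms(1)] using f[of y] by simp
  \<comment> \<open>The range does not depend on y and has length 1 - 1 / q, so two values of u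
    differ by less than 1.\<close>
  have ub: "- real a / real q \<le> u y" "u y \<le> 1 - (real a + 1) / real q" for y
  proof -
    have "y mod q < q" using assms by auto
    then have 1: "real (y mod q) / real q \<le> 1" by simp
    have 2: "(real a + 1) / real q \<le> 1" using assms by simp
    have 3: "0 \<le> real (y mod q) / real q" "0 \<le> real a / real q" by auto
    have 4: "(real a + 1) / real q \<le> real (y mod q) / real q" if "a < y mod q"
      using that by (intro divide_right_mono) auto
    have 5: "real (y mod q) / real q \<le> real a / real q" if "\<not> a < y mod q"
      using that by (intro divide_right_mono) auto
    have 6: "- real a / real q = - (real a / real q)" by simp
    have "- real a / real q \<le> u y \<and> u y \<le> 1 - (real a + 1) / real q"
    proof (cases "a < y mod q")
      case True
      then have "u y = 1 - real (y mod q) / real q" by (simp add: u_def)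
      then show ?thesis using 1 3 4[OF True] unfolding 6 by linarith
    next
      case False
      then have "u y = - (real (y mod q) / real q)" by (simp add: u_def)
      then show ?thesis using 2 3 5[OF False] unfolding 6 by linarith
    qed
    then show "- real a / real q \<le> u y" "u y \<le> 1 - (real a + 1) / real q" by auto
  qed
  have "real (c (Suc M)) - real (c (Suc N)) - (real M - real N) / real q = u (Suc M) - u (Suc N)"
    unfolding cu by (simp add: diff_divide_distrib add_divide_distrib)
  moreover have "(real a + 1) / real q = real a / real q + 1 / real q" "0 \<le> 1 / real q" by (auto simp: add_divide_distrib)
  moreover have "- real a / real q = - (real a / real q)" by simp
  ultimately show ?thesis unfolding e using ub[of "Suc M"] ub[of "Suc N"] by linarith
qed

lemma sum_over_res_classes:
  fixes F :: "nat \<Rightarrow> real"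
  assumes "finite X" "finite C" "0 < W" "\<And>p. p \<in> C \<Longrightarrow> 0 < p"
  shows "(\<Sum>n | n \<in> X \<and> n mod W = v \<and> (\<forall>p\<in>C. n mod p \<in> S p). F n)
    = (\<Sum>a\<in>res_classes W v S C. \<Sum>n | n \<in> X \<and> n mod (W * sprod C) = a. F n)"
proof -
  let ?q = "W * sprod C" and ?Y = "{n. n \<in> X \<and> n mod W = v \<and> (\<forall>p\<in>C. n mod p \<in> S p)}"
  have q: "0 < ?q" using assms by (auto simp: sprod_def intro!: prod_pos)
  have dv: "p dvd ?q" if "p \<in> C" for p
    unfolding sprod_def using that assms by (intro dvd_mult dvd_prodI) auto
  have mem: "n mod ?q \<in> res_classes W v S C \<longleftrightarrow> n mod W = v \<and> (\<forall>p\<in>C. n mod p \<in> S p)" for n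
    unfolding res_classes_def using q dv by (auto simp: mod_mod_cancel)
  have fin: "finite (res_classes W v S C)" unfolding res_classes_def by auto
  have "(\<Sum>n\<in>?Y. F n) = (\<Sum>a\<in>res_classes W v S C. \<Sum>n | n \<in> ?Y \<and> n mod ?q = a. F n)"
    using assms(1) fin mem by (intro sum.group[symmetric]) auto
  also have "\<dots> = (\<Sum>a\<in>res_classes W v S C. \<Sum>n | n \<in> X \<and> n mod ?q = a. F n)"
    by (intro sum.cong refl) (use mem in auto)
  finally show ?thesis .
qed

section \<open>Euler products and harmonic sums away from the small primes\<close>

lemma psets_sum_prod_le_exp:
  fixes b :: "nat \<Rightarrow> real"
  assumes "\<And>p. prime p \<Longrightarrow> D < p \<Longrightarrow> 0 \<le> b p"
  shows "(\<Sum>C\<in>psets D x. \<Prod>p\<in>C. b p) \<le> exp (\<Sum>p | (prime p \<and> D < p) \<and> real p \<le> x. b p)"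
proof -
  let ?Q = "{p. (prime p \<and> D < p) \<and> real p \<le> x}"
  have "psets D x \<subseteq> Pow ?Q"
  proof (intro subsetI PowI)
    fix A p assume A: "A \<in> psets D x" and p: "p \<in> A"
    have "{p} \<in> psets D x" using psets_mono_set[OF A, of "{p}"] p by auto
    then have "real p \<le> x" by (auto simp: psets_def)
    then show "p \<in> ?Q" using psetsD[OF A] p by auto
  qed
  then have "(\<Sum>C\<in>psets D x. \<Prod>p\<in>C. b p) \<le> (\<Sum>C\<in>Pow ?Q. \<Prod>p\<in>C. b p)"
    using assms by (intro sum_mono2) (auto intro!: prod_nonneg)
  also have "\<dots> = (\<Prod>p\<in>?Q. 1 + b p)" by (intro prod_one_plus_Pow) simp
  also have "\<dots> \<le> (\<Prod>p\<in>?Q. exp (b p))" using assms by (intro prod_mono) (auto intro: add_nonneg_nonneg)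
  also have "\<dots> = exp (\<Sum>p\<in>?Q. b p)" by (simp add: exp_sum)
  finally show ?thesis .
qed

lemma inverse_square_tail:
  assumes "0 < (D::nat)" "finite A" "\<And>n. n \<in> A \<Longrightarrow> D < n"
  shows "(\<Sum>n\<in>A. 1 / (real n)\<^sup>2) \<le> 1 / real D"
proof -
  have t: "(\<Sum>n=Suc D..m. 1 / (real n)\<^sup>2) \<le> 1 / real D - 1 / real m" if "D \<le> m" for m
    using that
  proof (induction m rule: dec_induct)
    case (step m)
    have "1 / (real (Suc m))\<^sup>2 \<le> 1 / (real m * real (Suc m))"
      using step assms(1) by (intro divide_left_mono) (auto simp: power2_eq_square intro!: mult_right_mono)
    also have "\<dots> = 1 / real m - 1 / real (Suc m)" using step assms(1) by (simp add: field_simps)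
    finally show ?case using step by simp
  qed simp
  define m where "m = Max (insert D A)"
  have "(\<Sum>n\<in>A. 1 / (real n)\<^sup>2) \<le> (\<Sum>n=Suc D..m. 1 / (real n)\<^sup>2)"
    using assms by (intro sum_mono2) (auto simp: m_def Suc_le_eq)
  also have "\<dots> \<le> 1 / real D - 1 / real m" using assms by (intro t) (auto simp: m_def)
  finally show ?thesis by (simp add: order_trans)
qed

text \<open>Splitting \<open>1 / (p - k) = k / (p * (p - k)) + 1 / p\<close> replaces the sieve weights by reciprocals, at the cost
  of a constant that tends to 1 as D grows.\<close>

lemma psets_weight_split:
  fixes F :: "nat \<Rightarrow> real"
  assumes D: "2 * k \<le> D" "0 < D" and F: "\<And>n. 0 \<le> F n"
    and U: "\<And>A. A \<in> psets D x \<Longrightarrow> (\<Sum>B\<in>psets D (x / sprod A). 1 / real (sprod B) * F (sprod A * sprod B)) \<le> U"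
    and U0: "0 \<le> U"
  shows "(\<Sum>B\<in>psets D x. (\<Prod>p\<in>B. 1 / (real p - real k)) * F (sprod B)) \<le> exp (2 * real k / real D) * U"
proof -
  define b where "b p = real k / (real p * (real p - real k))" for p :: nat
  have pk: "0 < real p - real k" "real p \<le> 2 * (real p - real k)" if "D < p" for p using that D by auto
  have b0: "0 \<le> b p" if "D < p" for p using pk[OF that] by (simp add: b_def)
  have split: "1 / (real p - real k) = b p + 1 / real p" if "D < p" for p
    unfolding b_def using pk[OF that] that by (simp add: field_simps)
  \<comment> \<open>As p > D and D is at least 2 * k, p is at most 2 * (p - k). Together with the
    tail of the inverse squares beyond D, at most 1 / D, this is the origin of
    \<open>exp (2 * k / D)\<close>.\<close>
  have b2: "b p \<le> 2 * real k * (1 / (real p)\<^sup>2)" if "D < p" for p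
    unfolding b_def using pk[OF that] that mult_right_mono[OF pk(2)[OF that], of "real k * real p"]
    by (simp add: field_simps power2_eq_square)
  have "(\<Sum>B\<in>psets D x. (\<Prod>p\<in>B. 1 / (real p - real k)) * F (sprod B))
    = (\<Sum>B\<in>psets D x. (\<Prod>p\<in>B. b p + 1 / real p) * F (sprod B))"
    by (intro sum.cong refl arg_cong2[of _ _ _ _ "(*)"] prod.cong split) (auto dest: psetsD)
  also have "\<dots> \<le> (\<Sum>A\<in>psets D x. (\<Prod>p\<in>A. b p) * (\<Sum>B\<in>psets D (x / sprod A). (\<Prod>p\<in>B. 1 / real p) * F (sprod A * sprod B)))"
    using b0 F by (intro psets_convolution_le) auto
  also have "\<dots> \<le> (\<Sum>A\<in>psets D x. (\<Prod>p\<in>A. b p) * U)"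
  proof (intro sum_mono mult_left_mono prod_nonneg b0)
    fix A assume "A \<in> psets D x"
    then show "(\<Sum>B\<in>psets D (x / sprod A). (\<Prod>p\<in>B. 1 / real p) * F (sprod A * sprod B)) \<le> U"
      using U[of A] by (simp add: sprod_def prod_dividef)
  qed (auto dest: psetsD)
  also have "\<dots> = (\<Sum>A\<in>psets D x. \<Prod>p\<in>A. b p) * U" by (simp add: sum_distrib_right)
  also have "\<dots> \<le> exp (2 * real k / real D) * U"
  proof (intro mult_right_mono U0)
    have "(\<Sum>A\<in>psets D x. \<Prod>p\<in>A. b p) \<le> exp (\<Sum>p | (prime p \<and> D < p) \<and> real p \<le> x. b p)"
      using b0 by (intro psets_sum_prod_le_exp) auto
    also have "(\<Sum>p | (prime p \<and> D < p) \<and> real p \<le> x. b p) \<le> (\<Sum>p | (prime p \<and> D < p) \<and> real p \<le> x. 2 * real k * (1 / (real p)\<^sup>2))"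
      using b2 by (intro sum_mono) auto
    also have "\<dots> \<le> 2 * real k * (1 / real D)"
      unfolding sum_distrib_left[symmetric] using D by (intro mult_left_mono inverse_square_tail) auto
    finally show "(\<Sum>A\<in>psets D x. \<Prod>p\<in>A. b p) \<le> exp (2 * real k / real D)" by simp
  qed
  finally show ?thesis .
qed

text \<open>Beyond the first block of length W, n is a + j * W with a totative a and j at least 1,
  and 1 / n is at most 1 / (j * W); the number of totatives gives the density. Only the coefficient
  of \<open>ln x\<close> has to be sharp, because the constant is later divided by
  \<open>ln R\<close>.\<close>

lemma coprime_harmonic_le:
  fixes W :: nat
  assumes W: "0 < W" and x: "1 \<le> x"
  shows "(\<Sum>n | (1 \<le> n \<and> coprime n W) \<and> real n \<le> x. 1 / real n) \<le> real (totient W) / real W * ln x + (1 + 2 * real W)"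
proof -
  let ?X = "{n. (1 \<le> n \<and> coprime n W) \<and> real n \<le> x}"
  let ?R = "totatives W"
  define J where "J = {j. 1 \<le> j \<and> real j \<le> x}"
  have finJ: "finite J" unfolding J_def by simp
  have "(\<Sum>n\<in>?X. 1 / real n) \<le> (\<Sum>n\<in>{1..W}. 1 / real n) + (\<Sum>n | n \<in> ?X \<and> W < n. 1 / real n)"
  proof -
    have "(\<Sum>n\<in>?X. 1 / real n) \<le> (\<Sum>n\<in>{1..W} \<union> {n. n \<in> ?X \<and> W < n}. 1 / real n)"
      by (intro sum_mono2) (auto intro: finite_subset[of _ ?X])
    also have "\<dots> \<le> (\<Sum>n\<in>{1..W}. 1 / real n) + (\<Sum>n | n \<in> ?X \<and> W < n. 1 / real n)"
      by (subst sum.union_disjoint) (auto intro: finite_subset[of _ ?X])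
    finally show ?thesis .
  qed
  also have "(\<Sum>n\<in>{1..W}. 1 / real n) \<le> (\<Sum>n\<in>{1..W}. 1)" by (intro sum_mono) auto
  also have "(\<Sum>n\<in>{1..W}. 1::real) = real W" by simp
  also have "(\<Sum>n | n \<in> ?X \<and> W < n. 1 / real n) \<le> (\<Sum>y\<in>?R \<times> J. 1 / (real W * real (snd y)))"
  proof (rule sum_le_included[where i = "\<lambda>(a, j). a + j * W"])
    show "\<forall>n\<in>{n. n \<in> ?X \<and> W < n}. \<exists>y\<in>?R \<times> J. (case y of (a, j) \<Rightarrow> a + j * W) = n \<and> 1 / real n \<le> 1 / (real W * real (snd y))"
    proof
      fix n assume n: "n \<in> {n. n \<in> ?X \<and> W < n}"
      \<comment> \<open>The shift by one makes the representatives run from 1 to W, the range of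
        \<open>totatives\<close>.\<close>
      define j where "j = (n - 1) div W"
      define a where "a = (n - 1) mod W + 1"
      have dj: "n - 1 = (n - 1) mod W + j * W" unfolding j_def by (simp add: mult.commute)
      then have e: "a + j * W = n" using n unfolding a_def by auto
      have a: "1 \<le> a" "a \<le> W" unfolding a_def using W by (auto simp: Suc_le_eq)
      have "coprime a W"
      proof -
        have "gcd W (j * W + a) = gcd W a" by (rule gcd_add_mult)
        moreover have "j * W + a = n" using e by simp
        moreover have "coprime W n" using n by (auto intro: coprime_commute[THEN iffD1])
        ultimately have "coprime W a" using coprime_iff_gcd_eq_1[of W n] coprime_iff_gcd_eq_1[of W a] by metis
        then show ?thesis by (rule coprime_commute[THEN iffD1])
      qed
      then have aR: "a \<in> ?R" using a by (auto simp: totatives_def)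
      have j1: "1 \<le> j"
      proof (rule ccontr)
        assume "\<not> 1 \<le> j"
        then have "j = 0" by simp
        then have "a = n" using e by simp
        then show False using a n by simp
      qed
      have "j \<le> j * W" using W by simp
      then have jn: "j \<le> n" "j * W \<le> n" using e by linarith+
      then have jJ: "j \<in> J" unfolding J_def using j1 n by (auto intro: order_trans[of _ "real n"])
      have "1 / real n \<le> 1 / (real W * real j)"
        using jn j1 W by (intro divide_left_mono) (auto simp: mult.commute simp flip: of_nat_mult)
      then show "\<exists>y\<in>?R \<times> J. (case y of (a, j) \<Rightarrow> a + j * W) = n \<and> 1 / real n \<le> 1 / (real W * real (snd y))"
        using aR jJ e by (intro bexI[of _ "(a, j)"]) auto
    qed
  qed (auto intro: finite_subset[of _ ?X] simp: finJ)
  also have "\<dots> = (\<Sum>a\<in>?R. \<Sum>j\<in>J. 1 / (real W * real j))"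
    by (simp only: sum.cartesian_product case_prod_unfold)
  also have "\<dots> = real (totient W) / real W * (\<Sum>j\<in>J. 1 / real j)"
    by (simp add: totient_def sum_distrib_left)
  also have "\<dots> \<le> real (totient W) / real W * (1 + ln x)"
    unfolding J_def using harmonic_le[OF x] by (intro mult_left_mono) auto
  also have "\<dots> \<le> real (totient W) / real W * ln x + 1"
  proof -
    have "real (totient W) / real W \<le> 1" using W totient_le[of W] by simp
    then show ?thesis unfolding distrib_left by simp
  qed
  finally show ?thesis by simp
qed

lemma totient_sprod:
  assumes "finite C" "\<And>p. p \<in> C \<Longrightarrow> prime p"
  shows "real (totient (sprod C)) = (\<Prod>p\<in>C. real p - 1)"
  using assms
proof (induction C rule: finite_induct)
  case (insert q C)
  have q: "prime q" "q \<notin> C" using insert by auto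
  have "coprime q (sprod C)" unfolding sprod_def
  proof (rule prod_coprime_right)
    fix p assume p: "p \<in> C"
    then have "p \<noteq> q" "prime p" using q insert.prems by auto
    then show "coprime q p" using q by (intro primes_coprime) auto
  qed
  then have "totient (q * sprod C) = (q - 1) * totient (sprod C)"
    using q by (simp add: totient_mult_coprime totient_prime)
  moreover have "real (q - 1) = real q - 1" using prime_gt_0_nat[OF q(1)] by simp
  moreover have "real (totient (sprod C)) = (\<Prod>p\<in>C. real p - 1)" using insert.prems by (intro insert.IH) auto
  ultimately show ?case using insert.hyps by simp
qed simp

section \<open>The Selberg weights\<close>

text \<open>The small primes are removed beforehand by fixing a class v modulo the primorial W in
  which every n + h is coprime to W. D at least every h keeps the shifts distinct modulo each
  remaining prime, and D at least 2 * k keeps p - k comparable to p.\<close>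

locale tuple_sieve =
  fixes H :: "nat set" and k D W v :: nat
  assumes finH: "finite H" and cardH: "card H = k" and k2: "2 \<le> k"
    and D2: "2 * k \<le> D" and HD: "\<And>h. h \<in> H \<Longrightarrow> h \<le> D"
    and W_def: "W = sprod {p. prime p \<and> p \<le> D}"
    and v: "v < W" and vH: "\<And>h. h \<in> H \<Longrightarrow> coprime (v + h) W"
begin

lemma D_pos: "0 < D" using D2 k2 by simp

lemma W_pos: "0 < W"
  unfolding W_def by (rule sprod_pos) auto

lemma not_dvd_W:
  assumes "prime p" "D < p"
  shows "\<not> p dvd W"
proof
  assume "p dvd W"
  then obtain q where "prime q" "q \<le> D" "p dvd q"
    unfolding W_def sprod_def using assms by (auto simp: prime_dvd_prod_iff)
  then show False using assms by (auto dest: dvd_imp_le simp: prime_gt_0_nat)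
qed

lemma dvd_W:
  assumes "prime p" "p \<le> D"
  shows "p dvd W"
  unfolding W_def sprod_def using assms by (intro dvd_prodI) auto

definition has_root :: "nat \<Rightarrow> nat \<Rightarrow> bool" where
  "has_root n p \<longleftrightarrow> (\<exists>h\<in>H. p dvd n + h)"

definition wt :: "nat set \<Rightarrow> real" where
  "wt C = (\<Prod>p\<in>C. real k / (real p - real k))"

text \<open>Parametrised by the diagonalising variables y: \<open>wt\<close> is the inverse of the multiplicative function with value
  \<open>p / k - 1\<close> at p, and \<open>lam\<close> is the Moebius-type inversion of \<open>y\<close>.\<close>

definition lam :: "real \<Rightarrow> (nat \<Rightarrow> real) \<Rightarrow> nat set \<Rightarrow> real" where
  "lam R y A = (\<Prod>p\<in>A. - (real p / real k)) * (\<Sum>B | B \<in> psets D R \<and> A \<subseteq> B. wt B * y (sprod B))"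

definition sw :: "real \<Rightarrow> (nat \<Rightarrow> real) \<Rightarrow> nat \<Rightarrow> real" where
  "sw R y n = (\<Sum>A | A \<in> psets D R \<and> (\<forall>p\<in>A. has_root n p). lam R y A)\<^sup>2"

definition window :: "nat \<Rightarrow> nat set" where
  "window N = {n. (N < n \<and> n \<le> 2 * N) \<and> n mod W = v}"

lemma finite_window [simp]: "finite (window N)"
  unfolding window_def by (rule finite_subset[of _ "{..2 * N}"]) auto

lemma psets_prime_bounds:
  assumes "C \<in> psets D x" "p \<in> C"
  shows "real k < real p" "real p \<le> 2 * (real p - real k)" "0 < real p - real k" "0 < real p" "1 < real p"
  using psetsD(3)[OF assms] D2 k2 by auto

lemma wt_nonneg: "C \<in> psets D x \<Longrightarrow> 0 \<le> wt C"
  unfolding wt_def using D2 by (intro psets_weight_nonneg[of C D x]) auto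

lemma sum_sw_expand:
  fixes F :: "nat \<Rightarrow> real"
  shows "(\<Sum>n\<in>window N. sw R y n * F n) = (\<Sum>A\<in>psets D R. \<Sum>B\<in>psets D R. lam R y A * lam R y B *
      (\<Sum>n | n \<in> window N \<and> (\<forall>p\<in>A \<union> B. has_root n p). F n))"
proof -
  let ?P = "\<lambda>n A. \<forall>p\<in>A. has_root n p"
  let ?l = "lam R y"
  have "(\<Sum>n\<in>window N. sw R y n * F n)
      = (\<Sum>n\<in>window N. \<Sum>A\<in>psets D R. \<Sum>B\<in>psets D R. if ?P n (A \<union> B) then ?l A * ?l B * F n else 0)"
  proof (intro sum.cong refl)
    fix n
    have s: "(\<Sum>A | A \<in> psets D R \<and> ?P n A. ?l A) = (\<Sum>A\<in>psets D R. if ?P n A then ?l A else 0)"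
      by (simp add: sum.inter_filter)
    have "sw R y n * F n = (\<Sum>A\<in>psets D R. \<Sum>B\<in>psets D R. (if ?P n A then ?l A else 0) * (if ?P n B then ?l B else 0)) * F n"
      unfolding sw_def s power2_eq_square sum_product ..
    also have "\<dots> = (\<Sum>A\<in>psets D R. \<Sum>B\<in>psets D R. if ?P n (A \<union> B) then ?l A * ?l B * F n else 0)"
      unfolding sum_distrib_right by (intro sum.cong refl) auto
    finally show "sw R y n * F n = (\<Sum>A\<in>psets D R. \<Sum>B\<in>psets D R. if ?P n (A \<union> B) then ?l A * ?l B * F n else 0)" .
  qed
  also have "\<dots> = (\<Sum>A\<in>psets D R. \<Sum>B\<in>psets D R. \<Sum>n\<in>window N. if ?P n (A \<union> B) then ?l A * ?l B * F n else 0)"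
    by (subst sum.swap, rule sum.cong[OF refl], rule sum.swap)
  also have "\<dots> = (\<Sum>A\<in>psets D R. \<Sum>B\<in>psets D R. ?l A * ?l B * (\<Sum>n | n \<in> window N \<and> ?P n (A \<union> B). F n))"
    by (intro sum.cong refl) (simp only: sum.inter_filter[OF finite_window] sum_distrib_left if_distrib[of "\<lambda>x. _ * x"] mult_zero_right cong: if_cong)
  finally show ?thesis .
qed

text \<open>The two coefficients give at most 4 to the power \<open>card C\<close>, where C is the
  union of A and B, and at most as many pairs (A, B) have union C; hence the factor 16. G is the
  local density and Er the error for a single modulus.\<close>

lemma sum_sw_approx:
  fixes F :: "nat \<Rightarrow> real"
  assumes l: "\<And>A. A \<in> psets D R \<Longrightarrow> \<bar>lam R y A\<bar> \<le> 2 ^ card A * L" and L: "0 \<le> L"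
    and Er: "\<And>C. C \<in> psets D (R * R) \<Longrightarrow> \<bar>(\<Sum>n | n \<in> window N \<and> (\<forall>p\<in>C. has_root n p). F n) - X * G C\<bar> \<le> Er C"
  shows "\<bar>(\<Sum>n\<in>window N. sw R y n * F n) - X * (\<Sum>A\<in>psets D R. \<Sum>B\<in>psets D R. lam R y A * lam R y B * G (A \<union> B))\<bar>
     \<le> L\<^sup>2 * (\<Sum>C\<in>psets D (R * R). 16 ^ card C * Er C)"
proof -
  let ?M = "\<lambda>C. (\<Sum>n | n \<in> window N \<and> (\<forall>p\<in>C. has_root n p). F n)"
  let ?l = "lam R y" and ?D = "psets D R"
  have Er0: "0 \<le> Er C" if "C \<in> psets D (R * R)" for C using order_trans[OF abs_ge_zero Er[OF that]] .
  have "\<bar>(\<Sum>n\<in>window N. sw R y n * F n) - X * (\<Sum>A\<in>?D. \<Sum>B\<in>?D. ?l A * ?l B * G (A \<union> B))\<bar>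
     = \<bar>\<Sum>A\<in>?D. \<Sum>B\<in>?D. ?l A * ?l B * (?M (A \<union> B) - X * G (A \<union> B))\<bar>"
    unfolding sum_sw_expand by (simp add: sum_distrib_left sum_subtractf[symmetric] right_diff_distrib mult_ac)
  also have "\<dots> \<le> (\<Sum>A\<in>?D. \<Sum>B\<in>?D. \<bar>?l A * ?l B * (?M (A \<union> B) - X * G (A \<union> B))\<bar>)"
    by (intro order_trans[OF sum_abs] sum_mono order_refl)
  also have "\<dots> \<le> (\<Sum>A\<in>?D. \<Sum>B\<in>?D. L\<^sup>2 * (4 ^ card (A \<union> B) * Er (A \<union> B)))"
  proof (intro sum_mono)
    fix A B assume A: "A \<in> ?D" and B: "B \<in> ?D"
    have U: "A \<union> B \<in> psets D (R * R)" by (rule Un_in_psets[OF A B])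
    have c: "card A \<le> card (A \<union> B)" "card B \<le> card (A \<union> B)"
      using psetsD(1)[OF A] psetsD(1)[OF B] by (auto intro: card_mono)
    have "\<bar>?l A\<bar> \<le> 2 ^ card (A \<union> B) * L"
      by (rule order_trans[OF l[OF A]]) (use c L in \<open>auto intro!: mult_right_mono power_increasing\<close>)
    moreover have "\<bar>?l B\<bar> \<le> 2 ^ card (A \<union> B) * L"
      by (rule order_trans[OF l[OF B]]) (use c L in \<open>auto intro!: mult_right_mono power_increasing\<close>)
    ultimately have "\<bar>?l A\<bar> * \<bar>?l B\<bar> * \<bar>?M (A \<union> B) - X * G (A \<union> B)\<bar> \<le> (2 ^ card (A \<union> B) * L) * (2 ^ card (A \<union> B) * L) * Er (A \<union> B)"
      using Er[OF U] L by (intro mult_mono) auto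
    also have "\<dots> = L\<^sup>2 * ((2 ^ card (A \<union> B) * 2 ^ card (A \<union> B)) * Er (A \<union> B))" by (simp add: power2_eq_square)
    also have "2 ^ card (A \<union> B) * 2 ^ card (A \<union> B) = (4::real) ^ card (A \<union> B)" by (simp add: power_mult_distrib[symmetric])
    finally show "\<bar>?l A * ?l B * (?M (A \<union> B) - X * G (A \<union> B))\<bar> \<le> L\<^sup>2 * (4 ^ card (A \<union> B) * Er (A \<union> B))"
      by (simp add: abs_mult)
  qed
  also have "\<dots> = L\<^sup>2 * (\<Sum>z\<in>?D \<times> ?D. 4 ^ card (fst z \<union> snd z) * Er (fst z \<union> snd z))"
    by (simp add: sum.cartesian_product sum_distrib_left case_prod_unfold)
  also have "(\<Sum>z\<in>?D \<times> ?D. 4 ^ card (fst z \<union> snd z) * Er (fst z \<union> snd z))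
     = (\<Sum>C\<in>psets D (R * R). \<Sum>z | z \<in> ?D \<times> ?D \<and> fst z \<union> snd z = C. 4 ^ card (fst z \<union> snd z) * Er (fst z \<union> snd z))"
    by (rule sum.group[symmetric]) (auto intro: Un_in_psets)
  also have "L\<^sup>2 * \<dots> \<le> L\<^sup>2 * (\<Sum>C\<in>psets D (R * R). 16 ^ card C * Er C)"
  proof (intro mult_left_mono sum_mono)
    fix C assume C: "C \<in> psets D (R * R)"
    let ?Z = "{z. z \<in> ?D \<times> ?D \<and> fst z \<union> snd z = C}"
    have "card ?Z \<le> card (Pow C \<times> Pow C)" using psetsD(1)[OF C] by (intro card_mono) auto
    also have "\<dots> = 4 ^ card C" using psetsD(1)[OF C] by (simp add: card_cartesian_product card_Pow power_mult_distrib[symmetric])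
    finally have "real (card ?Z) \<le> real (4 ^ card C)" by (simp only: of_nat_le_iff)
    then have c: "real (card ?Z) \<le> 4 ^ card C" by simp
    have "(\<Sum>z\<in>?Z. 4 ^ card (fst z \<union> snd z) * Er (fst z \<union> snd z)) = real (card ?Z) * (4 ^ card C * Er C)"
      by simp
    also have "\<dots> \<le> 4 ^ card C * (4 ^ card C * Er C)" using c Er0[OF C] by (intro mult_right_mono) auto
    also have "\<dots> = 16 ^ card C * Er C" by (simp add: power_mult_distrib[symmetric] mult.assoc[symmetric])
    finally show "(\<Sum>z\<in>?Z. 4 ^ card (fst z \<union> snd z) * Er (fst z \<union> snd z)) \<le> 16 ^ card C * Er C" .
  qed auto
  finally show ?thesis .
qed

lemma wt_le:
  assumes C: "C \<in> psets D x"
  shows "wt C \<le> real (2 * k) ^ card C / real (sprod C)"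
proof -
  have "wt C \<le> (\<Prod>p\<in>C. real (2 * k) / real p)"
    unfolding wt_def
  proof (intro prod_mono conjI)
    fix p assume p: "p \<in> C"
    note b = psets_prime_bounds[OF C p]
    show "0 \<le> real k / (real p - real k)" using b by simp
    show "real k / (real p - real k) \<le> real (2 * k) / real p"
      using b mult_right_mono[OF b(2), of "real k"] by (simp add: field_simps)
  qed
  then show ?thesis by (simp add: prod_dividef sprod_def)
qed

text \<open>Taking \<open>wt A\<close> out of the sum over supersets leaves with the prefactor a
  product of \<open>p / (p - k)\<close>, each at most 2, and a sum of \<open>wt (B - A)\<close>,
  which is a divisor sum. So the coefficients grow only like powers of logarithms apart from
  \<open>2 ^ card A\<close>.\<close>

lemma lam_bound:
  assumes R: "1 \<le> R" and y: "\<And>n. 1 \<le> n \<Longrightarrow> real n \<le> R \<Longrightarrow> 0 \<le> y n" "\<And>n. 1 \<le> n \<Longrightarrow> real n \<le> R \<Longrightarrow> y n \<le> Y" and A: "A \<in> psets D R"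
  shows "\<bar>lam R y A\<bar> \<le> 2 ^ card A * (Y * (1 + ln R) ^ (2 * k))"
proof -
  let ?S = "{B. B \<in> psets D R \<and> A \<subseteq> B}"
  have Y: "0 \<le> Y" using y(1)[of 1] y(2)[of 1] R by simp
  have "(\<Sum>B\<in>?S. wt B * y (sprod B)) \<le> (\<Sum>B\<in>?S. Y * wt A * wt (B - A))"
  proof (intro sum_mono)
    fix B assume B: "B \<in> ?S"
    then have B': "B \<in> psets D R" by simp
    have "wt B = wt A * wt (B - A)"
      unfolding wt_def using prod.subset_diff[of A B] B psetsD(1)[OF B'] by (simp add: mult.commute)
    moreover have "y (sprod B) \<le> Y" using psets_prod_pos[OF B'] psetsD(4)[OF B'] by (intro y(2)) auto
    ultimately show "wt B * y (sprod B) \<le> Y * wt A * wt (B - A)"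
      using mult_left_mono[of "y (sprod B)" Y "wt B"] wt_nonneg[OF B'] by (simp add: mult_ac)
  qed
  also have "\<dots> = Y * wt A * (\<Sum>B\<in>(\<lambda>B. B - A) ` ?S. wt B)"
    by (subst sum.reindex) (auto simp: inj_on_def sum_distrib_left)
  also have "\<dots> \<le> Y * wt A * (\<Sum>B\<in>psets D R. wt B)"
    using wt_nonneg[OF A] Y by (intro mult_left_mono sum_mono2) (auto intro: psets_mono_set wt_nonneg)
  also have "\<dots> \<le> Y * wt A * (1 + ln R) ^ (2 * k)"
  proof (intro mult_left_mono)
    have "(\<Sum>B\<in>psets D R. wt B) \<le> (\<Sum>B\<in>psets D R. real (2 * k) ^ card B / real (sprod B))"
      by (intro sum_mono wt_le)
    also have "\<dots> \<le> (1 + ln R) ^ (2 * k)" by (rule psets_power_sum_le[OF R])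
    finally show "(\<Sum>B\<in>psets D R. wt B) \<le> (1 + ln R) ^ (2 * k)" .
  qed (use wt_nonneg[OF A] Y in auto)
  finally have 1: "(\<Sum>B\<in>?S. wt B * y (sprod B)) \<le> Y * wt A * (1 + ln R) ^ (2 * k)" .
  have 2: "(\<Prod>p\<in>A. real p / real k) * wt A \<le> 2 ^ card A"
  proof -
    have "(\<Prod>p\<in>A. real p / real k) * wt A = (\<Prod>p\<in>A. real p / (real p - real k))"
      unfolding wt_def prod.distrib[symmetric] using k2 by (intro prod.cong refl) auto
    also have "\<dots> \<le> (\<Prod>p\<in>A. 2)"
    proof (intro prod_mono conjI)
      fix p assume p: "p \<in> A"
      show "0 \<le> real p / (real p - real k)" using psets_prime_bounds(3,4)[OF A p] by simp
      show "real p / (real p - real k) \<le> 2" using psets_prime_bounds(2,3)[OF A p] by (subst pos_divide_le_eq) auto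
    qed
    finally show ?thesis by simp
  qed
  have 0: "0 \<le> (\<Sum>B\<in>?S. wt B * y (sprod B))"
  proof (intro sum_nonneg mult_nonneg_nonneg)
    fix B assume B: "B \<in> ?S"
    then show "0 \<le> wt B" using wt_nonneg by auto
    show "0 \<le> y (sprod B)" using B psets_prod_pos[of B D R] psetsD(4)[of B D R] by (intro y(1)) auto
  qed
  have "\<bar>lam R y A\<bar> = (\<Prod>p\<in>A. real p / real k) * (\<Sum>B\<in>?S. wt B * y (sprod B))"
    unfolding lam_def abs_mult abs_prod using 0 by simp
  also have "\<dots> \<le> (\<Prod>p\<in>A. real p / real k) * (Y * wt A * (1 + ln R) ^ (2 * k))"
    using 1 by (intro mult_left_mono prod_nonneg) auto
  also have "\<dots> = ((\<Prod>p\<in>A. real p / real k) * wt A) * (Y * (1 + ln R) ^ (2 * k))" by simp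
  also have "\<dots> \<le> 2 ^ card A * (Y * (1 + ln R) ^ (2 * k))"
    using 2 Y R by (intro mult_right_mono) auto
  finally show ?thesis .
qed

text \<open>\<psi> is the quotient of the density g by k / p, the density for which
  \<open>lam\<close> was built. One diagonal formula thus covers the three sums that are needed: all
  n, n with a given prime divisor, and n with a prime shift.\<close>

lemma lam_form:
  fixes g :: "nat \<Rightarrow> real"
  assumes g: "\<And>p. prime p \<Longrightarrow> D < p \<Longrightarrow> g p \<noteq> 0"
  defines "\<psi> \<equiv> (\<lambda>p. g p * real p / real k)"
  shows "(\<Sum>A\<in>psets D R. \<Sum>B\<in>psets D R. lam R y A * lam R y B * (\<Prod>p\<in>A \<union> B. g p))
    = (\<Sum>C\<in>psets D R. (\<Prod>p\<in>C. (1 / g p - 1) * (\<psi> p)\<^sup>2) *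
        (\<Sum>B | B \<in> psets D R \<and> C \<subseteq> B. wt B * y (sprod B) * (\<Prod>p\<in>B - C. 1 - \<psi> p))\<^sup>2)"
proof -
  have lg: "lam R y A * (\<Prod>p\<in>A. g p) = (\<Prod>p\<in>A. - \<psi> p) * (\<Sum>B | B \<in> psets D R \<and> A \<subseteq> B. wt B * y (sprod B))" for A
  proof -
    have "(\<Prod>p\<in>A. - (real p / real k)) * (\<Prod>p\<in>A. g p) = (\<Prod>p\<in>A. - \<psi> p)"
      unfolding prod.distrib[symmetric] \<psi>_def by (intro prod.cong refl) simp
    then show ?thesis unfolding lam_def by (simp add: mult.commute mult.left_commute)
  qed
  have "(\<Sum>A\<in>psets D R. \<Sum>B\<in>psets D R. lam R y A * lam R y B * (\<Prod>p\<in>A \<union> B. g p))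
    = (\<Sum>C\<in>psets D R. (\<Prod>p\<in>C. 1 / g p - 1) * (\<Sum>A | A \<in> psets D R \<and> C \<subseteq> A. lam R y A * (\<Prod>p\<in>A. g p))\<^sup>2)"
    using g by (intro quadratic_form_diagonal) (auto dest: psetsD intro: psets_mono_set)
  also have "\<dots> = (\<Sum>C\<in>psets D R. (\<Prod>p\<in>C. 1 / g p - 1) * ((\<Prod>p\<in>C. - \<psi> p) *
        (\<Sum>B | B \<in> psets D R \<and> C \<subseteq> B. wt B * y (sprod B) * (\<Prod>p\<in>B - C. 1 - \<psi> p)))\<^sup>2)"
    unfolding lg by (subst superset_inversion) (auto dest: psetsD intro: psets_mono_set)
  also have "\<dots> = (\<Sum>C\<in>psets D R. (\<Prod>p\<in>C. (1 / g p - 1) * (\<psi> p)\<^sup>2) *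
        (\<Sum>B | B \<in> psets D R \<and> C \<subseteq> B. wt B * y (sprod B) * (\<Prod>p\<in>B - C. 1 - \<psi> p))\<^sup>2)"
    by (intro sum.cong refl) (simp add: power_mult_distrib prod.distrib prod_power_distrib)
  finally show ?thesis .
qed

text \<open>Here \<psi> p = 1, so the factors \<open>1 - \<psi> p\<close> remove every B except C,
  and the form is fully diagonal in y.\<close>

lemma lam_form_root:
  "(\<Sum>A\<in>psets D R. \<Sum>B\<in>psets D R. lam R y A * lam R y B * (\<Prod>p\<in>A \<union> B. real k / real p))
    = (\<Sum>C\<in>psets D R. wt C * (y (sprod C))\<^sup>2)"
proof -
  have k0: "real k \<noteq> 0" using k2 by simp
  have "(\<Sum>A\<in>psets D R. \<Sum>B\<in>psets D R. lam R y A * lam R y B * (\<Prod>p\<in>A \<union> B. real k / real p))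
    = (\<Sum>C\<in>psets D R. (\<Prod>p\<in>C. (1 / (real k / real p) - 1) * (real k / real p * real p / real k)\<^sup>2) *
        (\<Sum>B | B \<in> psets D R \<and> C \<subseteq> B. wt B * y (sprod B) * (\<Prod>p\<in>B - C. 1 - real k / real p * real p / real k))\<^sup>2)"
    using k2 by (intro lam_form) auto
  also have "\<dots> = (\<Sum>C\<in>psets D R. wt C * (y (sprod C))\<^sup>2)"
  proof (intro sum.cong refl)
    fix C assume C: "C \<in> psets D R"
    have "(\<Sum>B | B \<in> psets D R \<and> C \<subseteq> B. wt B * y (sprod B) * (\<Prod>p\<in>B - C. 1 - real k / real p * real p / real k))
      = (\<Sum>B | B \<in> psets D R \<and> C \<subseteq> B. if B = C then wt C * y (sprod C) else 0)"
    proof (intro sum.cong refl)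
      fix B assume B: "B \<in> {B. B \<in> psets D R \<and> C \<subseteq> B}"
      show "wt B * y (sprod B) * (\<Prod>p\<in>B - C. 1 - real k / real p * real p / real k) = (if B = C then wt C * y (sprod C) else 0)"
      proof (cases "B = C")
        case False
        then obtain p where p: "p \<in> B - C" using B by auto
        then have "1 - real k / real p * real p / real k = 0" using psets_prime_bounds(4)[of B R p] B k0 by simp
        then have "(\<Prod>p\<in>B - C. 1 - real k / real p * real p / real k) = 0"
          using p B by (intro prod_zero) (auto dest: psetsD)
        then show ?thesis using False by simp
      qed auto
    qed
    also have "\<dots> = wt C * y (sprod C)" using C by simp
    finally have i: "(\<Sum>B | B \<in> psets D R \<and> C \<subseteq> B. wt B * y (sprod B) * (\<Prod>p\<in>B - C. 1 - real k / real p * real p / real k)) = wt C * y (sprod C)" .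
    have "(\<Prod>p\<in>C. (1 / (real k / real p) - 1) * (real k / real p * real p / real k)\<^sup>2) * wt C = 1"
      unfolding wt_def prod.distrib[symmetric]
    proof (intro prod.neutral ballI)
      fix p assume p: "p \<in> C"
      show "(1 / (real k / real p) - 1) * (real k / real p * real p / real k)\<^sup>2 * (real k / (real p - real k)) = 1"
        using psets_prime_bounds[OF C p] k0 by (simp add: field_simps)
    qed
    then show "(\<Prod>p\<in>C. (1 / (real k / real p) - 1) * (real k / real p * real p / real k)\<^sup>2) *
        (\<Sum>B | B \<in> psets D R \<and> C \<subseteq> B. wt B * y (sprod B) * (\<Prod>p\<in>B - C. 1 - real k / real p * real p / real k))\<^sup>2
      = wt C * (y (sprod C))\<^sup>2"
      unfolding i by (simp add: power2_eq_square mult.assoc[symmetric])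
  qed
  finally show ?thesis .
qed

text \<open>With density 1 at q, the factor \<open>1 / g q - 1\<close> removes all C containing q,
  and only B = C and \<open>B = insert q C\<close> survive. Since
  \<open>wt (insert q C) * (1 - \<psi> q) = - wt C\<close>, a difference of two values of y appears;
  it is small when y varies slowly.\<close>

lemma lam_form_insert:
  assumes q: "prime q" "D < q"
  shows "(\<Sum>A\<in>psets D R. \<Sum>B\<in>psets D R. lam R y A * lam R y B * (\<Prod>p\<in>insert q (A \<union> B). real k / real p))
    = real k / real q * (\<Sum>C | C \<in> psets D R \<and> q \<notin> C. wt C *
        (y (sprod C) - (if insert q C \<in> psets D R then y (q * sprod C) else 0))\<^sup>2)"
proof -
  have k0: "real k \<noteq> 0" using k2 by simp
  have qk: "real q - real k > 0" "0 < real q" using q D2 k2 by auto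
  \<comment> \<open>Resetting the local density at q to 1 turns the restricted form into an instance of the general one.\<close>
  define g where "g p = (if p = q then 1 else real k / real p)" for p
  define \<psi> where "\<psi> p = g p * real p / real k" for p
  have \<psi>1: "\<psi> p = 1" if "p \<noteq> q" "p > 0" for p using that k0 by (simp add: \<psi>_def g_def)
  have \<psi>q: "\<psi> q = real q / real k" by (simp add: \<psi>_def g_def)
  have ins: "(\<Prod>p\<in>insert q C. real k / real p) = real k / real q * (\<Prod>p\<in>C. g p)" if "finite C" for C
  proof -
    have "(\<Prod>p\<in>C. g p) = (\<Prod>p\<in>C - {q}. g p)"
      using that by (cases "q \<in> C") (auto simp: prod.remove g_def)
    also have "\<dots> = (\<Prod>p\<in>C - {q}. real k / real p)" by (intro prod.cong) (auto simp: g_def)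
    finally show ?thesis using that by (simp add: prod.insert_remove)
  qed
  have "(\<Sum>A\<in>psets D R. \<Sum>B\<in>psets D R. lam R y A * lam R y B * (\<Prod>p\<in>insert q (A \<union> B). real k / real p))
     = real k / real q * (\<Sum>A\<in>psets D R. \<Sum>B\<in>psets D R. lam R y A * lam R y B * (\<Prod>p\<in>A \<union> B. g p))"
    unfolding sum_distrib_left by (intro sum.cong refl, subst ins) (auto dest: psetsD)
  also have "(\<Sum>A\<in>psets D R. \<Sum>B\<in>psets D R. lam R y A * lam R y B * (\<Prod>p\<in>A \<union> B. g p))
    = (\<Sum>C\<in>psets D R. (\<Prod>p\<in>C. (1 / g p - 1) * (\<psi> p)\<^sup>2) *
        (\<Sum>B | B \<in> psets D R \<and> C \<subseteq> B. wt B * y (sprod B) * (\<Prod>p\<in>B - C. 1 - \<psi> p))\<^sup>2)"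
    unfolding \<psi>_def using k0 by (intro lam_form) (auto simp: g_def)
  also have "\<dots> = (\<Sum>C\<in>psets D R. if q \<notin> C then wt C * (y (sprod C) - (if insert q C \<in> psets D R then y (q * sprod C) else 0))\<^sup>2 else 0)"
  proof (intro sum.cong refl)
    fix C assume C: "C \<in> psets D R"
    let ?X = "\<Sum>B | B \<in> psets D R \<and> C \<subseteq> B. wt B * y (sprod B) * (\<Prod>p\<in>B - C. 1 - \<psi> p)"
    let ?d = "y (sprod C) - (if insert q C \<in> psets D R then y (q * sprod C) else 0)"
    show "(\<Prod>p\<in>C. (1 / g p - 1) * (\<psi> p)\<^sup>2) * ?X\<^sup>2 = (if q \<notin> C then wt C * ?d\<^sup>2 else 0)"
    proof (cases "q \<in> C")
      case True
      then have "(\<Prod>p\<in>C. (1 / g p - 1) * (\<psi> p)\<^sup>2) = 0"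
        using psetsD(1)[OF C] by (intro prod_zero) (auto simp: g_def)
      then show ?thesis using True by simp
    next
      case False
      have "?X = (\<Sum>B | B \<in> psets D R \<and> C \<subseteq> B. (if B = C then wt C * y (sprod C) else 0)
          + (if B = insert q C then - wt C * y (q * sprod C) else 0))"
      proof (intro sum.cong refl)
        fix B assume B: "B \<in> {B. B \<in> psets D R \<and> C \<subseteq> B}"
        consider "B = C" | "B = insert q C" | p where "p \<in> B - C" "p \<noteq> q" using B by auto
        then show "wt B * y (sprod B) * (\<Prod>p\<in>B - C. 1 - \<psi> p) = (if B = C then wt C * y (sprod C) else 0)
          + (if B = insert q C then - wt C * y (q * sprod C) else 0)"
        proof cases
          case 1 then show ?thesis using False by auto
        next
          case 2
          have d: "insert q C - C = {q}" using False by auto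
          have "wt (insert q C) = real k / (real q - real k) * wt C"
            unfolding wt_def using False psetsD(1)[OF C] by simp
          then have "wt (insert q C) * (1 - \<psi> q) = - wt C"
            unfolding \<psi>q using qk k0 by (simp add: field_simps)
          then have "wt (insert q C) * y (q * sprod C) * (1 - \<psi> q) = - wt C * y (q * sprod C)"
            by (metis mult.assoc mult.commute)
          moreover have "insert q C \<noteq> C" using False by auto
          ultimately show ?thesis using 2 d False psetsD(1)[OF C] by simp
        next
          case 3
          then have "\<psi> p = 1" using psets_prime_bounds(4)[of B R p] B by (intro \<psi>1) auto
          then have "(\<Prod>p\<in>B - C. 1 - \<psi> p) = 0"
            using 3 B by (intro prod_zero) (auto dest: psetsD)
          moreover have "B \<noteq> C" "B \<noteq> insert q C" using 3 by auto
          ultimately show ?thesis by simp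
        qed
      qed
      also have "\<dots> = wt C * y (sprod C) + (if insert q C \<in> psets D R then - wt C * y (q * sprod C) else 0)"
        unfolding sum.distrib using C by (simp add: subset_insertI)
      also have "\<dots> = wt C * ?d" by (simp add: algebra_simps)
      finally have X: "?X = wt C * ?d" .
      have "(\<Prod>p\<in>C. (1 / g p - 1) * (\<psi> p)\<^sup>2) * wt C = 1"
        unfolding wt_def prod.distrib[symmetric]
      proof (intro prod.neutral ballI)
        fix p assume p: "p \<in> C"
        then have "p \<noteq> q" using False by auto
        then show "(1 / g p - 1) * (\<psi> p)\<^sup>2 * (real k / (real p - real k)) = 1"
          using psets_prime_bounds[OF C p] k0 by (simp add: \<psi>1 g_def field_simps)
      qed
      then show ?thesis unfolding X using False by (simp add: power2_eq_square mult.assoc[symmetric])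
    qed
  qed
  also have "\<dots> = (\<Sum>C | C \<in> psets D R \<and> q \<notin> C. wt C *
        (y (sprod C) - (if insert q C \<in> psets D R then y (q * sprod C) else 0))\<^sup>2)"
    by (simp add: sum.inter_filter)
  finally show ?thesis .
qed

text \<open>When n + h is prime, one of the k roots modulo p is forbidden, whence the density (k -
  1) / (p - 1). Then \<open>wt * (1 - \<psi>)\<close> is locally 1 / (p - 1): the inner sum becomes
  one-dimensional and the outer weight drops to dimension k - 1.\<close>

lemma lam_form_prime:
  "(\<Sum>A\<in>psets D R. \<Sum>B\<in>psets D R. lam R y A * lam R y B * (\<Prod>p\<in>A \<union> B. (real k - 1) / (real p - 1)))
    = (\<Sum>C\<in>psets D R. (\<Prod>p\<in>C. (real k - 1) / (real p - real k)) *
        ((\<Prod>p\<in>C. real p / (real p - 1)) * (\<Sum>m | m \<in> psets D (R / sprod C) \<and> m \<inter> C = {}.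
            (\<Prod>p\<in>m. 1 / (real p - 1)) * y (sprod C * sprod m)))\<^sup>2)"
proof -
  have k0: "real k \<noteq> 0" "real k - 1 \<noteq> 0" using k2 by auto
  define \<psi> where "\<psi> p = (real k - 1) / (real p - 1) * real p / real k" for p :: nat
  have "(\<Sum>A\<in>psets D R. \<Sum>B\<in>psets D R. lam R y A * lam R y B * (\<Prod>p\<in>A \<union> B. (real k - 1) / (real p - 1)))
    = (\<Sum>C\<in>psets D R. (\<Prod>p\<in>C. (1 / ((real k - 1) / (real p - 1)) - 1) * (\<psi> p)\<^sup>2) *
        (\<Sum>B | B \<in> psets D R \<and> C \<subseteq> B. wt B * y (sprod B) * (\<Prod>p\<in>B - C. 1 - \<psi> p))\<^sup>2)"
    unfolding \<psi>_def using k2 D2 by (intro lam_form) auto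
  also have "\<dots> = (\<Sum>C\<in>psets D R. (\<Prod>p\<in>C. (real k - 1) / (real p - real k)) *
        ((\<Prod>p\<in>C. real p / (real p - 1)) * (\<Sum>m | m \<in> psets D (R / sprod C) \<and> m \<inter> C = {}.
            (\<Prod>p\<in>m. 1 / (real p - 1)) * y (sprod C * sprod m)))\<^sup>2)"
  proof (intro sum.cong refl)
    fix C assume C: "C \<in> psets D R"
    let ?M = "{m. m \<in> psets D (R / sprod C) \<and> m \<inter> C = {}}"
    let ?Y = "\<Sum>m\<in>?M. (\<Prod>p\<in>m. 1 / (real p - 1)) * y (sprod C * sprod m)"
    have "(\<Sum>B | B \<in> psets D R \<and> C \<subseteq> B. wt B * y (sprod B) * (\<Prod>p\<in>B - C. 1 - \<psi> p))
       = (\<Sum>m\<in>?M. wt C * ((\<Prod>p\<in>m. 1 / (real p - 1)) * y (sprod C * sprod m)))"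
    proof (rule sum.reindex_bij_witness[where i = "\<lambda>m. C \<union> m" and j = "\<lambda>B. B - C"])
      fix B assume B: "B \<in> {B. B \<in> psets D R \<and> C \<subseteq> B}"
      then have B': "B \<in> psets D R" "C \<subseteq> B" by auto
      have sp: "sprod B = sprod C * sprod (B - C)"
        using sprod_Un_disjoint[of C "B - C"] B' psetsD(1)[OF B'(1)] psetsD(1)[OF C] by (simp add: Un_absorb1)
      have "real (sprod C) * real (sprod (B - C)) \<le> R" using psetsD(4)[OF B'(1)] sp by simp
      then have "real (sprod (B - C)) \<le> R / real (sprod C)" using psets_prod_ge1[OF C] by (simp add: field_simps)
      then show "B - C \<in> ?M" using B' by (auto simp: psets_def)
      have t1: "wt B = wt C * wt (B - C)"
        unfolding wt_def using prod.subset_diff[of C B] B' psetsD(1)[OF B'(1)] by (simp add: mult.commute)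
      have t2: "wt (B - C) * (\<Prod>p\<in>B - C. 1 - \<psi> p) = (\<Prod>p\<in>B - C. 1 / (real p - 1))"
        unfolding wt_def prod.distrib[symmetric]
      proof (intro prod.cong refl)
        fix p assume p: "p \<in> B - C"
        then have b: "real p - real k \<noteq> 0" "real p - 1 \<noteq> 0" using psets_prime_bounds[OF B'(1), of p] by auto
        have "1 - \<psi> p = (real p - real k) / ((real p - 1) * real k)"
          unfolding \<psi>_def using b k0 by (simp add: field_simps)
        then show "real k / (real p - real k) * (1 - \<psi> p) = 1 / (real p - 1)" using b k0 by simp
      qed
      show "wt C * ((\<Prod>p\<in>B - C. 1 / (real p - 1)) * y (sprod C * sprod (B - C))) = wt B * y (sprod B) * (\<Prod>p\<in>B - C. 1 - \<psi> p)"
        unfolding sp t1 t2[symmetric] by (simp add: mult_ac)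
    next
      fix m assume m: "m \<in> ?M"
      then have m': "m \<in> psets D (R / sprod C)" by simp
      have "real (sprod m) \<le> R / sprod C" using psetsD(4)[OF m'] .
      then have "real (sprod (C \<union> m)) \<le> R"
        using m psetsD(1)[OF m'] psetsD(1)[OF C] psets_prod_ge1[OF C] by (subst sprod_Un_disjoint) (auto simp: field_simps)
      then show "C \<union> m \<in> {B. B \<in> psets D R \<and> C \<subseteq> B}"
        using m' C by (auto simp: psets_def)
      show "C \<union> m - C = m" using m by auto
    qed auto
    then have X: "(\<Sum>B | B \<in> psets D R \<and> C \<subseteq> B. wt B * y (sprod B) * (\<Prod>p\<in>B - C. 1 - \<psi> p)) = wt C * ?Y"
      by (simp add: sum_distrib_left)
    have P: "(\<Prod>p\<in>C. (1 / ((real k - 1) / (real p - 1)) - 1) * (\<psi> p)\<^sup>2) * (wt C)\<^sup>2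
       = (\<Prod>p\<in>C. (real k - 1) / (real p - real k)) * (\<Prod>p\<in>C. real p / (real p - 1))\<^sup>2"
      unfolding wt_def prod_power_distrib prod.distrib[symmetric]
    proof (intro prod.cong refl)
      fix p assume p: "p \<in> C"
      have b: "real p - real k \<noteq> 0" "real p - 1 \<noteq> 0" using psets_prime_bounds[OF C p] by auto
      have 1: "1 / ((real k - 1) / (real p - 1)) - 1 = (real p - real k) / (real k - 1)"
        using k0 by (simp add: field_simps)
      have 2: "\<psi> p * (real k / (real p - real k)) = (real k - 1) / (real p - real k) * (real p / (real p - 1))"
        unfolding \<psi>_def using k0 by simp
      have "(1 / ((real k - 1) / (real p - 1)) - 1) * (\<psi> p)\<^sup>2 * (real k / (real p - real k))\<^sup>2
         = (real p - real k) / (real k - 1) * ((real k - 1) / (real p - real k) * (real p / (real p - 1)))\<^sup>2"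
        unfolding 1 2[symmetric] power_mult_distrib by (simp only: mult.assoc)
      also have "\<dots> = (real k - 1) / (real p - real k) * (real p / (real p - 1))\<^sup>2"
        using b k0 by (simp add: power2_eq_square mult_ac)
      finally show "(1 / ((real k - 1) / (real p - 1)) - 1) * (\<psi> p)\<^sup>2 * (real k / (real p - real k))\<^sup>2
         = (real k - 1) / (real p - real k) * (real p / (real p - 1))\<^sup>2" .
    qed
    show "(\<Prod>p\<in>C. (1 / ((real k - 1) / (real p - 1)) - 1) * (\<psi> p)\<^sup>2) *
        (\<Sum>B | B \<in> psets D R \<and> C \<subseteq> B. wt B * y (sprod B) * (\<Prod>p\<in>B - C. 1 - \<psi> p))\<^sup>2
       = (\<Prod>p\<in>C. (real k - 1) / (real p - real k)) * ((\<Prod>p\<in>C. real p / (real p - 1)) * ?Y)\<^sup>2"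
      unfolding X power_mult_distrib mult.assoc[symmetric] P ..
  qed
  finally show ?thesis .
qed

end

section \<open>Sieve sums over a window\<close>

definition errA :: "nat \<Rightarrow> nat \<Rightarrow> real" where
  "errA N q = Max ((\<lambda>a. \<bar>(\<Sum>p | prime p \<and> p \<le> N \<and> [p = a] (mod q). ln (real p))
                    - real N / real (totient q)\<bar>) ` {a. a < q \<and> coprime a q})"

definition errB :: "nat \<Rightarrow> nat \<Rightarrow> real" where
  "errB N q = Max ((\<lambda>(y, a). \<bar>\<Sum>n | 1 \<le> n \<and> n \<le> y \<and> [n = a] (mod q). liouville n\<bar>)
               ` ({..N} \<times> {..<q}))"

definition lnp :: "nat \<Rightarrow> real" where
  "lnp n = (if prime n then ln (real n) else 0)"

lemma errA_ge:
  assumes "0 < q" "coprime a q"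
  shows "\<bar>(\<Sum>p | prime p \<and> p \<le> N \<and> [p = a] (mod q). ln (real p)) - real N / real (totient q)\<bar> \<le> errA N q"
proof -
  have "[p = a] (mod q) \<longleftrightarrow> [p = a mod q] (mod q)" for p by (simp add: cong_def)
  then have "\<bar>(\<Sum>p | prime p \<and> p \<le> N \<and> [p = a] (mod q). ln (real p)) - real N / real (totient q)\<bar>
    = \<bar>(\<Sum>p | prime p \<and> p \<le> N \<and> [p = a mod q] (mod q). ln (real p)) - real N / real (totient q)\<bar>" by simp
  also have "\<dots> \<le> errA N q" unfolding errA_def
    using assms by (intro Max_ge) (auto intro!: image_eqI[of _ _ "a mod q"])
  finally show ?thesis .
qed

lemma errB_ge:
  assumes "y \<le> N" "0 < q"
  shows "\<bar>\<Sum>n | 1 \<le> n \<and> n \<le> y \<and> [n = a] (mod q). liouville n\<bar> \<le> errB N q"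
proof -
  have "[n = a] (mod q) \<longleftrightarrow> [n = a mod q] (mod q)" for n by (simp add: cong_def)
  then have "\<bar>\<Sum>n | 1 \<le> n \<and> n \<le> y \<and> [n = a] (mod q). liouville n\<bar>
    = \<bar>\<Sum>n | 1 \<le> n \<and> n \<le> y \<and> [n = a mod q] (mod q). liouville n\<bar>" by simp
  also have "\<dots> \<le> errB N q" unfolding errB_def
    using assms by (intro Max_ge) (auto intro!: image_eqI[of _ _ "(y, a mod q)"])
  finally show ?thesis .
qed

lemma cong_add_residue_iff:
  fixes n h a q :: nat
  assumes "a < q"
  shows "[n + h = a + h] (mod q) \<longleftrightarrow> n mod q = a"
  using assms by (simp add: cong_def cong_add_rcancel_nat[unfolded cong_def])

text \<open>Initial segments in a residue class are the form in which conditions (A) and (B) measure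
  errors. The minimum keeps the identity valid for M < N.\<close>

lemma sum_shift_window:
  fixes f :: "nat \<Rightarrow> real"
  assumes "a < q"
  shows "(\<Sum>n | (N < n \<and> n \<le> M) \<and> n mod q = a. f (n + h))
    = (\<Sum>m | 1 \<le> m \<and> m \<le> M + h \<and> [m = a + h] (mod q). f m) - (\<Sum>m | 1 \<le> m \<and> m \<le> min N M + h \<and> [m = a + h] (mod q). f m)"
proof -
  have "(\<Sum>n | (N < n \<and> n \<le> M) \<and> n mod q = a. f (n + h))
     = (\<Sum>m | N + h < m \<and> m \<le> M + h \<and> [m = a + h] (mod q). f m)"
  proof (rule sum.reindex_bij_witness[where i = "\<lambda>m. m - h" and j = "\<lambda>n. n + h"], goal_cases)
    case (2 n) then show ?case using cong_add_residue_iff[OF assms, of n h] by auto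
  next
    case (4 m) then show ?case using cong_add_residue_iff[OF assms, of "m - h" h] by auto
  qed auto
  moreover have "{m. 1 \<le> m \<and> m \<le> M + h \<and> [m = a + h] (mod q)}
     = {m. 1 \<le> m \<and> m \<le> min N M + h \<and> [m = a + h] (mod q)} \<union> {m. N + h < m \<and> m \<le> M + h \<and> [m = a + h] (mod q)}"
    by auto
  moreover have "(\<Sum>m\<in>{m. 1 \<le> m \<and> m \<le> min N M + h \<and> [m = a + h] (mod q)} \<union> {m. N + h < m \<and> m \<le> M + h \<and> [m = a + h] (mod q)}. f m)
     = (\<Sum>m | 1 \<le> m \<and> m \<le> min N M + h \<and> [m = a + h] (mod q). f m) + (\<Sum>m | N + h < m \<and> m \<le> M + h \<and> [m = a + h] (mod q). f m)"
    by (intro sum.union_disjoint) auto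
  ultimately show ?thesis by simp
qed

text \<open>Rankin's trick with exponent 1: each term is enlarged by the factor
  \<open>x / sprod C\<close>, which is at least 1.\<close>

lemma psets_power_card_sum_le:
  assumes "1 \<le> x"
  shows "(\<Sum>C\<in>psets D x. real K ^ card C) \<le> x * (1 + ln x) ^ K"
proof -
  have "(\<Sum>C\<in>psets D x. real K ^ card C) \<le> (\<Sum>C\<in>psets D x. x * (real K ^ card C / real (sprod C)))"
  proof (intro sum_mono)
    fix C assume C: "C \<in> psets D x"
    have "1 \<le> x / real (sprod C)" by (rule psets_quotient_ge1[OF C])
    then have "1 * real K ^ card C \<le> x / real (sprod C) * real K ^ card C" by (intro mult_right_mono) auto
    then show "real K ^ card C \<le> x * (real K ^ card C / real (sprod C))" by simp
  qed
  also have "\<dots> \<le> x * (1 + ln x) ^ K"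
    unfolding sum_distrib_left[symmetric] using assms by (intro mult_left_mono psets_power_sum_le) auto
  finally show ?thesis .
qed

context tuple_sieve
begin

text \<open>The root belonging to h is p - h, reduced to cover h = 0. All h are below p, so
  different shifts have different roots.\<close>

lemma card_roots:
  assumes p: "prime p" "D < p"
  shows "card {a. a < p \<and> has_root a p} = k"
    and "h \<in> H \<Longrightarrow> card {a. a < p \<and> has_root a p \<and> \<not> p dvd a + h} = k - 1"
proof -
  let ?f = "\<lambda>h. (p - h) mod p"
  have H: "h < p" if "h \<in> H" for h using HD[OF that] p by simp
  have root: "p dvd a + h \<longleftrightarrow> a = ?f h" if "a < p" "h \<in> H" for a h
  proof -
    have "h < p" using H that by auto
    show ?thesis
    proof (cases "h = 0")
      case True then show ?thesis using that by (auto dest: dvd_imp_le)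
    next
      case False
      then have f: "?f h = p - h" using \<open>h < p\<close> by simp
      show ?thesis
      proof
        assume d: "p dvd a + h"
        then obtain c where c: "a + h = p * c" by auto
        have "c = 1"
        proof -
          have "c \<noteq> 0" using c False by (intro notI) simp
          moreover have "p * c < p * 2" using c that \<open>h < p\<close> by linarith
          then have "c < 2" by simp
          ultimately show ?thesis by simp
        qed
        then show "a = ?f h" using c f by simp
      next
        assume "a = ?f h"
        then have "a + h = p" using f \<open>h < p\<close> by simp
        then show "p dvd a + h" by simp
      qed
    qed
  qed
  have inj: "inj_on ?f H"
  proof (rule inj_onI)
    fix x y assume "x \<in> H" "y \<in> H" "?f x = ?f y"
    then show "x = y" using H[of x] H[of y] by (cases "x = 0"; cases "y = 0") auto
  qed
  have p0: "0 < p" using p by simp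
  have img: "{a. a < p \<and> has_root a p} = ?f ` H"
    using root p0 by (auto simp: has_root_def)
  then show "card {a. a < p \<and> has_root a p} = k" using inj cardH by (simp add: card_image)
  assume h: "h \<in> H"
  have "{a. a < p \<and> has_root a p \<and> \<not> p dvd a + h} = ?f ` H - {?f h}"
    using root p0 h unfolding has_root_def by auto
  also have "\<dots> = ?f ` (H - {h})" using inj h by (subst inj_on_image_set_diff) auto
  also have "card \<dots> = k - 1" using inj h cardH finH by (subst card_image) (auto intro: inj_on_subset)
  finally show "card {a. a < p \<and> has_root a p \<and> \<not> p dvd a + h} = k - 1" .
qed

lemma dvd_mod_add_iff: "(p::nat) dvd n mod p + h \<longleftrightarrow> p dvd n + h"
  by (simp add: dvd_eq_mod_eq_0 mod_add_left_eq)

lemma has_root_mod: "has_root (n mod p) p \<longleftrightarrow> has_root n p"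
  by (simp add: has_root_def dvd_mod_add_iff)

lemma card_res_classes_psets:
  assumes C: "C \<in> psets D x" and S: "\<And>p. p \<in> C \<Longrightarrow> S p \<subseteq> {..<p} \<and> card (S p) = c"
  shows "card (res_classes W v S C) = c ^ card C"
proof -
  have "card (res_classes W v S C) = (\<Prod>p\<in>C. card (S p))"
  proof (intro card_res_classes v)
    fix p assume p: "p \<in> C"
    show "\<not> p dvd W" using psetsD[OF C] p by (intro not_dvd_W) auto
    show "S p \<subseteq> {..<p}" using S[OF p] by simp
  qed (use C in \<open>auto dest: psetsD\<close>)
  then show ?thesis using S by simp
qed

lemma sum_window_classes:
  fixes F :: "nat \<Rightarrow> real"
  assumes C: "C \<in> psets D x"
  shows "(\<Sum>n | n \<in> window N \<and> (\<forall>p\<in>C. n mod p \<in> S p). F n)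
    = (\<Sum>a\<in>res_classes W v S C. \<Sum>n | (N < n \<and> n \<le> 2 * N) \<and> n mod (W * sprod C) = a. F n)"
proof -
  have "{n. n \<in> window N \<and> (\<forall>p\<in>C. n mod p \<in> S p)} = {n. n \<in> {n. N < n \<and> n \<le> 2 * N} \<and> n mod W = v \<and> (\<forall>p\<in>C. n mod p \<in> S p)}"
    by (auto simp: window_def)
  moreover have "finite {n. N < n \<and> n \<le> 2 * N}" by (rule finite_subset[of _ "{..2 * N}"]) auto
  ultimately show ?thesis
    using sum_over_res_classes[where X = "{n. N < n \<and> n \<le> 2 * N}" and C = C and W = W and v = v and S = S and F = F] W_pos psetsD(1)[OF C] psetsD(2)[OF C]
    by (simp add: prime_gt_0_nat)
qed

lemma sum_window_roots:
  fixes F :: "nat \<Rightarrow> real"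
  assumes C: "C \<in> psets D x"
  shows "(\<Sum>n | n \<in> window N \<and> (\<forall>p\<in>C. has_root n p). F n)
    = (\<Sum>a\<in>res_classes W v (\<lambda>p. {a. a < p \<and> has_root a p}) C. \<Sum>n | (N < n \<and> n \<le> 2 * N) \<and> n mod (W * sprod C) = a. F n)"
proof -
  have "n mod p \<in> {a. a < p \<and> has_root a p} \<longleftrightarrow> has_root n p" if "p \<in> C" for n p
    using psetsD(2)[OF C that] prime_gt_0_nat[of p] by (simp add: has_root_mod)
  then have "{n. n \<in> window N \<and> (\<forall>p\<in>C. has_root n p)} = {n. n \<in> window N \<and> (\<forall>p\<in>C. n mod p \<in> {a. a < p \<and> has_root a p})}"
    by auto
  then show ?thesis using sum_window_classes[OF C, where N = N and S = "\<lambda>p. {a. a < p \<and> has_root a p}" and F = F] by simp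
qed

lemma card_root_classes:
  assumes C: "C \<in> psets D x"
  shows "card (res_classes W v (\<lambda>p. {a. a < p \<and> has_root a p}) C) = k ^ card C"
  using C card_roots(1) by (intro card_res_classes_psets[OF C]) (auto dest: psetsD)

lemma count_roots:
  assumes C: "C \<in> psets D x"
  shows "\<bar>(\<Sum>n | n \<in> window N \<and> (\<forall>p\<in>C. has_root n p). 1) - real N / real W * (\<Prod>p\<in>C. real k / real p)\<bar> \<le> real k ^ card C"
proof -
  let ?A = "res_classes W v (\<lambda>p. {a. a < p \<and> has_root a p}) C" and ?q = "W * sprod C"
  have main: "real N / real W * (\<Prod>p\<in>C. real k / real p) = (\<Sum>a\<in>?A. real N / real ?q)"
    by (simp add: card_root_classes[OF C] prod_dividef sprod_def)
  have "\<bar>(\<Sum>n | n \<in> window N \<and> (\<forall>p\<in>C. has_root n p). 1) - real N / real W * (\<Prod>p\<in>C. real k / real p)\<bar>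
     = \<bar>\<Sum>a\<in>?A. (\<Sum>n | (N < n \<and> n \<le> 2 * N) \<and> n mod ?q = a. 1) - real N / real ?q\<bar>"
    unfolding main sum_window_roots[OF C] sum_subtractf ..
  also have "\<dots> \<le> (\<Sum>a\<in>?A. 1)"
  proof (intro order_trans[OF sum_abs] sum_mono)
    fix a assume "a \<in> ?A"
    then have "a < ?q" by (simp add: res_classes_def)
    then show "\<bar>(\<Sum>n | (N < n \<and> n \<le> 2 * N) \<and> n mod ?q = a. 1) - real N / real ?q\<bar> \<le> 1"
      using card_mod_interval[of a ?q N "2 * N"] by (simp add: conj_assoc)
  qed
  also have "\<dots> = real k ^ card C" by (simp add: card_root_classes[OF C])
  finally show ?thesis .
qed

lemma sieve_sum_bound:
  assumes R: "1 \<le> R" and y: "\<And>n. 1 \<le> n \<Longrightarrow> real n \<le> R \<Longrightarrow> 0 \<le> y n" "\<And>n. 1 \<le> n \<Longrightarrow> real n \<le> R \<Longrightarrow> y n \<le> Y"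
  shows "\<bar>(\<Sum>n\<in>window N. sw R y n) - real N / real W * (\<Sum>C\<in>psets D R. wt C * (y (sprod C))\<^sup>2)\<bar>
     \<le> (Y * (1 + ln R) ^ (2 * k))\<^sup>2 * (R * R * (1 + ln (R * R)) ^ (16 * k))"
proof -
  have Y: "0 \<le> Y" using y(1)[of 1] y(2)[of 1] R by simp
  have R1: "1 \<le> R * R" using R mult_mono[of 1 R 1 R] by simp
  let ?L = "Y * (1 + ln R) ^ (2 * k)"
  have L: "0 \<le> ?L" using Y R by simp
  have "\<bar>(\<Sum>n\<in>window N. sw R y n * 1) - real N / real W * (\<Sum>A\<in>psets D R. \<Sum>B\<in>psets D R. lam R y A * lam R y B * (\<Prod>p\<in>A \<union> B. real k / real p))\<bar>
     \<le> ?L\<^sup>2 * (\<Sum>C\<in>psets D (R * R). 16 ^ card C * real k ^ card C)"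
    by (rule sum_sw_approx[OF lam_bound[OF R y] L count_roots])
  also have "(\<Sum>C\<in>psets D (R * R). 16 ^ card C * real k ^ card C) = (\<Sum>C\<in>psets D (R * R). real (16 * k) ^ card C)"
    by (simp add: power_mult_distrib)
  also have "?L\<^sup>2 * \<dots> \<le> ?L\<^sup>2 * (R * R * (1 + ln (R * R)) ^ (16 * k))"
    by (intro mult_left_mono psets_power_card_sum_le R1) simp
  finally show ?thesis unfolding lam_form_root by simp
qed

lemma sieve_sum_root_bound:
  assumes R: "1 \<le> R" and y: "\<And>n. 1 \<le> n \<Longrightarrow> real n \<le> R \<Longrightarrow> 0 \<le> y n" "\<And>n. 1 \<le> n \<Longrightarrow> real n \<le> R \<Longrightarrow> y n \<le> Y"
    and q: "prime q" "D < q"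
  shows "\<bar>(\<Sum>n | n \<in> window N \<and> has_root n q. sw R y n) - real N / real W * (real k / real q *
       (\<Sum>C | C \<in> psets D R \<and> q \<notin> C. wt C * (y (sprod C) - (if insert q C \<in> psets D R then y (q * sprod C) else 0))\<^sup>2))\<bar>
     \<le> (Y * (1 + ln R) ^ (2 * k))\<^sup>2 * (real k * (R * R * (1 + ln (R * R)) ^ (16 * k)))"
proof -
  have Y: "0 \<le> Y" using y(1)[of 1] y(2)[of 1] R by simp
  have R1: "1 \<le> R * R" using R mult_mono[of 1 R 1 R] by simp
  let ?L = "Y * (1 + ln R) ^ (2 * k)" and ?F = "\<lambda>n. if has_root n q then 1 else 0 :: real"
  have L: "0 \<le> ?L" using Y R by simp
  have cnt: "\<bar>(\<Sum>n | n \<in> window N \<and> (\<forall>p\<in>C. has_root n p). ?F n) - real N / real W * (\<Prod>p\<in>insert q C. real k / real p)\<bar>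
     \<le> real k * real k ^ card C" if C: "C \<in> psets D (R * R)" for C
  proof -
    \<comment> \<open>Together with q the modulus may exceed \<open>R * R\<close>. The estimate of
      \<open>count_roots\<close> does not depend on the bound, so the modulus itself is taken as the
      bound.\<close>
    have i: "insert q C \<in> psets D (real (sprod (insert q C)))" using C q by (auto simp: psets_def)
    have fw: "finite {n. n \<in> window N \<and> (\<forall>p\<in>C. has_root n p)}" by (rule finite_subset[of _ "window N"]) auto
    have "(\<Sum>n | n \<in> window N \<and> (\<forall>p\<in>C. has_root n p). ?F n)
       = (\<Sum>n\<in>{n \<in> {n. n \<in> window N \<and> (\<forall>p\<in>C. has_root n p)}. has_root n q}. 1)"
      by (rule sum.inter_filter[OF fw, symmetric])
    also have "{n \<in> {n. n \<in> window N \<and> (\<forall>p\<in>C. has_root n p)}. has_root n q} = {n. n \<in> window N \<and> (\<forall>p\<in>insert q C. has_root n p)}"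
      by auto
    finally have "\<bar>(\<Sum>n | n \<in> window N \<and> (\<forall>p\<in>C. has_root n p). ?F n) - real N / real W * (\<Prod>p\<in>insert q C. real k / real p)\<bar>
       \<le> real k ^ card (insert q C)"
      using count_roots[OF i, of N] by simp
    also have "\<dots> \<le> real k ^ (Suc (card C))"
      using k2 psetsD(1)[OF C] by (intro power_increasing) (auto simp: card_insert_if)
    finally show ?thesis by simp
  qed
  have "\<bar>(\<Sum>n\<in>window N. sw R y n * ?F n) - real N / real W * (\<Sum>A\<in>psets D R. \<Sum>B\<in>psets D R. lam R y A * lam R y B * (\<Prod>p\<in>insert q (A \<union> B). real k / real p))\<bar>
     \<le> ?L\<^sup>2 * (\<Sum>C\<in>psets D (R * R). 16 ^ card C * (real k * real k ^ card C))"
    by (rule sum_sw_approx[OF lam_bound[OF R y] L cnt])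
  also have "(\<Sum>C\<in>psets D (R * R). 16 ^ card C * (real k * real k ^ card C)) = real k * (\<Sum>C\<in>psets D (R * R). real (16 * k) ^ card C)"
    by (simp add: power_mult_distrib sum_distrib_left mult_ac)
  also have "?L\<^sup>2 * \<dots> \<le> ?L\<^sup>2 * (real k * (R * R * (1 + ln (R * R)) ^ (16 * k)))"
    by (intro mult_left_mono psets_power_card_sum_le R1) auto
  also have "(\<Sum>n\<in>window N. sw R y n * ?F n) = (\<Sum>n | n \<in> window N \<and> has_root n q. sw R y n)"
    by (simp add: sum.inter_filter if_distrib[of "\<lambda>x. _ * x"] cong: if_cong)
  finally show ?thesis unfolding lam_form_insert[OF q] .
qed

lemma totient_W_sprod:
  assumes C: "C \<in> psets D x"
  shows "real (totient (W * sprod C)) = real (totient W) * (\<Prod>p\<in>C. real p - 1)"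
proof -
  let ?P = "{p. prime p \<and> p \<le> D}"
  have dis: "?P \<inter> C = {}" by (auto dest!: psetsD(3)[OF C])
  have "W * sprod C = sprod (?P \<union> C)"
    unfolding W_def using psetsD(1)[OF C] dis by (intro sprod_Un_disjoint[symmetric]) auto
  moreover have "real (totient (sprod (?P \<union> C))) = (\<Prod>p\<in>?P \<union> C. real p - 1)"
    using psetsD(1,2)[OF C] by (intro totient_sprod) auto
  moreover have "(\<Prod>p\<in>?P \<union> C. real p - 1) = (\<Prod>p\<in>?P. real p - 1) * (\<Prod>p\<in>C. real p - 1)"
    using psetsD(1)[OF C] dis by (intro prod.union_disjoint) auto
  moreover have "real (totient W) = (\<Prod>p\<in>?P. real p - 1)"
    unfolding W_def by (intro totient_sprod) auto
  ultimately show ?thesis by simp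
qed

text \<open>A prime n + h exceeds N and hence every p in C, so it is divisible by none of them. This
  leaves k - 1 admissible roots per prime, all of them reduced classes, to which condition (A)
  applies.\<close>

lemma sum_lnp_window:
  assumes C: "C \<in> psets D x" and CN: "\<And>p. p \<in> C \<Longrightarrow> p \<le> N" and h: "h \<in> H"
  shows "\<bar>(\<Sum>n | n \<in> window N \<and> (\<forall>p\<in>C. has_root n p). lnp (n + h)) - real N / real (totient W) * (\<Prod>p\<in>C. (real k - 1) / (real p - 1))\<bar>
    \<le> real k ^ card C * (errA (2 * N + h) (W * sprod C) + errA (N + h) (W * sprod C))"
proof -
  let ?S = "\<lambda>p. {a. a < p \<and> has_root a p \<and> \<not> p dvd a + h}"
  let ?A = "res_classes W v ?S C" and ?q = "W * sprod C"
  let ?E = "errA (2 * N + h) ?q + errA (N + h) ?q"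
  have q0: "0 < ?q" using W_pos psets_prod_pos[OF C] by simp
  have cA: "card ?A = (k - 1) ^ card C"
    using C card_roots(2) h by (intro card_res_classes_psets[OF C]) (auto dest: psetsD)
  have E0: "0 \<le> ?E" using order_trans[OF abs_ge_zero errA_ge[OF q0 coprime_1_left, of "2 * N + h"]]
      order_trans[OF abs_ge_zero errA_ge[OF q0 coprime_1_left, of "N + h"]] by simp
  have "(\<Sum>n | n \<in> window N \<and> (\<forall>p\<in>C. has_root n p). lnp (n + h))
     = (\<Sum>n | n \<in> window N \<and> (\<forall>p\<in>C. n mod p \<in> ?S p). lnp (n + h))"
  proof (rule sum.mono_neutral_right)
    show "finite {n. n \<in> window N \<and> (\<forall>p\<in>C. has_root n p)}" by (rule finite_subset[of _ "window N"]) auto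
    have *: "n mod p \<in> ?S p \<longleftrightarrow> has_root n p \<and> \<not> p dvd n + h" if "p \<in> C" for n p
      using psetsD(2)[OF C that] prime_gt_0_nat[of p] by (simp add: has_root_mod dvd_mod_add_iff)
    show "{n. n \<in> window N \<and> (\<forall>p\<in>C. n mod p \<in> ?S p)} \<subseteq> {n. n \<in> window N \<and> (\<forall>p\<in>C. has_root n p)}"
      using * by blast
    show "\<forall>n\<in>{n. n \<in> window N \<and> (\<forall>p\<in>C. has_root n p)} - {n. n \<in> window N \<and> (\<forall>p\<in>C. n mod p \<in> ?S p)}. lnp (n + h) = 0"
    proof
      fix n assume "n \<in> {n. n \<in> window N \<and> (\<forall>p\<in>C. has_root n p)} - {n. n \<in> window N \<and> (\<forall>p\<in>C. n mod p \<in> ?S p)}"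
      then obtain p where p: "p \<in> C" "p dvd n + h" and n: "N < n" using * unfolding window_def by blast
      have "\<not> prime (n + h)"
      proof
        assume "prime (n + h)"
        then have "p = n + h" using p psetsD(2)[OF C p(1)] by (simp add: primes_dvd_imp_eq)
        then show False using CN[OF p(1)] n by simp
      qed
      then show "lnp (n + h) = 0" by (simp add: lnp_def)
    qed
  qed
  also have "\<dots> = (\<Sum>a\<in>?A. \<Sum>n | (N < n \<and> n \<le> 2 * N) \<and> n mod ?q = a. lnp (n + h))"
    by (rule sum_window_classes[OF C])
  finally have eq: "(\<Sum>n | n \<in> window N \<and> (\<forall>p\<in>C. has_root n p). lnp (n + h))
     = (\<Sum>a\<in>?A. \<Sum>n | (N < n \<and> n \<le> 2 * N) \<and> n mod ?q = a. lnp (n + h))" .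
  have main: "real N / real (totient W) * (\<Prod>p\<in>C. (real k - 1) / (real p - 1)) = (\<Sum>a\<in>?A. real N / real (totient ?q))"
    using k2 by (simp add: cA totient_W_sprod[OF C] prod_dividef of_nat_diff)
  have lnpsum: "(\<Sum>m | 1 \<le> m \<and> m \<le> M \<and> [m = c] (mod ?q). lnp m) = (\<Sum>p | prime p \<and> p \<le> M \<and> [p = c] (mod ?q). ln (real p))" for M c
    by (rule sum.mono_neutral_cong_right) (auto simp: lnp_def Suc_le_eq prime_gt_0_nat)
  have "\<bar>(\<Sum>n | n \<in> window N \<and> (\<forall>p\<in>C. has_root n p). lnp (n + h)) - real N / real (totient W) * (\<Prod>p\<in>C. (real k - 1) / (real p - 1))\<bar>
     = \<bar>\<Sum>a\<in>?A. (\<Sum>n | (N < n \<and> n \<le> 2 * N) \<and> n mod ?q = a. lnp (n + h)) - real N / real (totient ?q)\<bar>"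
    unfolding main eq sum_subtractf ..
  also have "\<dots> \<le> (\<Sum>a\<in>?A. ?E)"
  proof (intro order_trans[OF sum_abs] sum_mono)
    fix a assume a: "a \<in> ?A"
    then have aq: "a < ?q" "a mod W = v" "\<And>p. p \<in> C \<Longrightarrow> \<not> p dvd a + h"
      by (auto simp: res_classes_def dvd_mod_add_iff)
    have co: "coprime (a + h) ?q"
    proof -
      have "coprime (a + h) W"
      proof -
        have "gcd (a + h) W = gcd W ((a + h) mod W)" by (rule gcd_red_nat)
        also have "(a + h) mod W = (v + h) mod W" using aq(2) by (metis mod_add_left_eq)
        also have "gcd W ((v + h) mod W) = gcd (v + h) W" by (rule gcd_red_nat[symmetric])
        also have "\<dots> = 1" using vH[OF h] coprime_iff_gcd_eq_1 by blast
        finally show ?thesis using coprime_iff_gcd_eq_1 by blast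
      qed
      moreover have "coprime (a + h) (sprod C)" unfolding sprod_def
      proof (rule prod_coprime_right)
        fix p assume p: "p \<in> C"
        show "coprime (a + h) p"
          using prime_imp_coprime[OF psetsD(2)[OF C p] aq(3)[OF p]] by (rule coprime_commute[THEN iffD1])
      qed
      ultimately show ?thesis by simp
    qed
    have "(\<Sum>n | (N < n \<and> n \<le> 2 * N) \<and> n mod ?q = a. lnp (n + h))
       = (\<Sum>p | prime p \<and> p \<le> 2 * N + h \<and> [p = a + h] (mod ?q). ln (real p)) - (\<Sum>p | prime p \<and> p \<le> N + h \<and> [p = a + h] (mod ?q). ln (real p))"
      using sum_shift_window[OF aq(1), where N = N and M = "2 * N" and f = lnp and h = h] lnpsum[of "2 * N + h" "a + h"] lnpsum[of "N + h" "a + h"]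
      by (simp add: min_def)
    moreover have "real N / real (totient ?q) = real (2 * N + h) / real (totient ?q) - real (N + h) / real (totient ?q)"
      by (simp add: diff_divide_distrib[symmetric])
    ultimately show "\<bar>(\<Sum>n | (N < n \<and> n \<le> 2 * N) \<and> n mod ?q = a. lnp (n + h)) - real N / real (totient ?q)\<bar> \<le> ?E"
      using errA_ge[OF q0 co, of "2 * N + h"] errA_ge[OF q0 co, of "N + h"] by linarith
  qed
  also have "\<dots> = real (k - 1) ^ card C * ?E" by (simp add: cA)
  also have "\<dots> \<le> real k ^ card C * ?E" using E0 by (intro mult_right_mono power_mono) auto
  finally show ?thesis .
qed

text \<open>The classes need not be reduced and there is no main term, which is why (B) takes the
  maximum over all classes and all initial segments. The window is a difference of two segments,
  hence the factor 2.\<close>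

lemma sum_liouville_window:
  assumes C: "C \<in> psets D x" and h: "2 * N + h \<le> 3 * N"
  shows "\<bar>\<Sum>n | n \<in> window N \<and> (\<forall>p\<in>C. has_root n p). liouville (n + h)\<bar> \<le> real k ^ card C * (2 * errB (3 * N) (W * sprod C))"
proof -
  let ?A = "res_classes W v (\<lambda>p. {a. a < p \<and> has_root a p}) C" and ?q = "W * sprod C"
  have q0: "0 < ?q" using W_pos psets_prod_pos[OF C] by simp
  have "\<bar>\<Sum>n | n \<in> window N \<and> (\<forall>p\<in>C. has_root n p). liouville (n + h)\<bar> \<le> (\<Sum>a\<in>?A. 2 * errB (3 * N) ?q)"
    unfolding sum_window_roots[OF C]
  proof (rule order_trans[OF sum_abs], rule sum_mono)
    fix a assume a: "a \<in> ?A"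
    then have aq: "a < ?q" by (auto simp: res_classes_def)
    show "\<bar>\<Sum>n | (N < n \<and> n \<le> 2 * N) \<and> n mod ?q = a. liouville (n + h)\<bar> \<le> 2 * errB (3 * N) ?q"
      using sum_shift_window[OF aq, where N = N and M = "2 * N" and f = liouville and h = h] h
        errB_ge[of "2 * N + h" "3 * N" ?q "a + h"] errB_ge[of "min N (2 * N) + h" "3 * N" ?q "a + h"] q0 by linarith
  qed
  also have "\<dots> = real k ^ card C * (2 * errB (3 * N) ?q)" by (simp add: card_root_classes[OF C])
  finally show ?thesis .
qed

lemma sieve_sum_prime_bound:
  assumes R: "1 \<le> R" and y: "\<And>n. 1 \<le> n \<Longrightarrow> real n \<le> R \<Longrightarrow> 0 \<le> y n" "\<And>n. 1 \<le> n \<Longrightarrow> real n \<le> R \<Longrightarrow> y n \<le> Y"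
    and h: "h \<in> H" and RN: "R * R \<le> real N"
  shows "\<bar>(\<Sum>n\<in>window N. sw R y n * lnp (n + h)) - real N / real (totient W) *
       (\<Sum>C\<in>psets D R. (\<Prod>p\<in>C. (real k - 1) / (real p - real k)) *
        ((\<Prod>p\<in>C. real p / (real p - 1)) * (\<Sum>m | m \<in> psets D (R / sprod C) \<and> m \<inter> C = {}.
            (\<Prod>p\<in>m. 1 / (real p - 1)) * y (sprod C * sprod m)))\<^sup>2)\<bar>
     \<le> (Y * (1 + ln R) ^ (2 * k))\<^sup>2 * (\<Sum>C\<in>psets D (R * R). real (16 * k) ^ card C * (errA (2 * N + h) (W * sprod C) + errA (N + h) (W * sprod C)))"
proof -
  have Y: "0 \<le> Y" using y(1)[of 1] y(2)[of 1] R by simp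
  let ?L = "Y * (1 + ln R) ^ (2 * k)"
  let ?E = "\<lambda>C. errA (2 * N + h) (W * sprod C) + errA (N + h) (W * sprod C)"
  have L: "0 \<le> ?L" using Y R by simp
  have cnt: "\<bar>(\<Sum>n | n \<in> window N \<and> (\<forall>p\<in>C. has_root n p). lnp (n + h)) - real N / real (totient W) * (\<Prod>p\<in>C. (real k - 1) / (real p - 1))\<bar>
    \<le> real k ^ card C * ?E C" if C: "C \<in> psets D (R * R)" for C
  proof (rule sum_lnp_window[OF C _ h])
    fix p assume p: "p \<in> C"
    have "{p} \<in> psets D (R * R)" using psets_mono_set[OF C, of "{p}"] p by auto
    then have "real p \<le> R * R" by (auto simp: psets_def)
    then show "p \<le> N" using RN by linarith
  qed
  have "\<bar>(\<Sum>n\<in>window N. sw R y n * lnp (n + h)) - real N / real (totient W) * (\<Sum>A\<in>psets D R. \<Sum>B\<in>psets D R. lam R y A * lam R y B * (\<Prod>p\<in>A \<union> B. (real k - 1) / (real p - 1)))\<bar>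
     \<le> ?L\<^sup>2 * (\<Sum>C\<in>psets D (R * R). 16 ^ card C * (real k ^ card C * ?E C))"
    by (rule sum_sw_approx[OF lam_bound[OF R y] L cnt])
  also have "(\<Sum>C\<in>psets D (R * R). 16 ^ card C * (real k ^ card C * ?E C)) = (\<Sum>C\<in>psets D (R * R). real (16 * k) ^ card C * ?E C)"
    by (simp add: power_mult_distrib mult.assoc)
  finally show ?thesis unfolding lam_form_prime .
qed

lemma sieve_sum_liouville_bound:
  assumes R: "1 \<le> R" and y: "\<And>n. 1 \<le> n \<Longrightarrow> real n \<le> R \<Longrightarrow> 0 \<le> y n" "\<And>n. 1 \<le> n \<Longrightarrow> real n \<le> R \<Longrightarrow> y n \<le> Y"
    and h: "2 * N + h \<le> 3 * N"
  shows "\<bar>\<Sum>n\<in>window N. sw R y n * liouville (n + h)\<bar>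
     \<le> (Y * (1 + ln R) ^ (2 * k))\<^sup>2 * (\<Sum>C\<in>psets D (R * R). real (16 * k) ^ card C * (2 * errB (3 * N) (W * sprod C)))"
proof -
  have Y: "0 \<le> Y" using y(1)[of 1] y(2)[of 1] R by simp
  let ?L = "Y * (1 + ln R) ^ (2 * k)"
  let ?E = "\<lambda>C. 2 * errB (3 * N) (W * sprod C)"
  have L: "0 \<le> ?L" using Y R by simp
  \<comment> \<open>The products with 0 instantiate the main term of \<open>sum_sw_approx\<close> by
    zero.\<close>
  have cnt: "\<bar>(\<Sum>n | n \<in> window N \<and> (\<forall>p\<in>C. has_root n p). liouville (n + h)) - 0 * 0\<bar> \<le> real k ^ card C * ?E C"
    if C: "C \<in> psets D (R * R)" for C
    using sum_liouville_window[OF C h] by simp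
  have "\<bar>(\<Sum>n\<in>window N. sw R y n * liouville (n + h)) - 0 * (\<Sum>A\<in>psets D R. \<Sum>B\<in>psets D R. lam R y A * lam R y B * 0)\<bar>
     \<le> ?L\<^sup>2 * (\<Sum>C\<in>psets D (R * R). 16 ^ card C * (real k ^ card C * ?E C))"
    by (rule sum_sw_approx[OF lam_bound[OF R y] L cnt])
  also have "(\<Sum>C\<in>psets D (R * R). 16 ^ card C * (real k ^ card C * ?E C)) = (\<Sum>C\<in>psets D (R * R). real (16 * k) ^ card C * ?E C)"
    by (simp add: power_mult_distrib mult.assoc)
  finally show ?thesis by simp
qed

end

section \<open>Error terms\<close>

lemma one_le_ln:
  fixes x :: real
  assumes "3 \<le> x"
  shows "1 \<le> ln x"
  using assms exp_le by (subst ln_ge_iff) auto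

lemma condA_iff: "condA \<theta> \<longleftrightarrow> (\<forall>\<epsilon>>0. \<forall>A>0. \<exists>K. \<forall>N::nat. N \<ge> 2 \<longrightarrow>
    (\<Sum>q\<in>moduli N (\<theta> - \<epsilon>). errA N q) \<le> K * real N / ln (real N) powr A)"
  by (simp only: condA_def errA_def)

lemma condB_iff: "condB \<theta> \<longleftrightarrow> (\<forall>\<epsilon>>0. \<forall>A>0. \<exists>K. \<forall>N::nat. N \<ge> 2 \<longrightarrow>
    (\<Sum>q\<in>moduli N (\<theta> - \<epsilon>). errB N q) \<le> K * real N / ln (real N) powr A)"
  by (simp only: condB_def errB_def)

text \<open>The inequality \<open>u \<le> T + u\<^sup>2 / T\<close> takes the place of Cauchy--Schwarz in removing the divisor-type weights.\<close>

lemma weighted_sum_le: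
  fixes E :: "nat set \<Rightarrow> real"
  assumes x: "1 \<le> x" and T: "0 < T" and M: "0 \<le> M"
    and E: "\<And>C. C \<in> psets D x \<Longrightarrow> 0 \<le> E C" "\<And>C. C \<in> psets D x \<Longrightarrow> E C \<le> M * 2 ^ card C / real (sprod C)"
  shows "(\<Sum>C\<in>psets D x. real K ^ card C * E C) \<le> T * (\<Sum>C\<in>psets D x. E C) + M / T * (1 + ln x) ^ (2 * K\<^sup>2)"
proof -
  have "(\<Sum>C\<in>psets D x. real K ^ card C * E C)
     \<le> (\<Sum>C\<in>psets D x. T * E C + M / T * (real (2 * K\<^sup>2) ^ card C / real (sprod C)))"
  proof (intro sum_mono)
    fix C assume C: "C \<in> psets D x"
    let ?u = "real K ^ card C"
    have "?u \<le> T + ?u\<^sup>2 / T"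
    proof (cases "?u \<le> T")
      case True then show ?thesis using T by (simp add: add_increasing2)
    next
      case False
      then have "?u * T \<le> ?u * ?u" by (intro mult_left_mono) auto
      then have "?u \<le> ?u\<^sup>2 / T" using T by (simp add: field_simps power2_eq_square)
      then show ?thesis using T by simp
    qed
    then have "?u * E C \<le> (T + ?u\<^sup>2 / T) * E C" using E(1)[OF C] by (intro mult_right_mono)
    also have "\<dots> = T * E C + ?u\<^sup>2 / T * E C" by (simp add: distrib_right)
    also have "?u\<^sup>2 / T * E C \<le> ?u\<^sup>2 / T * (M * 2 ^ card C / real (sprod C))"
      using E(2)[OF C] T by (intro mult_left_mono) auto
    also have "\<dots> = M / T * (real (2 * K\<^sup>2) ^ card C / real (sprod C))"
    proof -
      have "real (2 * K\<^sup>2) ^ card C = 2 ^ card C * ?u\<^sup>2"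
        by (simp add: power_mult_distrib power2_eq_square)
      then show ?thesis by simp
    qed
    finally show "?u * E C \<le> T * E C + M / T * (real (2 * K\<^sup>2) ^ card C / real (sprod C))" by simp
  qed
  also have "\<dots> = T * (\<Sum>C\<in>psets D x. E C) + M / T * (\<Sum>C\<in>psets D x. real (2 * K\<^sup>2) ^ card C / real (sprod C))"
    by (simp only: sum.distrib sum_distrib_left)
  also have "\<dots> \<le> T * (\<Sum>C\<in>psets D x. E C) + M / T * (1 + ln x) ^ (2 * K\<^sup>2)"
    using M T by (intro add_left_mono mult_left_mono psets_power_sum_le x) auto
  finally show ?thesis .
qed

text \<open>The unweighted average saves any power of the logarithm, and the trivial bound controls
  the moduli with large weight. The room between e and t absorbs the fixed factor W. The claim is
  uniform in M because errors are needed at N + h, 2 * N + h and 3 * N.\<close>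

lemma weighted_error_small:
  fixes Er :: "nat \<Rightarrow> nat \<Rightarrow> real" and e t B :: real and W :: nat
  assumes level: "\<And>a::nat. 0 < a \<Longrightarrow> \<exists>K. \<forall>M\<ge>2. (\<Sum>q\<in>moduli M t. Er M q) \<le> K * real M / ln (real M) ^ a"
    and Er0: "\<And>M q. 1 \<le> q \<Longrightarrow> 0 \<le> Er M q"
    and triv: "\<And>M C x. 3 \<le> M \<Longrightarrow> C \<in> psets D x \<Longrightarrow> W * sprod C \<le> M \<Longrightarrow> Er M (W * sprod C) \<le> B * (real M * ln (real M)) * 2 ^ card C / real (sprod C)"
    and et: "e < t" "0 < e" "t \<le> 1" and W: "0 < W" and B: "0 \<le> B"
  shows "\<forall>\<^sub>F N in sequentially. \<forall>M. N \<le> M \<and> M \<le> 3 * N \<longrightarrow>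
     (\<Sum>C\<in>psets D (real N powr e). real K ^ card C * Er M (W * sprod C)) \<le> real N / ln (real N) ^ m"
proof -
  \<comment> \<open>P is the power of the logarithm in the divisor sum. With threshold
    \<open>ln N ^ b\<close> the trivial part costs P + 1 logarithms and gains b; a is larger than b
    by m + 1. Both parts thus save m + 1 logarithms, and one of these absorbs the constant
    c.\<close>
  define P where "P = 2 * K\<^sup>2"
  define b where "b = P + 2 + m"
  define a where "a = b + m + 1"
  obtain Ka where Ka: "\<And>M. M \<ge> 2 \<Longrightarrow> (\<Sum>q\<in>moduli M t. Er M q) \<le> Ka * real M / ln (real M) ^ a"
    using level[of a] by (auto simp: a_def)
  define c where "c = 3 * \<bar>Ka\<bar> + 6 * B * 2 ^ P"
  have ev1: "\<forall>\<^sub>F N in sequentially. real W * real N powr e \<le> real N powr t"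
    using et by real_asymp
  have ev2: "\<forall>\<^sub>F N in sequentially. max c 2 \<le> ln (real N)" by real_asymp
  have ev3: "\<forall>\<^sub>F N in sequentially. 3 \<le> N" by (rule eventually_ge_at_top)
  from ev1 ev2 ev3 show ?thesis
  proof eventually_elim
    case (elim N)
    let ?x = "real N powr e" and ?l = "ln (real N)"
    have l: "c \<le> ?l" "2 \<le> ?l" "0 < ?l" using elim by auto
    have x1: "1 \<le> ?x" using elim et by (simp add: ge_one_powr_ge_zero)
    show ?case
    proof (intro allI impI)
      fix M assume M: "N \<le> M \<and> M \<le> 3 * N"
      have M3: "3 \<le> M" using M elim by simp
      have lM: "?l \<le> ln (real M)" "ln (real M) \<le> 2 * ?l"
      proof -
        show "?l \<le> ln (real M)" using M elim by simp
        have "M \<le> N * N" using M elim mult_le_mono1[of 3 N N] by linarith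
        then have "real M \<le> real N * real N" by (simp flip: of_nat_mult)
        then have "ln (real M) \<le> ln (real N * real N)" using M3 elim by (subst ln_le_cancel_iff) auto
        then show "ln (real M) \<le> 2 * ?l" using elim by (simp add: ln_mult)
      qed
      have q: "W * sprod C \<in> moduli M t" "W * sprod C \<le> M" if C: "C \<in> psets D ?x" for C
      proof -
        have "real W * real (sprod C) \<le> real W * ?x" using psetsD(4)[OF C] by (intro mult_left_mono) auto
        also have "\<dots> \<le> real N powr t" using elim by simp
        also have "\<dots> \<le> real M powr t" using M et by (intro powr_mono2) auto
        finally have 1: "real (W * sprod C) \<le> real M powr t" by simp
        then show "W * sprod C \<in> moduli M t"
          using W psets_prod_pos[OF C] by (auto simp: moduli_def Suc_le_eq)
        have "real M powr t \<le> real M powr 1" using et M3 by (intro powr_mono) auto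
        then show "W * sprod C \<le> M" using 1 M3 by (simp flip: of_nat_mult of_nat_le_iff)
      qed
      have inj: "inj_on (\<lambda>C. W * sprod C) (psets D ?x)"
      proof (rule inj_onI)
        fix C C' assume C: "C \<in> psets D ?x" and C': "C' \<in> psets D ?x" and "W * sprod C = W * sprod C'"
        then have "sprod C = sprod C'" using W by simp
        then show "C = C'" using inj_onD[OF inj_on_sprod, of C C'] C C' by (auto dest: psetsD)
      qed
      have finm: "finite (moduli M t)" unfolding moduli_def by (rule finite_nat_le_real)
      have "(\<Sum>C\<in>psets D ?x. Er M (W * sprod C)) = (\<Sum>q\<in>(\<lambda>C. W * sprod C) ` psets D ?x. Er M q)"
        by (simp add: sum.reindex[OF inj])
      also have "\<dots> \<le> (\<Sum>q\<in>moduli M t. Er M q)"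
        using q finm Er0 by (intro sum_mono2) (auto simp: moduli_def)
      also have "\<dots> \<le> Ka * real M / ln (real M) ^ a" using Ka M3 by simp
      also have "\<dots> \<le> \<bar>Ka\<bar> * (3 * real N) / ?l ^ a"
        using M lM l by (intro frac_le mult_mono power_mono) auto
      finally have s1: "(\<Sum>C\<in>psets D ?x. Er M (W * sprod C)) \<le> 3 * \<bar>Ka\<bar> * real N / ?l ^ a" by (simp add: mult_ac)
      have "(\<Sum>C\<in>psets D ?x. real K ^ card C * Er M (W * sprod C))
         \<le> ?l ^ b * (\<Sum>C\<in>psets D ?x. Er M (W * sprod C)) + B * (real M * ln (real M)) / ?l ^ b * (1 + ln ?x) ^ (2 * K\<^sup>2)"
      proof (rule weighted_sum_le[OF x1])
        fix C assume C: "C \<in> psets D ?x"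
        show "0 \<le> Er M (W * sprod C)" using q(1)[OF C] by (intro Er0) (simp add: moduli_def)
        show "Er M (W * sprod C) \<le> B * (real M * ln (real M)) * 2 ^ card C / real (sprod C)"
          by (rule triv[OF M3 C q(2)[OF C]])
      qed (use l B M3 in auto)
      also have "\<dots> \<le> ?l ^ b * (3 * \<bar>Ka\<bar> * real N / ?l ^ a) + B * (3 * real N * (2 * ?l)) / ?l ^ b * (2 * ?l) ^ P"
      proof (intro add_mono mult_mono divide_right_mono mult_left_mono s1)
        have lnx: "ln ?x = e * ?l" using elim by (simp add: ln_powr)
        have "ln ?x \<le> ?l" unfolding lnx using et l by (simp add: mult_le_cancel_right1)
        then have "1 + ln ?x \<le> 2 * ?l" using l by linarith
        moreover have "0 \<le> ln ?x" unfolding lnx using et l by simp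
        ultimately show "(1 + ln ?x) ^ (2 * K\<^sup>2) \<le> (2 * ?l) ^ P" unfolding P_def by (intro power_mono) auto
        show "real M \<le> 3 * real N" using M by linarith
        show "0 \<le> (\<Sum>C\<in>psets D ?x. Er M (W * sprod C))"
        proof (rule sum_nonneg)
          fix C assume "C \<in> psets D ?x"
          then show "0 \<le> Er M (W * sprod C)" using q(1)[of C] by (intro Er0) (simp add: moduli_def)
        qed
      qed (use l lM B x1 M3 in auto)
      also have "?l ^ b * (3 * \<bar>Ka\<bar> * real N / ?l ^ a) = 3 * \<bar>Ka\<bar> * real N / ?l ^ (m + 1)"
        using l unfolding a_def by (simp add: power_add)
      also have "B * (3 * real N * (2 * ?l)) / ?l ^ b * (2 * ?l) ^ P = 6 * B * 2 ^ P * real N / ?l ^ (m + 1)"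
        using l unfolding b_def by (simp add: power_add power_mult_distrib)
      also have "3 * \<bar>Ka\<bar> * real N / ?l ^ (m + 1) + 6 * B * 2 ^ P * real N / ?l ^ (m + 1) = c * real N / ?l ^ (m + 1)"
        unfolding c_def by (simp add: add_divide_distrib[symmetric] distrib_right)
      also have "\<dots> \<le> ?l * real N / ?l ^ (m + 1)" using l by (intro divide_right_mono mult_right_mono) auto
      also have "\<dots> = real N / ?l ^ m" using l by simp
      finally show "(\<Sum>C\<in>psets D ?x. real K ^ card C * Er M (W * sprod C)) \<le> real N / ?l ^ m" .
    qed
  qed
qed

text \<open>A residue class modulo q holds at most M / q + 1 integers up to M, which is at most 2 *
  M / q. This crude bound feeds the second term of \<open>weighted_sum_le\<close>.\<close>

lemma errA_le:
  assumes q: "1 \<le> q" "q \<le> M" and M: "3 \<le> M"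
  shows "errA M q \<le> 2 * real M * ln (real M) / real q + real M / real (totient q)"
proof -
  have ne: "{a. a < q \<and> coprime a q} \<noteq> {}"
  proof -
    have "1 mod q \<in> {a. a < q \<and> coprime a q}" using q by (cases "q = 1") auto
    then show ?thesis by blast
  qed
  show ?thesis unfolding errA_def
  proof (subst Max_le_iff)
    show "\<forall>z\<in>(\<lambda>a. \<bar>(\<Sum>p | prime p \<and> p \<le> M \<and> [p = a] (mod q). ln (real p)) - real M / real (totient q)\<bar>) ` {a. a < q \<and> coprime a q}.
       z \<le> 2 * real M * ln (real M) / real q + real M / real (totient q)"
    proof (clarify)
      fix a assume a: "a < q" "coprime a q"
      let ?S = "{p. prime p \<and> p \<le> M \<and> [p = a] (mod q)}"
      have "?S \<subseteq> {n. 0 < n \<and> n \<le> M \<and> n mod q = a}" using a by (auto simp: cong_def prime_gt_0_nat)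
      then have "card ?S \<le> card {n. 0 < n \<and> n \<le> M \<and> n mod q = a}" by (intro card_mono) auto
      then have c: "real (card ?S) \<le> real M / real q + 1" using card_mod_interval[OF a(1), of 0 M] by simp
      also have "\<dots> \<le> 2 * real M / real q" using q by (simp add: field_simps)
      finally have c: "real (card ?S) \<le> 2 * real M / real q" .
      have "(\<Sum>p\<in>?S. ln (real p)) \<le> (\<Sum>p\<in>?S. ln (real M))"
      proof (rule sum_mono)
        fix p assume "p \<in> ?S"
        then have "0 < p" "p \<le> M" by (auto simp: prime_gt_0_nat)
        then show "ln (real p) \<le> ln (real M)" by simp
      qed
      also have "\<dots> = real (card ?S) * ln (real M)" by simp
      also have "\<dots> \<le> 2 * real M / real q * ln (real M)" using c M by (intro mult_right_mono) auto
      finally have 1: "(\<Sum>p\<in>?S. ln (real p)) \<le> 2 * real M * ln (real M) / real q" by simp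
      have 2: "0 \<le> (\<Sum>p\<in>?S. ln (real p))" using prime_gt_0_nat by (intro sum_nonneg) (auto simp: Suc_le_eq)
      have 3: "0 \<le> real M / real (totient q)" by simp
      show "\<bar>(\<Sum>p\<in>?S. ln (real p)) - real M / real (totient q)\<bar> \<le> 2 * real M * ln (real M) / real q + real M / real (totient q)"
        using 1 2 3 by linarith
    qed
  qed (use ne in auto)
qed

lemma errB_le:
  assumes q: "1 \<le> q" "q \<le> M"
  shows "errB M q \<le> 2 * real M / real q"
  unfolding errB_def
proof (subst Max_le_iff)
  show "\<forall>z\<in>(\<lambda>(y, a). \<bar>\<Sum>n | 1 \<le> n \<and> n \<le> y \<and> [n = a] (mod q). liouville n\<bar>) ` ({..M} \<times> {..<q}). z \<le> 2 * real M / real q"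
  proof (clarify)
    fix y a assume a: "y \<le> M" "a < q"
    let ?S = "{n. 1 \<le> n \<and> n \<le> y \<and> [n = a] (mod q)}"
    have "?S = {n. 0 < n \<and> n \<le> y \<and> n mod q = a}" using a by (auto simp: cong_def)
    then have c: "real (card ?S) \<le> real y / real q + 1" using card_mod_interval[OF a(2), of 0 y] by simp
    have "\<bar>\<Sum>n\<in>?S. liouville n\<bar> \<le> (\<Sum>n\<in>?S. \<bar>liouville n\<bar>)" by (rule sum_abs)
    also have "\<dots> = real (card ?S)" by (simp add: liouville_def power_abs)
    also have "\<dots> \<le> real M / real q + 1"
    proof -
      have "real y / real q \<le> real M / real q" using a by (intro divide_right_mono) auto
      then show ?thesis using c by linarith
    qed
    also have "\<dots> \<le> 2 * real M / real q" using q by (simp add: field_simps)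
    finally show "\<bar>\<Sum>n\<in>?S. liouville n\<bar> \<le> 2 * real M / real q" .
  qed
qed (use q in \<open>auto simp: lessThan_empty_iff\<close>)

context tuple_sieve
begin

lemma totient_W_ge1: "1 \<le> real (totient W)"
  using W_pos totient_gt_0_iff[of W] by (simp add: Suc_le_eq)

lemma errA_triv:
  assumes M: "3 \<le> M" and C: "C \<in> psets D x" and q: "W * sprod C \<le> M"
  shows "errA M (W * sprod C) \<le> 3 * (real M * ln (real M)) * 2 ^ card C / real (sprod C)"
proof -
  have s0: "0 < real (sprod C)" using psets_prod_pos[OF C] by simp
  have W1: "1 \<le> real W" using W_pos by simp
  have lnM: "1 \<le> ln (real M)"
    using M by (intro one_le_ln) simp
  have prodle: "real (sprod C) \<le> 2 ^ card C * (\<Prod>p\<in>C. real p - 1)"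
  proof -
    have "real (sprod C) = (\<Prod>p\<in>C. real p)" by (simp add: sprod_def)
    also have "\<dots> \<le> (\<Prod>p\<in>C. 2 * (real p - 1))"
    proof (intro prod_mono conjI)
      fix p assume "p \<in> C"
      then show "real p \<le> 2 * (real p - 1)" using psetsD(2)[OF C] prime_ge_2_nat[of p] by auto
    qed auto
    also have "\<dots> = 2 ^ card C * (\<Prod>p\<in>C. real p - 1)" by (simp only: prod.distrib prod_constant)
    finally show ?thesis .
  qed
  have pp: "0 < (\<Prod>p\<in>C. real p - 1)" using psets_prime_bounds(5)[OF C] by (intro prod_pos) auto
  have "errA M (W * sprod C) \<le> 2 * real M * ln (real M) / real (W * sprod C) + real M / real (totient (W * sprod C))"
    using W_pos psets_prod_pos[OF C] by (intro errA_le q M) (simp add: Suc_le_eq)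
  also have "2 * real M * ln (real M) / real (W * sprod C) \<le> 2 * real M * ln (real M) * 2 ^ card C / real (sprod C)"
  proof -
    have "2 * real M * ln (real M) / real (W * sprod C) \<le> 2 * real M * ln (real M) / real (sprod C)"
      using s0 W1 lnM by (intro divide_left_mono) auto
    also have "\<dots> \<le> 2 * real M * ln (real M) * 2 ^ card C / real (sprod C)"
    proof -
      have "2 * real M * ln (real M) * 1 \<le> 2 * real M * ln (real M) * 2 ^ card C"
        using lnM by (intro mult_left_mono) auto
      then show ?thesis using s0 by (intro divide_right_mono) auto
    qed
    finally show ?thesis .
  qed
  also have "real M / real (totient (W * sprod C)) \<le> real M * ln (real M) * 2 ^ card C / real (sprod C)"
  proof -
    have "real M / real (totient (W * sprod C)) \<le> real M / (\<Prod>p\<in>C. real p - 1)"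
      unfolding totient_W_sprod[OF C] using totient_W_ge1 pp W_pos
      by (intro divide_left_mono mult_pos_pos) (auto simp: mult_le_cancel_right1)
    also have "\<dots> \<le> real M * 2 ^ card C / real (sprod C)"
      using prodle pp s0 mult_left_mono[OF prodle, of "real M"] by (simp add: field_simps)
    also have "\<dots> \<le> real M * ln (real M) * 2 ^ card C / real (sprod C)"
      using s0 lnM by (intro divide_right_mono mult_right_mono) (auto simp: mult_le_cancel_left1)
    finally show ?thesis .
  qed
  finally show ?thesis by (simp add: add_divide_distrib[symmetric] distrib_right)
qed

lemma errB_triv:
  assumes M: "3 \<le> M" and C: "C \<in> psets D x" and q: "W * sprod C \<le> M"
  shows "errB M (W * sprod C) \<le> 2 * (real M * ln (real M)) * 2 ^ card C / real (sprod C)"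
proof -
  have s0: "0 < real (sprod C)" using psets_prod_pos[OF C] by simp
  have W1: "1 \<le> real W" using W_pos by simp
  have lnM: "1 \<le> ln (real M)"
    using M by (intro one_le_ln) simp
  have "errB M (W * sprod C) \<le> 2 * real M / real (W * sprod C)"
    using W_pos psets_prod_pos[OF C] by (intro errB_le q) (simp add: Suc_le_eq)
  also have "\<dots> \<le> 2 * real M / real (sprod C)"
    using s0 W1 by (intro divide_left_mono) auto
  also have "\<dots> \<le> 2 * (real M * ln (real M)) * 2 ^ card C / real (sprod C)"
  proof (intro divide_right_mono)
    have "real M * 1 \<le> real M * (ln (real M) * 2 ^ card C)"
      using lnM mult_mono[OF lnM, of 1 "2 ^ card C"] by (intro mult_left_mono) auto
    then show "2 * real M \<le> 2 * (real M * ln (real M)) * 2 ^ card C" by (simp add: mult_ac)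
  qed (use s0 in auto)
  finally show ?thesis .
qed

lemma errA_small:
  assumes A: "condA \<theta>" and e: "0 < e" "e < \<theta>" "e < 1"
  shows "\<forall>\<^sub>F N in sequentially. \<forall>M. N \<le> M \<and> M \<le> 3 * N \<longrightarrow>
     (\<Sum>C\<in>psets D (real N powr e). real K ^ card C * errA M (W * sprod C)) \<le> real N / ln (real N) ^ m"
proof -
  \<comment> \<open>The midpoint leaves room on both sides: \<theta> - t plays the role of
    \<epsilon> in condition (A), and t - e absorbs W.\<close>
  define t where "t = (e + min \<theta> 1) / 2"
  have t: "e < t" "t < \<theta>" "t \<le> 1" using e by (auto simp: t_def min_def)
  show ?thesis
  proof (rule weighted_error_small[where t = t and B = 3])
    fix a :: nat assume a: "0 < a"
    have pos: "0 < \<theta> - t" "0 < real a" using t a by auto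
    have "\<exists>K. \<forall>N\<ge>2. (\<Sum>q\<in>moduli N (\<theta> - (\<theta> - t)). errA N q) \<le> K * real N / ln (real N) powr real a"
      using A[unfolded condA_iff] pos by blast
    then show "\<exists>K. \<forall>M\<ge>2. (\<Sum>q\<in>moduli M t. errA M q) \<le> K * real M / ln (real M) ^ a"
      by (simp add: powr_realpow)
  next
    fix M q :: nat assume "1 \<le> q"
    then show "0 \<le> errA M q" using order_trans[OF abs_ge_zero errA_ge[OF _ coprime_1_left]] by simp
  next
    fix M C x assume "3 \<le> M" "C \<in> psets D x" "W * sprod C \<le> M"
    then show "errA M (W * sprod C) \<le> 3 * (real M * ln (real M)) * 2 ^ card C / real (sprod C)" by (rule errA_triv)
  qed (use t e W_pos in auto)
qed

lemma errB_small:
  assumes A: "condB \<theta>" and e: "0 < e" "e < \<theta>" "e < 1"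
  shows "\<forall>\<^sub>F N in sequentially. \<forall>M. N \<le> M \<and> M \<le> 3 * N \<longrightarrow>
     (\<Sum>C\<in>psets D (real N powr e). real K ^ card C * errB M (W * sprod C)) \<le> real N / ln (real N) ^ m"
proof -
  define t where "t = (e + min \<theta> 1) / 2"
  have t: "e < t" "t < \<theta>" "t \<le> 1" using e by (auto simp: t_def min_def)
  show ?thesis
  proof (rule weighted_error_small[where t = t and B = 2])
    fix a :: nat assume a: "0 < a"
    have pos: "0 < \<theta> - t" "0 < real a" using t a by auto
    have "\<exists>K. \<forall>N\<ge>2. (\<Sum>q\<in>moduli N (\<theta> - (\<theta> - t)). errB N q) \<le> K * real N / ln (real N) powr real a"
      using A[unfolded condB_iff] pos by blast
    then show "\<exists>K. \<forall>M\<ge>2. (\<Sum>q\<in>moduli M t. errB M q) \<le> K * real M / ln (real M) ^ a"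
      by (simp add: powr_realpow)
  next
    fix M q :: nat assume "1 \<le> q"
    then show "0 \<le> errB M q" using order_trans[OF abs_ge_zero errB_ge[of 0 M q 0]] by simp
  next
    fix M C x assume "3 \<le> M" "C \<in> psets D x" "W * sprod C \<le> M"
    then show "errB M (W * sprod C) \<le> 2 * (real M * ln (real M)) * 2 ^ card C / real (sprod C)" by (rule errB_triv)
  qed (use t e W_pos in auto)
qed

end

text \<open>With \<epsilon> = \<theta> the range of moduli shrinks to q = 1, so condition (A) itself
  supplies the prime number theorem, here with the two logarithms that
  \<open>mertens_bounded\<close> uses.\<close>

lemma PNT_of_condA:
  assumes A: "condA \<theta>" and t: "0 < \<theta>"
  obtains K where "\<And>N::nat. 2 \<le> N \<Longrightarrow> \<bar>(\<Sum>p | prime p \<and> p \<le> N. ln (real p)) - real N\<bar> \<le> K * real N / (ln (real N))\<^sup>2"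
proof -
  have "\<exists>K. \<forall>N\<ge>2. (\<Sum>q\<in>moduli N (\<theta> - \<theta>). errA N q) \<le> K * real N / ln (real N) powr 2"
    using A[unfolded condA_iff] t zero_less_numeral by blast
  then obtain K where K: "\<And>N. N \<ge> 2 \<Longrightarrow> (\<Sum>q\<in>moduli N 0. errA N q) \<le> K * real N / ln (real N) powr 2" by auto
  show ?thesis
  proof (rule that[of K])
    fix N :: nat assume N: "2 \<le> N"
    have m: "moduli N 0 = {1}" using N by (auto simp: moduli_def)
    have "\<bar>(\<Sum>p | prime p \<and> p \<le> N \<and> [p = 0] (mod 1). ln (real p)) - real N / real (totient 1)\<bar> \<le> errA N 1"
      by (rule errA_ge) auto
    also have "\<dots> \<le> K * real N / ln (real N) powr 2" using K[OF N] by (simp add: m)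
    also have "ln (real N) powr 2 = (ln (real N))\<^sup>2" using N by simp
    finally show "\<bar>(\<Sum>p | prime p \<and> p \<le> N. ln (real p)) - real N\<bar> \<le> K * real N / (ln (real N))\<^sup>2" by simp
  qed
qed

section \<open>Main terms\<close>

lemma harmonic_segment_le:
  assumes "1 \<le> a" "a \<le> (m::nat)"
  shows "(\<Sum>n=a..m. 1 / real n) \<le> 1 / real a + ln (real m / real a)"
  using assms(2)
proof (induction m rule: dec_induct)
  case (step m)
  have m: "0 < real m" "0 < real a" using step assms by auto
  have "ln (real m / real (Suc m)) \<le> real m / real (Suc m) - 1" using m by (intro ln_le_minus_one) auto
  also have "\<dots> = - (1 / real (Suc m))" by (simp add: field_simps)
  finally have "1 / real (Suc m) \<le> ln (real (Suc m)) - ln (real m)" using m by (simp add: ln_div)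
  then show ?case using step m by (simp add: ln_div)
qed (use assms in simp)

text \<open>The integers lie between z / q and z, an interval of fixed logarithmic length
  \<open>ln q\<close>; the bound is therefore free of z.\<close>

lemma harmonic_tail_le:
  assumes z: "1 \<le> z" and q: "1 \<le> q"
  shows "(\<Sum>n | (1 \<le> n \<and> z < q * real n) \<and> real n \<le> z. 1 / real n) \<le> 1 + ln q"
proof -
  define m where "m = nat \<lfloor>z\<rfloor>"
  define a where "a = nat \<lfloor>z / q\<rfloor> + 1"
  have m: "real m \<le> z" unfolding m_def using z by auto
  have zq: "0 \<le> z / q" using z q by auto
  have a: "z / q < real a" unfolding a_def using zq by linarith
  have sub: "{n. (1 \<le> n \<and> z < q * real n) \<and> real n \<le> z} \<subseteq> {a..m}"
  proof
    fix n assume n: "n \<in> {n. (1 \<le> n \<and> z < q * real n) \<and> real n \<le> z}"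
    then have "z / q < real n" using q by (simp add: divide_less_eq mult.commute)
    then have "\<lfloor>z / q\<rfloor> < int n" by (simp add: floor_less_iff)
    then have "a \<le> n" unfolding a_def using zq by linarith
    moreover have "n \<le> m" unfolding m_def using n by (simp add: le_nat_floor)
    ultimately show "n \<in> {a..m}" by simp
  qed
  have "(\<Sum>n | (1 \<le> n \<and> z < q * real n) \<and> real n \<le> z. 1 / real n) \<le> (\<Sum>n=a..m. 1 / real n)"
    using sub by (intro sum_mono2) auto
  also have "\<dots> \<le> 1 + ln q"
  proof (cases "a \<le> m")
    case True
    have a1: "1 \<le> a" unfolding a_def by simp
    have "(\<Sum>n=a..m. 1 / real n) \<le> 1 / real a + ln (real m / real a)" by (rule harmonic_segment_le[OF a1 True])
    also have "1 / real a \<le> 1" using a1 by simp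
    also have "ln (real m / real a) \<le> ln q"
    proof -
      have "real m \<le> q * real a" using m a q by (simp add: divide_less_eq mult.commute)
      then have "real m / real a \<le> q" using a1 by (simp add: divide_le_eq)
      then show ?thesis using True a1 q by (subst ln_le_cancel_iff) auto
    qed
    finally show ?thesis by simp
  next
    case False then show ?thesis using q by simp
  qed
  finally show ?thesis .
qed

context tuple_sieve
begin

text \<open>A linear polynomial in the logarithm, with value 1 + b at 1 and value 1 at R. As it does
  not vanish at R, the cutoff there produces a boundary term whenever a prime q is inserted.\<close>

definition ywt :: "real \<Rightarrow> real \<Rightarrow> nat \<Rightarrow> real" where
  "ywt b R n = 1 + b * (ln (R / real n) / ln R)"

lemma ywt_bounds:
  assumes "1 < R" "0 \<le> b" "1 \<le> n" "real n \<le> R"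
  shows "0 \<le> ywt b R n" "ywt b R n \<le> 1 + b"
proof -
  have l: "0 < ln R" using assms by simp
  have q: "1 \<le> R / real n" "R / real n \<le> R" using assms by (auto simp: field_simps)
  then have 0: "0 \<le> ln (R / real n)" "ln (R / real n) \<le> ln R" using assms by auto
  then have "0 \<le> ln (R / real n) / ln R" "ln (R / real n) / ln R \<le> 1" using l by auto
  then have "0 \<le> b * (ln (R / real n) / ln R)" "b * (ln (R / real n) / ln R) \<le> b * 1"
    using assms by (intro mult_nonneg_nonneg mult_left_mono; simp)+
  then show "0 \<le> ywt b R n" "ywt b R n \<le> 1 + b" unfolding ywt_def by linarith+
qed

text \<open>Euler product \<open>\<Prod>p\<le>D. 1 - 1 / p\<close>.\<close>

definition Phi :: real where "Phi = real (totient W) / real W"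

lemma Phi_pos: "0 < Phi"
  unfolding Phi_def using W_pos totient_W_ge1 by simp

abbreviation mo1 :: "nat \<Rightarrow> real \<Rightarrow> real" where "mo1 \<equiv> moment D k (real k - 1)"
abbreviation mo :: "nat \<Rightarrow> real \<Rightarrow> real" where "mo \<equiv> moment D k (real k)"

lemma main_sum_eq:
  assumes "1 < R"
  shows "(\<Sum>C\<in>psets D R. wt C * (ywt b R (sprod C))\<^sup>2) = mo 0 R + 2 * b * (mo 1 R / ln R) + b\<^sup>2 * (mo 2 R / (ln R)\<^sup>2)"
proof -
  have l: "ln R \<noteq> 0" using assms by simp
  have "(\<Sum>C\<in>psets D R. wt C * (ywt b R (sprod C))\<^sup>2)
     = (\<Sum>C\<in>psets D R. wt C + 2 * b / ln R * (wt C * ln (R / sprod C)) + b\<^sup>2 / (ln R)\<^sup>2 * (wt C * ln (R / sprod C) ^ 2))"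
    by (intro sum.cong refl) (simp add: ywt_def power2_eq_square algebra_simps)
  then show ?thesis unfolding moment_def wt_def by (simp only: sum.distrib sum_distrib_left[symmetric]) simp
qed

lemma psets_coprime_W:
  assumes C: "C \<in> psets D x"
  shows "coprime (sprod C) W"
  unfolding sprod_def
proof (rule prod_coprime_left)
  fix p assume p: "p \<in> C"
  have "\<not> p dvd W" using psetsD[OF C] p by (intro not_dvd_W) auto
  then show "coprime p W" using psetsD(2)[OF C p] by (rule prime_imp_coprime[rotated])
qed

text \<open>\<open>k = (k - 1) + 1\<close> in the numerators lowers the dimension: the outer sum has
  dimension k - 1 and the inner one, with weights 1 / (p - k), is one-dimensional and left to the
  bound U.\<close>

lemma weight_split_moment:
  fixes F :: "nat \<Rightarrow> real"
  assumes F: "\<And>n. 0 \<le> F n"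
    and U: "\<And>A. A \<in> psets D R \<Longrightarrow> 0 \<le> U (R / sprod A) \<and>
      (\<Sum>B\<in>psets D (R / sprod A). (\<Prod>p\<in>B. 1 / (real p - real k)) * F (sprod A * sprod B)) \<le> U (R / sprod A)"
  shows "(\<Sum>C\<in>psets D R. wt C * F (sprod C)) \<le> (\<Sum>A\<in>psets D R. (\<Prod>p\<in>A. (real k - 1) / (real p - real k)) * U (R / sprod A))"
proof -
  have s: "real k / (real p - real k) = (real k - 1) / (real p - real k) + 1 / (real p - real k)" for p :: nat
    by (simp add: add_divide_distrib[symmetric])
  have "(\<Sum>C\<in>psets D R. wt C * F (sprod C)) = (\<Sum>C\<in>psets D R. (\<Prod>p\<in>C. (real k - 1) / (real p - real k) + 1 / (real p - real k)) * F (sprod C))"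
    unfolding wt_def s ..
  also have "\<dots> \<le> (\<Sum>A\<in>psets D R. (\<Prod>p\<in>A. (real k - 1) / (real p - real k)) *
      (\<Sum>B\<in>psets D (R / sprod A). (\<Prod>p\<in>B. 1 / (real p - real k)) * F (sprod A * sprod B)))"
    using F D2 k2 by (intro psets_convolution_le) auto
  also have "\<dots> \<le> (\<Sum>A\<in>psets D R. (\<Prod>p\<in>A. (real k - 1) / (real p - real k)) * U (R / sprod A))"
    using U D2 k2 by (intro sum_mono mult_left_mono psets_weight_nonneg[of _ D R]) auto
  finally show ?thesis .
qed

text \<open>The comparison of the two dimensions. Up to the factor \<open>exp (2 * k / D)\<close>
  the inner sum runs over integers coprime to W, giving \<open>Phi * ln x\<close> and so the first
  moment in dimension k - 1.\<close>

lemma moment_zero_convolution_le: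
  assumes R: "1 \<le> R"
  shows "mo 0 R \<le> exp (2 * real k / real D) * (Phi * mo1 1 R + (1 + 2 * real W) * mo1 0 R)"
proof -
  define U where "U x = exp (2 * real k / real D) * (Phi * ln x + (1 + 2 * real W))" for x
  have U0: "0 \<le> U x" if "1 \<le> x" for x unfolding U_def using that Phi_pos by auto
  have inner: "(\<Sum>B\<in>psets D x. (\<Prod>p\<in>B. 1 / (real p - real k)) * 1) \<le> U x" if x: "1 \<le> x" for x
    unfolding U_def
  proof (rule psets_weight_split[OF D2 D_pos])
    fix A assume A: "A \<in> psets D x"
    have x1: "1 \<le> x / sprod A" by (rule psets_quotient_ge1[OF A])
    have x2: "x / sprod A \<le> x" using psets_prod_ge1[OF A] x by (simp add: divide_le_eq mult_le_cancel_left1)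
    have "(\<Sum>B\<in>psets D (x / sprod A). 1 / real (sprod B)) \<le> (\<Sum>n | (1 \<le> n \<and> coprime n W) \<and> real n \<le> x / sprod A. 1 / real n)"
      by (rule psets_sum_le_integers[where D = D and x = "x / sprod A"])
         (use psets_coprime_W psets_prod_pos in \<open>auto dest: psetsD simp: Suc_le_eq\<close>)
    also have "\<dots> \<le> Phi * ln (x / sprod A) + (1 + 2 * real W)"
      unfolding Phi_def by (rule coprime_harmonic_le[OF W_pos x1])
    also have "\<dots> \<le> Phi * ln x + (1 + 2 * real W)"
      using x1 x2 Phi_pos by (intro add_right_mono mult_left_mono) auto
    finally show "(\<Sum>B\<in>psets D (x / sprod A). 1 / real (sprod B) * 1) \<le> Phi * ln x + (1 + 2 * real W)" by simp
  next
    show "0 \<le> Phi * ln x + (1 + 2 * real W)" using x Phi_pos by auto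
  qed auto
  have "mo 0 R = (\<Sum>C\<in>psets D R. wt C * 1)" unfolding moment_def wt_def by simp
  also have "\<dots> \<le> (\<Sum>A\<in>psets D R. (\<Prod>p\<in>A. (real k - 1) / (real p - real k)) * U (R / sprod A))"
    by (rule weight_split_moment) (use U0 inner R psets_quotient_ge1 in auto)
  also have "\<dots> = exp (2 * real k / real D) * (Phi * mo1 1 R + (1 + 2 * real W) * mo1 0 R)"
    unfolding U_def moment_def by (simp add: sum.distrib sum_distrib_left algebra_simps)
  finally show ?thesis .
qed

text \<open>The same splitting for the moduli between R / q and R. The inner sum now runs over an
  interval of logarithmic length \<open>ln q\<close>, so that \<open>ln q\<close> stands where the
  bound for \<open>mo 0\<close> has the much larger \<open>ln R\<close>.\<close>

lemma wt_tail_le: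
  assumes R: "1 \<le> R" and q: "1 \<le> real q"
  shows "(\<Sum>C | C \<in> psets D R \<and> R < real q * real (sprod C). wt C) \<le> exp (2 * real k / real D) * (1 + ln (real q)) * mo1 0 R"
proof -
  define F :: "nat \<Rightarrow> real" where "F n = (if R < real q * real n then 1 else 0)" for n
  define U where "U x = exp (2 * real k / real D) * (1 + ln (real q))" for x :: real
  have U0: "0 \<le> U x" for x unfolding U_def using q by auto
  have inner: "(\<Sum>B\<in>psets D (R / sprod A). (\<Prod>p\<in>B. 1 / (real p - real k)) * F (sprod A * sprod B)) \<le> U (R / sprod A)"
    if A: "A \<in> psets D R" for A
    unfolding U_def
  proof (rule psets_weight_split[OF D2 D_pos, where F = "\<lambda>n. F (sprod A * n)"])
    fix A' assume A': "A' \<in> psets D (R / sprod A)"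
    define z where "z = R / sprod A / sprod A'"
    have z1: "1 \<le> z" unfolding z_def by (rule psets_quotient_ge1[OF A'])
    have Fz: "F (sprod A * (sprod A' * n)) = (if z < real q * real n then 1 else 0)" for n
      unfolding F_def z_def using psets_prod_ge1[OF A] psets_prod_ge1[OF A'] by (simp add: field_simps)
    have "(\<Sum>B\<in>psets D z. 1 / real (sprod B) * F (sprod A * (sprod A' * sprod B)))
       = (\<Sum>B\<in>psets D z. if z < real q * real (sprod B) then 1 / real (sprod B) else 0)"
      unfolding Fz by (intro sum.cong) auto
    also have "\<dots> = (\<Sum>B | B \<in> psets D z \<and> z < real q * real (sprod B). 1 / real (sprod B))"
      by (rule sum.inter_filter[symmetric]) simp
    also have "\<dots> \<le> (\<Sum>n | (1 \<le> n \<and> z < real q * real n) \<and> real n \<le> z. 1 / real n)"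
      by (rule psets_sum_le_integers[where D = D and x = z])
         (use psets_prod_pos in \<open>auto dest: psetsD simp: Suc_le_eq\<close>)
    also have "\<dots> \<le> 1 + ln (real q)" by (rule harmonic_tail_le[OF z1 q])
    finally show "(\<Sum>B\<in>psets D (R / sprod A / sprod A'). 1 / real (sprod B) * F (sprod A * (sprod A' * sprod B))) \<le> 1 + ln (real q)"
      unfolding z_def .
  qed (use q in \<open>auto simp: F_def\<close>)
  have "(\<Sum>C | C \<in> psets D R \<and> R < real q * real (sprod C). wt C) = (\<Sum>C\<in>psets D R. if R < real q * real (sprod C) then wt C else 0)"
    by (rule sum.inter_filter) simp
  also have "\<dots> = (\<Sum>C\<in>psets D R. wt C * F (sprod C))" unfolding F_def by (intro sum.cong) auto
  also have "\<dots> \<le> (\<Sum>A\<in>psets D R. (\<Prod>p\<in>A. (real k - 1) / (real p - real k)) * U (R / sprod A))"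
    by (rule weight_split_moment) (use U0 inner in \<open>auto simp: F_def\<close>)
  also have "\<dots> = exp (2 * real k / real D) * (1 + ln (real q)) * mo1 0 R"
    unfolding U_def moment_def by (simp add: sum_distrib_left sum_distrib_right mult_ac)
  finally show ?thesis .
qed

text \<open>The Euler product over the primes up to D and those of C is 1 / \<open>Phi\<close> times
  the product of \<open>p / (p - 1)\<close> over C. The latter is exactly the prefactor in the
  diagonal form, so the dependence on C disappears apart from the length
  \<open>R / sprod C\<close>.\<close>

lemma prime_inner_lower:
  assumes R: "1 < R" and b: "0 \<le> b" and C: "C \<in> psets D R"
  shows "Phi * (ln (R / sprod C) + b / (2 * ln R) * (ln (R / sprod C))\<^sup>2)
    \<le> (\<Prod>p\<in>C. real p / (real p - 1)) * (\<Sum>m | m \<in> psets D (R / sprod C) \<and> m \<inter> C = {}.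
            (\<Prod>p\<in>m. 1 / (real p - 1)) * ywt b R (sprod C * sprod m))"
proof -
  define x where "x = R / sprod C"
  have x1: "1 \<le> x" unfolding x_def by (rule psets_quotient_ge1[OF C])
  have l: "0 < ln R" using R by simp
  define F where "F n = ywt b R (sprod C * n)" for n
  have F: "F n = 1 + b / ln R * ln (x / real n)" for n
    unfolding F_def ywt_def x_def by simp
  let ?G = "{p. prime p \<and> p \<le> D} \<union> C"
  let ?Y = "\<Sum>m | m \<in> psets D x \<and> m \<inter> C = {}. (\<Prod>p\<in>m. 1 / (real p - 1)) * F (sprod m)"
  have ln0: "0 \<le> ln (x / real n)" if "1 \<le> n" "real n \<le> x" for n :: nat
    using that by (simp add: field_simps)
  have up: "(\<Sum>n | 1 \<le> n \<and> real n \<le> x. F n / real n) \<le> (\<Prod>p\<in>?G. real p / (real p - 1)) * ?Y"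
  proof (rule antimono_harmonic_le_psets)
    fix n :: nat assume n: "1 \<le> n" "real n \<le> x"
    show "0 \<le> F n" unfolding F using ln0[OF n] b l by (intro add_nonneg_nonneg mult_nonneg_nonneg) auto
  next
    fix m n :: nat assume mn: "1 \<le> m" "m \<le> n" "real n \<le> x"
    have "x / real n \<le> x / real m" using mn x1 by (intro divide_left_mono) auto
    then have "ln (x / real n) \<le> ln (x / real m)" using mn x1 by (subst ln_le_cancel_iff) auto
    then show "F n \<le> F m" unfolding F using b l by (intro add_left_mono mult_left_mono) auto
  qed (use C in \<open>auto dest: psetsD\<close>)
  have "ln x + b / (2 * ln R) * (ln x)\<^sup>2 \<le> (\<Sum>n | 1 \<le> n \<and> real n \<le> x. F n / real n)"
  proof -
    have "(\<Sum>n | 1 \<le> n \<and> real n \<le> x. F n / real n)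
       = (\<Sum>n | 1 \<le> n \<and> real n \<le> x. ln (x / real n) ^ 0 / real n) + b / ln R * (\<Sum>n | 1 \<le> n \<and> real n \<le> x. ln (x / real n) ^ 1 / real n)"
      unfolding F sum_distrib_left sum.distrib[symmetric] by (intro sum.cong refl) (simp add: add_divide_distrib)
    also have "\<dots> \<ge> ln x ^ (0 + 1) / real (0 + 1) + b / ln R * (ln x ^ (1 + 1) / real (1 + 1))"
      using b l by (intro add_mono mult_left_mono log_power_sum_bounds(1)[OF x1]) auto
    finally show ?thesis by (simp add: power2_eq_square)
  qed
  also note up
  also have "(\<Prod>p\<in>?G. real p / (real p - 1)) = 1 / Phi * (\<Prod>p\<in>C. real p / (real p - 1))"
  proof -
    have "(\<Prod>p\<in>?G. real p / (real p - 1)) = (\<Prod>p\<in>{p. prime p \<and> p \<le> D}. real p / (real p - 1)) * (\<Prod>p\<in>C. real p / (real p - 1))"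
      using psetsD(1)[OF C] by (intro prod.union_disjoint) (auto dest!: psetsD(3)[OF C])
    also have "(\<Prod>p\<in>{p. prime p \<and> p \<le> D}. real p / (real p - 1)) = real W / real (totient W)"
      unfolding W_def by (subst totient_sprod) (auto simp: prod_dividef sprod_def)
    finally show ?thesis unfolding Phi_def by simp
  qed
  finally have fin: "ln x + b / (2 * ln R) * (ln x)\<^sup>2 \<le> 1 / Phi * (\<Prod>p\<in>C. real p / (real p - 1)) * ?Y" .
  have "Phi * (ln x + b / (2 * ln R) * (ln x)\<^sup>2) \<le> Phi * (1 / Phi * (\<Prod>p\<in>C. real p / (real p - 1)) * ?Y)"
    using fin Phi_pos by (intro mult_left_mono) auto
  also have "\<dots> = (\<Prod>p\<in>C. real p / (real p - 1)) * ?Y" using Phi_pos by simp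
  finally show ?thesis unfolding x_def F_def .
qed

text \<open>Squaring \<open>t + b / (2 * ln R) * t\<^sup>2\<close> with
  \<open>t = ln (R / sprod C)\<close> yields the second, third and fourth moments in dimension k -
  1.\<close>

lemma prime_main_lower:
  assumes R: "1 < R" and b: "0 \<le> b"
  shows "Phi\<^sup>2 * (mo1 2 R + b * (mo1 3 R / ln R) + b\<^sup>2 / 4 * (mo1 4 R / (ln R)\<^sup>2))
    \<le> (\<Sum>C\<in>psets D R. (\<Prod>p\<in>C. (real k - 1) / (real p - real k)) *
        ((\<Prod>p\<in>C. real p / (real p - 1)) * (\<Sum>m | m \<in> psets D (R / sprod C) \<and> m \<inter> C = {}.
            (\<Prod>p\<in>m. 1 / (real p - 1)) * ywt b R (sprod C * sprod m)))\<^sup>2)"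
proof -
  have l: "0 < ln R" using R by simp
  let ?u = "\<lambda>C. \<Prod>p\<in>C. (real k - 1) / (real p - real k)"
  have "Phi\<^sup>2 * (mo1 2 R + b * (mo1 3 R / ln R) + b\<^sup>2 / 4 * (mo1 4 R / (ln R)\<^sup>2))
     = (\<Sum>C\<in>psets D R. ?u C * (Phi * (ln (R / sprod C) + b / (2 * ln R) * (ln (R / sprod C))\<^sup>2))\<^sup>2)"
  proof -
    have "?u C * (Phi * (t + b / (2 * ln R) * t\<^sup>2))\<^sup>2
       = Phi\<^sup>2 * (?u C * t ^ 2) + Phi\<^sup>2 * (b / ln R) * (?u C * t ^ 3) + Phi\<^sup>2 * (b\<^sup>2 / 4 / (ln R)\<^sup>2) * (?u C * t ^ 4)" for C t
      using l by (simp add: power2_eq_square power3_eq_cube power4_eq_xxxx field_simps)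
    then show ?thesis unfolding moment_def by (simp only: sum.distrib sum_distrib_left[symmetric]) (simp add: algebra_simps)
  qed
  also have "\<dots> \<le> (\<Sum>C\<in>psets D R. ?u C *
        ((\<Prod>p\<in>C. real p / (real p - 1)) * (\<Sum>m | m \<in> psets D (R / sprod C) \<and> m \<inter> C = {}.
            (\<Prod>p\<in>m. 1 / (real p - 1)) * ywt b R (sprod C * sprod m)))\<^sup>2)"
  proof (intro sum_mono mult_left_mono power_mono prime_inner_lower R b)
    fix C assume C: "C \<in> psets D R"
    show "0 \<le> ?u C" using D2 k2 by (intro psets_weight_nonneg[OF C]) auto
    show "0 \<le> Phi * (ln (R / sprod C) + b / (2 * ln R) * (ln (R / sprod C))\<^sup>2)"
      using Phi_pos psets_quotient_ge1[OF C] b l by (intro mult_nonneg_nonneg add_nonneg_nonneg) auto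
  qed
  finally show ?thesis .
qed

text \<open>If q times \<open>sprod C\<close> stays below R, the difference of the two values is
  exactly \<open>b * ln q / ln R\<close>; otherwise the second value is missing, but then C lies in
  the tail. Both cases carry a factor \<open>ln q\<close>, so after division by q the sum over q up
  to \<open>N powr c\<close> is of order \<open>c * ln N\<close>, small with c.\<close>

lemma root_main_upper:
  assumes R: "1 < R" and b: "0 \<le> b" and q: "prime q" "D < q" "real q \<le> R"
  shows "(\<Sum>C | C \<in> psets D R \<and> q \<notin> C. wt C * (ywt b R (sprod C) - (if insert q C \<in> psets D R then ywt b R (q * sprod C) else 0))\<^sup>2)
    \<le> ln (real q) * (b\<^sup>2 * (mo 0 R / ln R) + 2 * (1 + b)\<^sup>2 * exp (2 * real k / real D) * mo1 0 R)"
proof -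
  have l: "0 < ln R" using R by simp
  have q4: "4 < q" using q D2 k2 by simp
  then have lq: "0 < ln (real q)" by simp
  have lq1: "1 \<le> ln (real q)"
    using q4 by (intro one_le_ln) simp
  let ?d = "\<lambda>C. ywt b R (sprod C) - (if insert q C \<in> psets D R then ywt b R (q * sprod C) else 0)"
  have "(\<Sum>C | C \<in> psets D R \<and> q \<notin> C. wt C * (?d C)\<^sup>2)
     \<le> (\<Sum>C | C \<in> psets D R \<and> q \<notin> C. wt C * (b\<^sup>2 * (ln (real q) / ln R)\<^sup>2) + (if R < real q * real (sprod C) then wt C * (1 + b)\<^sup>2 else 0))"
  proof (rule sum_mono)
    fix C assume "C \<in> {C. C \<in> psets D R \<and> q \<notin> C}"
    then have C: "C \<in> psets D R" "q \<notin> C" by auto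
    have w: "0 \<le> wt C" by (rule wt_nonneg[OF C(1)])
    have ins: "insert q C \<in> psets D R \<longleftrightarrow> \<not> R < real q * real (sprod C)"
      using C q psetsD[OF C(1)] by (auto simp: psets_def)
    show "wt C * (?d C)\<^sup>2 \<le> wt C * (b\<^sup>2 * (ln (real q) / ln R)\<^sup>2) + (if R < real q * real (sprod C) then wt C * (1 + b)\<^sup>2 else 0)"
    proof (cases "R < real q * real (sprod C)")
      case True
      have "(?d C)\<^sup>2 \<le> (1 + b)\<^sup>2"
        using True ins ywt_bounds[OF R b, of "sprod C"] psets_prod_pos[OF C(1)] psetsD(4)[OF C(1)]
        by (intro power_mono) (auto simp: Suc_le_eq)
      then have "wt C * (?d C)\<^sup>2 \<le> wt C * (1 + b)\<^sup>2" using w by (rule mult_left_mono)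
      moreover have "0 \<le> wt C * (b\<^sup>2 * (ln (real q) / ln R)\<^sup>2)" using w by simp
      ultimately show ?thesis using True by simp
    next
      case False
      have e: "ln (R / real (q * sprod C)) = ln (R / real (sprod C)) - ln (real q)"
        using psets_prod_pos[OF C(1)] q4 R by (simp add: ln_div ln_mult)
      have "?d C = ywt b R (sprod C) - ywt b R (q * sprod C)" using False ins by simp
      also have "\<dots> = b * (ln (real q) / ln R)"
        unfolding ywt_def e by (simp only: diff_divide_distrib right_diff_distrib)
      finally have fd: "?d C = b * (ln (real q) / ln R)" .
      show ?thesis unfolding fd power_mult_distrib using False by simp
    qed
  qed
  also have "\<dots> \<le> (\<Sum>C\<in>psets D R. wt C * (b\<^sup>2 * (ln (real q) / ln R)\<^sup>2) + (if R < real q * real (sprod C) then wt C * (1 + b)\<^sup>2 else 0))"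
    by (intro sum_mono2) (auto intro!: add_nonneg_nonneg mult_nonneg_nonneg intro: wt_nonneg)
  also have "\<dots> = b\<^sup>2 * (ln (real q) / ln R)\<^sup>2 * mo 0 R + (1 + b)\<^sup>2 * (\<Sum>C | C \<in> psets D R \<and> R < real q * real (sprod C). wt C)"
  proof -
    have "(\<Sum>C\<in>psets D R. if R < real q * real (sprod C) then wt C * (1 + b)\<^sup>2 else 0) = (\<Sum>C | C \<in> psets D R \<and> R < real q * real (sprod C). wt C * (1 + b)\<^sup>2)"
      by (rule sum.inter_filter[symmetric]) simp
    then show ?thesis unfolding sum.distrib moment_def wt_def by (simp add: sum_distrib_left sum_distrib_right mult_ac)
  qed
  also have "\<dots> \<le> b\<^sup>2 * (ln (real q) / ln R) * mo 0 R + (1 + b)\<^sup>2 * (exp (2 * real k / real D) * (2 * ln (real q)) * mo1 0 R)"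
  proof (intro add_mono mult_right_mono mult_left_mono)
    have t: "0 \<le> ln (real q) / ln R" "ln (real q) / ln R \<le> 1" using l lq q q4 by auto
    then show "(ln (real q) / ln R)\<^sup>2 \<le> ln (real q) / ln R" using power_decreasing[of 1 2 "ln (real q) / ln R"] by simp
    have "(\<Sum>C | C \<in> psets D R \<and> R < real q * real (sprod C). wt C) \<le> exp (2 * real k / real D) * (1 + ln (real q)) * mo1 0 R"
      using R q4 by (intro wt_tail_le) auto
    also have "\<dots> \<le> exp (2 * real k / real D) * (2 * ln (real q)) * mo1 0 R"
      using lq1 moment_nonneg[of k D "real k - 1" 0 R] D2 k2 by (intro mult_right_mono mult_left_mono) auto
    finally show "(\<Sum>C | C \<in> psets D R \<and> R < real q * real (sprod C). wt C) \<le> exp (2 * real k / real D) * (2 * ln (real q)) * mo1 0 R" .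
  qed (use moment_nonneg[of k D "real k" 0 R] D2 in auto)
  also have "\<dots> = ln (real q) * (b\<^sup>2 * (mo 0 R / ln R) + 2 * (1 + b)\<^sup>2 * exp (2 * real k / real D) * mo1 0 R)"
    by (simp add: algebra_simps)
  finally show ?thesis .
qed

end

text \<open>Divided by \<open>moment 0 * ln x ^ (j + 1)\<close>, the recurrence has error O(1 / ln
  x), so each step multiplies the limit by (j + 1) / (j + 1 + \<kappa>). This product is a quotient
  of Beta integrals.\<close>

lemma moment_ratio_limit:
  fixes \<kappa> :: real and k D j :: nat
  assumes PNT: "\<And>N::nat. 2 \<le> N \<Longrightarrow> \<bar>(\<Sum>p | prime p \<and> p \<le> N. ln (real p)) - real N\<bar> \<le> K * real N / (ln (real N))\<^sup>2"
    and D: "2 * k \<le> D" and \<kappa>: "0 \<le> \<kappa>"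
  shows "((\<lambda>x. moment D k \<kappa> j x / (moment D k \<kappa> 0 x * ln x ^ j)) \<longlongrightarrow> (\<Prod>i=1..j. real i / (real i + \<kappa>))) at_top"
proof (induction j)
  have pos: "1 \<le> moment D k \<kappa> 0 x" if "1 \<le> x" for x
    using D \<kappa> that by (intro moment_zero_ge1) auto
  case 0
  have "\<forall>\<^sub>F x in at_top. moment D k \<kappa> 0 x / (moment D k \<kappa> 0 x * ln x ^ 0) = 1"
    using eventually_ge_at_top[of 1] by eventually_elim (use pos in force)
  then show ?case by (simp add: tendsto_eventually)
next
  have pos: "1 \<le> moment D k \<kappa> 0 x" if "1 \<le> x" for x
    using D \<kappa> that by (intro moment_zero_ge1) auto
  case (Suc j)
  define r where "r i x = moment D k \<kappa> i x / (moment D k \<kappa> 0 x * ln x ^ i)" for i x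
  define s where "s = 1 + \<kappa> / real (j + 1)"
  have s: "0 < s" unfolding s_def using \<kappa> by (intro add_pos_nonneg) auto
  let ?t = "\<Prod>i=1..j. real i / (real i + \<kappa>)"
  obtain E where E: "\<And>x. 1 \<le> x \<Longrightarrow> \<bar>ln x * moment D k \<kappa> j x - s * moment D k \<kappa> (j + 1) x\<bar> \<le> E * moment D k \<kappa> j x"
    unfolding s_def using moment_recurrence[OF PNT D \<kappa>, of j] by blast
  have rj: "(r j \<longlongrightarrow> ?t) at_top" using Suc unfolding r_def .
  have ev: "\<forall>\<^sub>F x in at_top. norm (r j x - s * r (j + 1) x) \<le> E * r j x / ln x"
    using eventually_gt_at_top[of 1]
  proof eventually_elim
    case (elim x)
    have l: "0 < ln x" and M: "0 < moment D k \<kappa> 0 x" using elim pos[of x] by auto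
    let ?d = "moment D k \<kappa> 0 x * ln x ^ (j + 1)"
    have d: "0 < ?d" using l M by simp
    have e: "r j x = ln x * moment D k \<kappa> j x / ?d" using l unfolding r_def by simp
    have "r j x - s * r (j + 1) x = (ln x * moment D k \<kappa> j x - s * moment D k \<kappa> (j + 1) x) / ?d"
      unfolding e by (simp add: r_def diff_divide_distrib)
    then have "\<bar>r j x - s * r (j + 1) x\<bar> = \<bar>ln x * moment D k \<kappa> j x - s * moment D k \<kappa> (j + 1) x\<bar> / ?d"
      using d by (simp add: abs_divide)
    also have "\<dots> \<le> E * moment D k \<kappa> j x / ?d" using E[of x] elim d by (intro divide_right_mono) auto
    also have "\<dots> = E * r j x / ln x" using l unfolding r_def by simp
    finally show ?case by simp
  qed
  have "((\<lambda>x. E * r j x * inverse (ln x)) \<longlongrightarrow> E * ?t * 0) at_top"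
    by (intro tendsto_mult tendsto_const rj tendsto_inverse_0_at_top ln_at_top)
  then have "((\<lambda>x. E * r j x / ln x) \<longlongrightarrow> 0) at_top" by (simp add: divide_inverse)
  from Lim_null_comparison[OF ev this] have "((\<lambda>x. r j x - s * r (j + 1) x) \<longlongrightarrow> 0) at_top" .
  from tendsto_diff[OF rj this] have "((\<lambda>x. s * r (j + 1) x) \<longlongrightarrow> ?t) at_top" by simp
  from tendsto_divide[OF this tendsto_const, of s] have "((\<lambda>x. r (j + 1) x) \<longlongrightarrow> ?t / s) at_top" using s by simp
  moreover have "?t / s = (\<Prod>i=1..Suc j. real i / (real i + \<kappa>))"
    unfolding s_def using \<kappa> by (simp add: field_simps)
  ultimately show ?case unfolding r_def by simp
qed

section \<open>The parity inequality\<close>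

lemma liouville_cases: "liouville n = 1 \<or> liouville n = -1"
  unfolding liouville_def by (cases "even (bigOmega n)") auto

lemma bigOmega_prime: "prime p \<Longrightarrow> bigOmega p = 1"
  by (simp add: bigOmega_def prime_factorization_prime)

context tuple_sieve
begin

text \<open>Only primes above D are tested, since the class v already keeps every n + h coprime to
  the smaller ones.\<close>

definition rough :: "nat \<Rightarrow> real \<Rightarrow> bool" where
  "rough n z \<longleftrightarrow> (\<forall>q. prime q \<and> D < q \<and> real q \<le> z \<longrightarrow> \<not> has_root n q)"

definition good :: "nat \<Rightarrow> bool" where
  "good n \<longleftrightarrow> (\<exists>h\<in>H. \<exists>h'\<in>H. h \<noteq> h' \<and> prime (n + h) \<and> liouville (n + h') = -1)"

lemma sw_nonneg: "0 \<le> sw R y n"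
  by (simp add: sw_def)

text \<open>A rough n that is not good has at most one prime shift, because a second prime would
  itself have Liouville value -1. With one prime shift the Liouville values add up to k - 2; with
  none the bracket is nonnegative, their sum being at least -k. Without roughness the term k squared
  dominates trivially.\<close>

lemma parity_pointwise:
  assumes n: "n \<in> window N" and HN: "\<And>h. h \<in> H \<Longrightarrow> h \<le> N" and ng: "\<not> (rough n z \<and> good n)"
  shows "(real k - 1) * (\<Sum>h\<in>H. lnp (n + h))
    \<le> ln (3 * real N) * (real k / 2 + 1 / 2 * (\<Sum>h\<in>H. liouville (n + h)) + (if rough n z then 0 else (real k)\<^sup>2))"
proof -
  have N: "N < n" "n \<le> 2 * N" using n by (auto simp: window_def)
  then have N0: "1 \<le> real N" by simp
  have l3: "0 \<le> ln (3 * real N)" using N0 by simp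
  have lnp_le: "lnp (n + h) \<le> ln (3 * real N)" if "h \<in> H" for h
  proof -
    have "real (n + h) \<le> 3 * real N" using N HN[OF that] by simp
    moreover have "0 < real (n + h)" using N by simp
    ultimately have "ln (real (n + h)) \<le> ln (3 * real N)" by (subst ln_le_cancel_iff) auto
    then show ?thesis using l3 by (simp add: lnp_def)
  qed
  have lam_ge: "- real k \<le> (\<Sum>h\<in>H. liouville (n + h))"
  proof -
    have "(\<Sum>h\<in>H. -1) \<le> (\<Sum>h\<in>H. liouville (n + h))"
    proof (rule sum_mono)
      fix h show "-1 \<le> liouville (n + h)" using liouville_cases[of "n + h"] by auto
    qed
    then show ?thesis using cardH by simp
  qed
  have k1: "0 \<le> real k - 1" using k2 by simp
  show ?thesis
  proof (cases "rough n z")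
    case False
    have "(\<Sum>h\<in>H. lnp (n + h)) \<le> (\<Sum>h\<in>H. ln (3 * real N))" using lnp_le by (rule sum_mono)
    then have "(\<Sum>h\<in>H. lnp (n + h)) \<le> real k * ln (3 * real N)" using cardH by simp
    then have "(real k - 1) * (\<Sum>h\<in>H. lnp (n + h)) \<le> (real k - 1) * (real k * ln (3 * real N))"
      using k1 by (rule mult_left_mono)
    also have "\<dots> = ln (3 * real N) * ((real k - 1) * real k)" by simp
    also have "\<dots> \<le> ln (3 * real N) * (real k / 2 + 1 / 2 * (\<Sum>h\<in>H. liouville (n + h)) + (real k)\<^sup>2)"
      using lam_ge l3 by (intro mult_left_mono) (auto simp: power2_eq_square algebra_simps)
    finally show ?thesis using False by simp
  next
    case True
    then have ng: "\<not> good n" using ng by simp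
    show ?thesis
    proof (cases "\<exists>h\<in>H. prime (n + h)")
      case False
      then have "(\<Sum>h\<in>H. lnp (n + h)) = 0" by (intro sum.neutral) (auto simp: lnp_def)
      then show ?thesis using True lam_ge l3 by (auto intro!: mult_nonneg_nonneg)
    next
      case ex: True
      then obtain h where h: "h \<in> H" "prime (n + h)" by auto
      have lh: "liouville (n + h) = -1" using h by (simp add: liouville_def bigOmega_prime)
      have other: "liouville (n + h') = 1" if "h' \<in> H - {h}" for h'
        using ng h that liouville_cases[of "n + h'"] unfolding good_def by auto
      have np: "lnp (n + h') = 0" if "h' \<in> H - {h}" for h'
      proof -
        have "\<not> prime (n + h')"
        proof
          assume "prime (n + h')"
          then have "liouville (n + h') = -1" by (simp add: liouville_def bigOmega_prime)
          then show False using other[OF that] by simp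
        qed
        then show ?thesis by (simp add: lnp_def)
      qed
      have s1: "(\<Sum>h\<in>H. lnp (n + h)) = lnp (n + h)"
        using h finH np by (simp add: sum.remove[of H h])
      have "(\<Sum>h'\<in>H - {h}. liouville (n + h')) = (\<Sum>h'\<in>H - {h}. 1)" using other by (intro sum.cong) auto
      then have s2: "(\<Sum>h\<in>H. liouville (n + h)) = real k - 2"
        using h finH cardH lh k2 by (simp add: sum.remove[of H h] of_nat_diff)
      \<comment> \<open>Here the bracket equals k / 2 + (k - 2) / 2 = k - 1, so the only loss is
        that of \<open>lnp\<close> against \<open>ln (3 * N)\<close>.\<close>
      have "(real k - 1) * lnp (n + h) \<le> (real k - 1) * ln (3 * real N)"
        using lnp_le[OF h(1)] k1 by (rule mult_left_mono)
      then show ?thesis unfolding s1 s2 using True by (simp add: field_simps)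
    qed
  qed
qed

text \<open>The nonnegative weight preserves the pointwise inequality. The n that are not rough are
  covered by a union bound over the primes q that witness it.\<close>

lemma parity_inequality:
  assumes HN: "\<And>h. h \<in> H \<Longrightarrow> h \<le> N" and ng: "\<And>n. n \<in> window N \<Longrightarrow> \<not> (rough n z \<and> good n)" and N: "1 \<le> N"
  shows "(real k - 1) * (\<Sum>h\<in>H. \<Sum>n\<in>window N. sw R y n * lnp (n + h))
    \<le> ln (3 * real N) * (real k / 2 * (\<Sum>n\<in>window N. sw R y n) + 1 / 2 * (\<Sum>h\<in>H. \<bar>\<Sum>n\<in>window N. sw R y n * liouville (n + h)\<bar>)
       + (real k)\<^sup>2 * (\<Sum>q | (prime q \<and> D < q) \<and> real q \<le> z. \<Sum>n | n \<in> window N \<and> has_root n q. sw R y n))"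
proof -
  let ?Q = "{q. (prime q \<and> D < q) \<and> real q \<le> z}"
  let ?S = "\<Sum>n\<in>window N. sw R y n" and ?L = "\<lambda>h. \<Sum>n\<in>window N. sw R y n * liouville (n + h)"
  let ?NR = "\<Sum>q\<in>?Q. \<Sum>n | n \<in> window N \<and> has_root n q. sw R y n"
  have l3: "0 \<le> ln (3 * real N)" using N by simp
  have "(real k - 1) * (\<Sum>h\<in>H. \<Sum>n\<in>window N. sw R y n * lnp (n + h))
     = (\<Sum>n\<in>window N. sw R y n * ((real k - 1) * (\<Sum>h\<in>H. lnp (n + h))))"
    by (subst sum.swap) (simp add: sum_distrib_left mult_ac)
  also have "\<dots> \<le> (\<Sum>n\<in>window N. sw R y n * (ln (3 * real N) * (real k / 2 + 1 / 2 * (\<Sum>h\<in>H. liouville (n + h)) + (if rough n z then 0 else (real k)\<^sup>2))))"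
    using parity_pointwise[OF _ HN ng] by (intro sum_mono mult_left_mono sw_nonneg) auto
  also have "\<dots> = ln (3 * real N) * (real k / 2 * ?S + 1 / 2 * (\<Sum>h\<in>H. ?L h) + (real k)\<^sup>2 * (\<Sum>n\<in>window N. if rough n z then 0 else sw R y n))"
  proof -
    have sp: "sw R y n * (ln (3 * real N) * (real k / 2 + 1 / 2 * (\<Sum>h\<in>H. liouville (n + h)) + (if rough n z then 0 else (real k)\<^sup>2)))
      = ln (3 * real N) * (real k / 2 * sw R y n) + ln (3 * real N) * (1 / 2 * (\<Sum>h\<in>H. sw R y n * liouville (n + h)))
        + ln (3 * real N) * ((real k)\<^sup>2 * (if rough n z then 0 else sw R y n))" for n
      unfolding sum_distrib_left[symmetric] by (cases "rough n z") (simp_all add: algebra_simps)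
    have sw: "(\<Sum>n\<in>window N. sw R y n * (\<Sum>h\<in>H. liouville (n + h))) = (\<Sum>h\<in>H. ?L h)"
      unfolding sum_distrib_left by (rule sum.swap)
    show ?thesis unfolding sp sum.distrib sum_distrib_left[symmetric] sw by (simp add: distrib_left)
  qed
  also have "\<dots> \<le> ln (3 * real N) * (real k / 2 * ?S + 1 / 2 * (\<Sum>h\<in>H. \<bar>?L h\<bar>) + (real k)\<^sup>2 * ?NR)"
  proof (intro mult_left_mono add_mono l3 order_refl)
    show "(\<Sum>h\<in>H. ?L h) \<le> (\<Sum>h\<in>H. \<bar>?L h\<bar>)" by (rule sum_mono) simp
    have "(\<Sum>n\<in>window N. if rough n z then 0 else sw R y n) \<le> (\<Sum>n\<in>window N. \<Sum>q\<in>?Q. if has_root n q then sw R y n else 0)"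
    proof (rule sum_mono)
      fix n
      have nn: "0 \<le> (\<Sum>q\<in>?Q. if has_root n q then sw R y n else 0)" using sw_nonneg by (intro sum_nonneg) auto
      show "(if rough n z then 0 else sw R y n) \<le> (\<Sum>q\<in>?Q. if has_root n q then sw R y n else 0)"
      proof (cases "rough n z")
        case True then show ?thesis using nn by simp
      next
        case False
        then obtain q where q: "q \<in> ?Q" "has_root n q" unfolding rough_def by auto
        have "(if has_root n q then sw R y n else 0) \<le> (\<Sum>q\<in>?Q. if has_root n q then sw R y n else 0)"
          using q sw_nonneg by (intro member_le_sum) auto
        then show ?thesis using q False by simp
      qed
    qed
    also have "\<dots> = ?NR"
      by (subst sum.swap, rule sum.cong[OF refl]) (simp add: sum.inter_filter)
    finally show "(\<Sum>n\<in>window N. if rough n z then 0 else sw R y n) \<le> ?NR" .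
  qed auto
  finally show ?thesis .
qed

end

text \<open>The quotient of the Beta integrals of \<open>(1 - u) ^ j * u powr (\<kappa> - 1)\<close> and \<open>u powr (\<kappa> - 1)\<close> over the unit interval.\<close>

definition beta_ratio :: "real \<Rightarrow> nat \<Rightarrow> real" where
  "beta_ratio \<kappa> j = (\<Prod>i=1..j. real i / (real i + \<kappa>))"

section \<open>Averaged parity inequality with normalised main terms\<close>

context tuple_sieve
begin

text \<open>The moduli cost \<open>N powr \<tau>\<close> and the primes q of the union bound another
  \<open>N powr c\<close>; \<tau> + c < 1 leaves a positive power against the 4 * k + 16 * k
  logarithms.\<close>

lemma polynomial_errors_small:
  fixes b \<tau> c :: real
  assumes "0 \<le> b" "0 < \<tau>" "0 < c" "\<tau> + c < 1"
  shows "\<forall>\<^sub>F N in sequentially. ((1 + b) * (1 + ln (real N powr (\<tau> / 2))) ^ (2 * k))\<^sup>2 *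
     (real k * (real N powr (\<tau> / 2) * real N powr (\<tau> / 2) * (1 + ln (real N powr (\<tau> / 2) * real N powr (\<tau> / 2))) ^ (16 * k))) * (real N powr c + 1) \<le> real N"
proof -
  define \<delta> where "\<delta> = (1 - \<tau> - c) / 2"
  have \<delta>: "0 < \<delta>" using assms by (simp add: \<delta>_def)
  define A where "A = (1 + b)\<^sup>2 * real k * 2"
  have "(\<lambda>x::real. (1 + ln x) ^ (20 * k)) \<in> o(\<lambda>x. x powr \<delta>)"
  proof -
    have "(\<lambda>x::real. (1 + ln x)) \<in> O(\<lambda>x. ln x)" by real_asymp
    then have 1: "(\<lambda>x::real. (1 + ln x) ^ (20 * k)) \<in> O(\<lambda>x. ln x ^ (20 * k))" by (rule landau_o.big_power)
    have "(\<lambda>x::real. ln x ^ (20 * k)) \<in> o(\<lambda>x. x powr \<delta>)"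
      using \<delta> by real_asymp
    from landau_o.big_small_trans[OF 1 this] show ?thesis .
  qed
  then have "(\<lambda>x::real. A * (1 + ln x) ^ (20 * k)) \<in> o(\<lambda>x. x powr \<delta>)"
    by (cases "A = 0") auto
  from landau_o.smallD[OF this zero_less_one]
  have "\<forall>\<^sub>F x in at_top. norm (A * (1 + ln x) ^ (20 * k)) \<le> 1 * norm (x powr \<delta> :: real)" .
  then have ev: "\<forall>\<^sub>F N in sequentially. norm (A * (1 + ln (real N)) ^ (20 * k)) \<le> 1 * norm (real N powr \<delta>)"
    by (rule eventually_compose_filterlim[OF _ filterlim_real_sequentially])
  show ?thesis using ev eventually_ge_at_top[of 1]
  proof eventually_elim
    case (elim N)
    have N: "1 \<le> real N" "0 < real N" using elim by auto
    let ?l = "ln (real N)"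
    have l0: "0 \<le> ?l" using N by simp
    have RR: "real N powr (\<tau> / 2) * real N powr (\<tau> / 2) = real N powr \<tau>" by (simp add: powr_add[symmetric])
    have lR: "ln (real N powr (\<tau> / 2)) = \<tau> / 2 * ?l" "ln (real N powr \<tau>) = \<tau> * ?l" using N by (auto simp: ln_powr)
    have th: "\<tau> / 2 \<le> 1" "\<tau> \<le> 1" using assms by auto
    have b1: "0 \<le> 1 + \<tau> / 2 * ?l" "1 + \<tau> / 2 * ?l \<le> 1 + ?l" "0 \<le> 1 + \<tau> * ?l" "1 + \<tau> * ?l \<le> 1 + ?l"
    proof -
      have "0 \<le> \<tau> / 2 * ?l" "\<tau> / 2 * ?l \<le> 1 * ?l" "0 \<le> \<tau> * ?l" "\<tau> * ?l \<le> 1 * ?l"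
        using assms th l0 by (intro mult_nonneg_nonneg mult_right_mono; simp)+
      then show "0 \<le> 1 + \<tau> / 2 * ?l" "1 + \<tau> / 2 * ?l \<le> 1 + ?l" "0 \<le> 1 + \<tau> * ?l" "1 + \<tau> * ?l \<le> 1 + ?l"
        by linarith+
    qed
    have zc: "1 \<le> real N powr c" using N assms by (simp add: ge_one_powr_ge_zero)
    have "((1 + b) * (1 + \<tau> / 2 * ?l) ^ (2 * k))\<^sup>2 * (real k * (real N powr \<tau> * (1 + \<tau> * ?l) ^ (16 * k))) * (real N powr c + 1)
       \<le> ((1 + b) * (1 + ?l) ^ (2 * k))\<^sup>2 * (real k * (real N powr \<tau> * (1 + ?l) ^ (16 * k))) * (2 * real N powr c)"
      using b1 assms zc l0 by (intro mult_mono power_mono mult_nonneg_nonneg zero_le_power order_refl) auto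
    also have "\<dots> = A * (1 + ?l) ^ (20 * k) * (real N powr \<tau> * real N powr c)"
    proof -
      have "((1 + ?l) ^ (2 * k))\<^sup>2 * (1 + ?l) ^ (16 * k) = (1 + ?l) ^ (20 * k)"
        by (simp add: power_mult[symmetric] power_add[symmetric])
      then show ?thesis unfolding A_def by (simp add: power_mult_distrib mult_ac)
    qed
    also have "\<dots> \<le> real N powr \<delta> * (real N powr \<tau> * real N powr c)"
    proof (rule mult_right_mono)
      have nn: "0 \<le> real N powr \<delta>" by simp
      have "\<bar>A * (1 + ?l) ^ (20 * k)\<bar> \<le> real N powr \<delta>"
        using elim(1) unfolding real_norm_def mult_1 abs_of_nonneg[OF nn] .
      then show "A * (1 + ?l) ^ (20 * k) \<le> real N powr \<delta>" by linarith
    qed simp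
    also have "\<dots> = real N powr (\<delta> + \<tau> + c)" by (simp add: powr_add)
    also have "\<dots> \<le> real N powr 1" using N assms by (intro powr_mono) (auto simp: \<delta>_def field_simps)
    finally show ?case unfolding RR lR using N by simp
  qed
qed

text \<open>The squared bound for the sieve coefficients costs 4 * k logarithms. The errors are
  taken with one logarithm more, which beats the constant.\<close>

lemma log_errors_small:
  fixes b \<tau> :: real
  assumes "0 \<le> b" "0 < \<tau>" "\<tau> < 1"
  shows "\<forall>\<^sub>F N in sequentially. \<forall>E. E \<le> 2 * (real N / ln (real N) ^ (4 * k + 1)) \<longrightarrow>
     ((1 + b) * (1 + ln (real N powr (\<tau> / 2))) ^ (2 * k))\<^sup>2 * E \<le> real N"
proof -
  define A where "A = (1 + b)\<^sup>2 * 2 ^ (4 * k) * 2"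
  have ev: "\<forall>\<^sub>F N in sequentially. max A 1 \<le> ln (real N)" by real_asymp
  show ?thesis using ev eventually_ge_at_top[of 3]
  proof eventually_elim
    case (elim N)
    let ?l = "ln (real N)"
    have l: "A \<le> ?l" "1 \<le> ?l" using elim by auto
    have lR: "ln (real N powr (\<tau> / 2)) = \<tau> / 2 * ?l" using elim by (auto simp: ln_powr)
    have "\<tau> / 2 * ?l \<le> 1 * ?l" using assms l by (intro mult_right_mono) auto
    moreover have "0 \<le> \<tau> / 2 * ?l" using assms l by (intro mult_nonneg_nonneg) auto
    ultimately have b1: "0 \<le> 1 + \<tau> / 2 * ?l" "1 + \<tau> / 2 * ?l \<le> 2 * ?l" using l by linarith+
    show ?case
    proof (intro allI impI)
      fix E assume E: "E \<le> 2 * (real N / ?l ^ (4 * k + 1))"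
      have "((1 + b) * (1 + \<tau> / 2 * ?l) ^ (2 * k))\<^sup>2 * E \<le> ((1 + b) * (1 + \<tau> / 2 * ?l) ^ (2 * k))\<^sup>2 * (2 * (real N / ?l ^ (4 * k + 1)))"
        using E by (rule mult_left_mono) simp
      also have "\<dots> \<le> ((1 + b) * (2 * ?l) ^ (2 * k))\<^sup>2 * (2 * (real N / ?l ^ (4 * k + 1)))"
        using b1 assms l by (intro mult_right_mono power_mono mult_left_mono) auto
      also have "\<dots> = A * (real N / ?l)"
      proof -
        have "((2 * ?l) ^ (2 * k))\<^sup>2 = 2 ^ (4 * k) * ?l ^ (4 * k)"
          by (simp add: power_mult_distrib power_mult[symmetric])
        then show ?thesis unfolding A_def using l by (simp add: power_mult_distrib)
      qed
      also have "\<dots> \<le> ?l * (real N / ?l)" using l by (intro mult_right_mono) auto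
      also have "\<dots> = real N" using l by simp
      finally show "((1 + b) * (1 + ln (real N powr (\<tau> / 2))) ^ (2 * k))\<^sup>2 * E \<le> real N" unfolding lR .
    qed
  qed
qed

end

context tuple_sieve
begin

lemma errA_pair_bound:
  assumes A: "condA \<theta>" and t: "0 < \<tau>" "\<tau> < \<theta>" "\<tau> < 1"
  shows "\<forall>\<^sub>F N in sequentially. \<forall>h\<in>H. (\<Sum>C\<in>psets D (real N powr \<tau>). real (16 * k) ^ card C *
      (errA (2 * N + h) (W * sprod C) + errA (N + h) (W * sprod C))) \<le> 2 * (real N / ln (real N) ^ (4 * k + 1))"
  using errA_small[OF A t, of "16 * k" "4 * k + 1"] eventually_ge_at_top[of D]
proof eventually_elim
  case (elim N)
  show ?case
  proof
    fix h assume h: "h \<in> H"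
    then have "h \<le> N" using HD[OF h] elim by simp
    then show "(\<Sum>C\<in>psets D (real N powr \<tau>). real (16 * k) ^ card C *
      (errA (2 * N + h) (W * sprod C) + errA (N + h) (W * sprod C))) \<le> 2 * (real N / ln (real N) ^ (4 * k + 1))"
      unfolding distrib_left sum.distrib
      using elim(1)[rule_format, of "2 * N + h"] elim(1)[rule_format, of "N + h"] by simp
  qed
qed

lemma errB_double_bound:
  assumes B: "condB \<theta>" and t: "0 < \<tau>" "\<tau> < \<theta>" "\<tau> < 1"
  shows "\<forall>\<^sub>F N in sequentially. (\<Sum>C\<in>psets D (real N powr \<tau>). real (16 * k) ^ card C *
      (2 * errB (3 * N) (W * sprod C))) \<le> 2 * (real N / ln (real N) ^ (4 * k + 1))"
  using errB_small[OF B t, of "16 * k" "4 * k + 1"]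
proof eventually_elim
  case (elim N)
  have "(\<Sum>C\<in>psets D (real N powr \<tau>). real (16 * k) ^ card C * (2 * errB (3 * N) (W * sprod C)))
     = 2 * (\<Sum>C\<in>psets D (real N powr \<tau>). real (16 * k) ^ card C * errB (3 * N) (W * sprod C))"
    by (simp add: sum_distrib_left mult_ac)
  then show ?case using elim[rule_format, of "3 * N"] by simp
qed

text \<open>If no such n existed in a window, \<open>G * lhs N\<close> and \<open>G * rhs N\<close>
  would bound the two sides of the averaged parity inequality from below and above, forcing
  \<open>lhs N \<le> rhs N\<close>. Both sequences converge, and \<open>slack\<close> together with
  a small c orders their limits strictly the other way.\<close>

lemma good_exists:
  fixes b \<tau> \<theta> :: real
  assumes A: "condA \<theta>" and B: "condB \<theta>" and t: "0 < \<tau>" "\<tau> < \<theta>" "\<tau> < 1" and b: "0 \<le> b"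
    and slack: "exp (2 * real k / real D) * (1 + 2 * b * beta_ratio (real k) 1 + b\<^sup>2 * beta_ratio (real k) 2)
      < \<tau> * (real k * (real k - 1) * (beta_ratio (real k - 1) 2 + b * beta_ratio (real k - 1) 3 + b\<^sup>2 / 4 * beta_ratio (real k - 1) 4))"
  shows "\<exists>c>0. \<forall>\<^sub>F N in sequentially. \<exists>n\<in>window N. rough n (real N powr c) \<and> good n"
proof -
  define \<eta> where "\<eta> = exp (2 * real k / real D)"
  define U where "U = 1 + 2 * b * beta_ratio (real k) 1 + b\<^sup>2 * beta_ratio (real k) 2"
  define L where "L = beta_ratio (real k - 1) 2 + b * beta_ratio (real k - 1) 3 + b\<^sup>2 / 4 * beta_ratio (real k - 1) 4"
  \<comment> \<open>The limit of the last bracket in \<open>Vn\<close>, as \<open>Qn\<close> tends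
    to \<eta> / k.\<close>
  define B0 where "B0 = b\<^sup>2 * Phi * (\<eta> * (1 / real k)) + 2 * (1 + b)\<^sup>2 * \<eta>"
  have \<eta>0: "0 < \<eta>" by (simp add: \<eta>_def)
  have k0: "0 < real k" "1 \<le> real k" "0 \<le> real k - 1" using k2 by auto
  have B0: "0 \<le> B0" unfolding B0_def using Phi_pos \<eta>0 b by simp
  define gap where "gap = \<tau> * (real k * (real k - 1) * L) - \<eta> * U"
  have gap: "0 < gap" using slack by (simp add: gap_def \<eta>_def U_def L_def)
  \<comment> \<open>Respectively: the error terms of all q stay below N, every q is at most R, and
    the limiting contribution of the n that are not rough fits into the gap. \<open>B0\<close> and
    \<open>Phi\<close> depend on D, so c is chosen after it.\<close>
  obtain c where c: "0 < c" "\<tau> + c < 1" "c \<le> \<tau> / 2" "4 * (real k) ^ 3 / (Phi * \<tau>) * B0 * c < gap"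
  proof -
    define V where "V = 4 * (real k) ^ 3 / (Phi * \<tau>) * B0"
    have V: "0 \<le> V" unfolding V_def using B0 Phi_pos t by simp
    define c where "c = min (min ((1 - \<tau>) / 2) (\<tau> / 2)) (gap / (2 * (V + 1)))"
    have "0 < c" unfolding c_def using t gap V by auto
    moreover have "\<tau> + c < 1"
    proof -
      have "c \<le> min ((1 - \<tau>) / 2) (\<tau> / 2)" unfolding c_def by (rule min.cobounded1)
      also have "\<dots> \<le> (1 - \<tau>) / 2" by (rule min.cobounded1)
      finally show ?thesis using t by (simp add: field_simps)
    qed
    moreover have "c \<le> \<tau> / 2" unfolding c_def by (rule min.coboundedI1, rule min.cobounded2)
    moreover have "V * c < gap"
    proof -
      have "V * c \<le> V * (gap / (2 * (V + 1)))" unfolding c_def using V by (intro mult_left_mono) auto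
      also have "\<dots> < gap" using V gap by (simp add: field_simps add_nonneg_pos)
      finally show ?thesis .
    qed
    ultimately show ?thesis using that unfolding V_def by blast
  qed
  obtain K where PNT: "\<And>N::nat. 2 \<le> N \<Longrightarrow> \<bar>(\<Sum>p | prime p \<and> p \<le> N. ln (real p)) - real N\<bar> \<le> K * real N / (ln (real N))\<^sup>2"
    using PNT_of_condA[OF A less_trans[OF t(1,2)]] by blast
  \<comment> \<open>The case \<kappa> = 1, k = 0, j = 0 is Mertens' estimate for the sum of
    \<open>ln p / p\<close> over primes above D.\<close>
  obtain E where E: "0 \<le> E" "\<And>x. 1 \<le> x \<Longrightarrow>
    \<bar>(\<Sum>p | (prime p \<and> D < p) \<and> real p \<le> x. 1 / (real p - real 0) * ln (real p) * ln (x / real p) ^ 0)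
       - 1 * ln x ^ (0 + 1) / real (0 + 1)\<bar> \<le> E * ln x ^ 0"
    using prime_log_weight_sum[OF PNT, of 0 D 1 0] by auto
  define R where "R N = real N powr (\<tau> / 2)" for N :: nat
  define lR where "lR N = ln (R N)" for N
  define r where "r j N = mo1 j (R N) / (mo1 0 (R N) * lR N ^ j)" for j N
  define s where "s j N = mo j (R N) / (mo 0 (R N) * lR N ^ j)" for j N
  define Ln where "Ln N = r 2 N + b * r 3 N + b\<^sup>2 / 4 * r 4 N" for N
  define Us where "Us N = 1 + 2 * b * s 1 N + b\<^sup>2 * s 2 N" for N
  define Qn where "Qn N = \<eta> * (r 1 N + (1 + 2 * real W) / Phi * (1 / lR N))" for N
  define Vn where "Vn N = real k / Phi * ((c * ln (real N) + E) / lR N) * (b\<^sup>2 * Phi * Qn N + 2 * (1 + b)\<^sup>2 * \<eta>)" for N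
  \<comment> \<open>Measures errors of size N in units of the normalising factor \<open>G\<close>,
    namely \<open>N \<le> G * \<nu> N\<close>. It decays like the inverse square of
    \<open>ln R\<close>, so it still tends to 0 after multiplication by
    \<open>ln (3 * N)\<close>.\<close>
  define \<nu> where "\<nu> N = real W / Phi * (1 / (lR N)\<^sup>2)" for N
  have R_top: "filterlim R at_top sequentially" unfolding R_def using t by real_asymp
  have r_lim: "(r j \<longlongrightarrow> beta_ratio (real k - 1) j) sequentially" for j
    using filterlim_compose[OF moment_ratio_limit[OF PNT D2 k0(3), of j] R_top]
    unfolding r_def lR_def beta_ratio_def .
  have s_lim: "(s j \<longlongrightarrow> beta_ratio (real k) j) sequentially" for j
    using filterlim_compose[OF moment_ratio_limit[OF PNT D2, of "real k" j] R_top]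
    unfolding s_def lR_def beta_ratio_def by simp
  have lR_eq: "\<forall>\<^sub>F N in sequentially. lR N = \<tau> / 2 * ln (real N)"
    using eventually_gt_at_top[of 0] by eventually_elim (simp add: lR_def R_def ln_powr)
  have lim1: "((\<lambda>N. 1 / lR N) \<longlongrightarrow> 0) sequentially"
    unfolding lR_def R_def using t by real_asymp
  \<comment> \<open>This is where the level enters: primes carry the weight
    \<open>ln (3 * N)\<close>, while the sieve gains only \<open>ln R\<close>, about \<tau> / 2
    times as much.\<close>
  have lim2: "((\<lambda>N. ln (3 * real N) / lR N) \<longlongrightarrow> 2 / \<tau>) sequentially"
    unfolding lR_def R_def using t by real_asymp
  have lim3: "((\<lambda>N. (c * ln (real N) + E) / lR N) \<longlongrightarrow> 2 * c / \<tau>) sequentially"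
    unfolding lR_def R_def using t by real_asymp
  have lim4: "((\<lambda>N. ln (3 * real N) * (1 / (lR N)\<^sup>2)) \<longlongrightarrow> 0) sequentially"
    unfolding lR_def R_def using t by real_asymp
  have lim5: "((\<lambda>N. 1 / (lR N)\<^sup>2) \<longlongrightarrow> 0) sequentially"
    unfolding lR_def R_def using t by real_asymp
  have Ln_lim: "(Ln \<longlongrightarrow> L) sequentially" unfolding Ln_def L_def by (intro tendsto_intros r_lim)
  have Us_lim: "(Us \<longlongrightarrow> U) sequentially" unfolding Us_def U_def by (intro tendsto_intros s_lim)
  have Qn_lim: "(Qn \<longlongrightarrow> \<eta> * (beta_ratio (real k - 1) 1 + (1 + 2 * real W) / Phi * 0)) sequentially"
    unfolding Qn_def by (intro tendsto_intros r_lim lim1)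
  have br1: "beta_ratio (real k - 1) 1 = 1 / real k" by (simp add: beta_ratio_def)
  have Qn_lim: "(Qn \<longlongrightarrow> \<eta> * (1 / real k)) sequentially" using Qn_lim unfolding br1 by simp
  have Vn_lim: "(Vn \<longlongrightarrow> real k / Phi * (2 * c / \<tau>) * B0) sequentially"
    unfolding Vn_def B0_def by (intro tendsto_intros lim3 Qn_lim)
  have \<nu>_lim: "(\<nu> \<longlongrightarrow> real W / Phi * 0) sequentially" unfolding \<nu>_def by (intro tendsto_intros lim5)
  have l\<nu>_lim: "((\<lambda>N. ln (3 * real N) * \<nu> N) \<longlongrightarrow> real W / Phi * 0) sequentially"
  proof -
    have "(\<lambda>N. ln (3 * real N) * \<nu> N) = (\<lambda>N. real W / Phi * (ln (3 * real N) * (1 / (lR N)\<^sup>2)))"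
      by (rule ext) (simp add: \<nu>_def)
    then show ?thesis using tendsto_mult[OF tendsto_const lim4, of "real W / Phi"] by simp
  qed
  define lhs where "lhs N = (real k - 1) * real k * (Ln N - \<nu> N)" for N
  define rhs where "rhs N = ln (3 * real N) / lR N * (real k / 2 * (Qn N * Us N) + (real k)\<^sup>2 * Vn N)
      + ln (3 * real N) * \<nu> N * (real k + (real k)\<^sup>2)" for N
  have lhs_lim: "(lhs \<longlongrightarrow> (real k - 1) * real k * (L - real W / Phi * 0)) sequentially"
    unfolding lhs_def by (intro tendsto_intros Ln_lim \<nu>_lim)
  have rhs_lim: "(rhs \<longlongrightarrow> 2 / \<tau> * (real k / 2 * (\<eta> * (1 / real k) * U) + (real k)\<^sup>2 * (real k / Phi * (2 * c / \<tau>) * B0))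
      + real W / Phi * 0 * (real k + (real k)\<^sup>2)) sequentially"
    unfolding rhs_def by (intro tendsto_intros lim2 Qn_lim Us_lim Vn_lim l\<nu>_lim)
  have lt: "2 / \<tau> * (real k / 2 * (\<eta> * (1 / real k) * U) + (real k)\<^sup>2 * (real k / Phi * (2 * c / \<tau>) * B0))
      + real W / Phi * 0 * (real k + (real k)\<^sup>2) < (real k - 1) * real k * (L - real W / Phi * 0)"
  proof -
    have "2 / \<tau> * (real k / 2 * (\<eta> * (1 / real k) * U) + (real k)\<^sup>2 * (real k / Phi * (2 * c / \<tau>) * B0))
       = (\<eta> * U + 4 * (real k) ^ 3 / (Phi * \<tau>) * B0 * c) / \<tau>"
      using k0 Phi_pos t by (simp add: field_simps power2_eq_square power3_eq_cube)
    also have "\<dots> < (\<tau> * (real k * (real k - 1) * L)) / \<tau>"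
      using c(4) t unfolding gap_def by (intro divide_strict_right_mono) auto
    also have "\<dots> = (real k - 1) * real k * L" using t by simp
    finally show ?thesis by simp
  qed
  have ev_lt: "\<forall>\<^sub>F N in sequentially. rhs N < lhs N"
  proof -
    have "\<forall>\<^sub>F N in sequentially. 0 < lhs N - rhs N"
      by (rule order_tendstoD(1)[OF tendsto_diff[OF lhs_lim rhs_lim]]) (use lt in simp)
    then show ?thesis by eventually_elim simp
  qed
  have "\<forall>\<^sub>F N in sequentially. \<exists>n\<in>window N. rough n (real N powr c) \<and> good n"
    using ev_lt polynomial_errors_small[OF b t(1) c(1,2)] log_errors_small[OF b t(1,3)]
      errA_pair_bound[OF A t] errB_double_bound[OF B t] lR_eq eventually_ge_at_top[of "max 3 D"]
  proof eventually_elim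
    case (elim N)
    show ?case
    proof (rule ccontr)
      assume neg: "\<not> ?case"
      define x where "x = R N"
      define l where "l = lR N"
      define z where "z = real N powr c"
      define M where "M = mo1 0 x"
      define y where "y = ywt b x"
      \<comment> \<open>The common size of the prime sums: by \<open>prime_main_lower\<close> each
        of them is at least about \<open>G * Ln N\<close>. The factor N / \<open>totient W\<close>
        times \<open>Phi\<close> squared becomes N * \<open>Phi\<close> / W.\<close>
      define G where "G = real N * Phi / real W * M * l\<^sup>2"
      define l3 where "l3 = ln (3 * real N)"
      have N3: "3 \<le> N" "D \<le> N" using elim by auto
      have lN: "0 < ln (real N)" using N3 by simp
      have l: "0 < l" "l = ln x"
      proof -
        have "0 < \<tau> / 2 * ln (real N)" using lN t by (intro mult_pos_pos) auto
        then show "0 < l" unfolding l_def using elim(6) by linarith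
        show "l = ln x" by (simp only: l_def lR_def x_def)
      qed
      have x1: "1 < x"
      proof -
        have "real N powr 0 < real N powr (\<tau> / 2)" using N3 t by (intro powr_less_mono) auto
        then show ?thesis using N3 by (simp add: x_def R_def)
      qed
      have xx: "x * x = real N powr \<tau>" unfolding x_def R_def by (simp add: powr_add[symmetric])
      have xxN: "x * x \<le> real N"
      proof -
        have "real N powr \<tau> \<le> real N powr 1" using N3 t by (intro powr_mono) auto
        then show ?thesis unfolding xx using N3 by simp
      qed
      have zx: "z \<le> x" unfolding z_def x_def R_def using c(3) N3 by (intro powr_mono) auto
      have z1: "1 \<le> z" unfolding z_def using c N3 by (simp add: ge_one_powr_ge_zero)
      have M1: "1 \<le> M" unfolding M_def using x1 k0 D2 by (intro moment_zero_ge1) auto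
      have mo0: "1 \<le> mo 0 x" using x1 k0 D2 by (intro moment_zero_ge1) auto
      have G0: "0 < G" unfolding G_def using N3 Phi_pos W_pos M1 l by simp
      have l3: "0 \<le> l3" unfolding l3_def using N3 by simp
      have HN: "h \<le> N" if "h \<in> H" for h using HD[OF that] N3 by simp
      have y0: "0 \<le> y n" "y n \<le> 1 + b" if "1 \<le> n" "real n \<le> x" for n
        unfolding y_def using ywt_bounds[OF x1 b that] by auto
      define Lm where "Lm = (1 + b) * (1 + ln x) ^ (2 * k)"
      define Ep where "Ep = real k * (x * x * (1 + ln (x * x)) ^ (16 * k))"
      have Ep0: "0 \<le> Ep"
      proof -
        have "1 \<le> x * x" using x1 by (simp add: less_1_mult less_imp_le)
        then show ?thesis unfolding Ep_def by simp
      qed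
      have errP: "Lm\<^sup>2 * Ep * (z + 1) \<le> real N"
        using elim(2) unfolding Lm_def Ep_def x_def z_def R_def .
      have errL: "Lm\<^sup>2 * e \<le> real N" if "e \<le> 2 * (real N / ln (real N) ^ (4 * k + 1))" for e
        using elim(3) that unfolding Lm_def x_def R_def by blast
      have N\<nu>: "real N \<le> G * \<nu> N"
      proof -
        have "G * \<nu> N = real N * M" unfolding G_def \<nu>_def l_def[symmetric] using Phi_pos W_pos l by simp
        then show ?thesis using M1 N3 by simp
      qed
      have mor: "mo1 j x = r j N * M * l ^ j" for j
        unfolding r_def M_def x_def[symmetric] l_def[symmetric] using l M1[unfolded M_def] by simp
      have mos: "mo j x = s j N * mo 0 x * l ^ j" for j
        unfolding s_def x_def[symmetric] l_def[symmetric] using l mo0 by simp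
      have s_nonneg: "0 \<le> s j N" for j
        unfolding s_def x_def[symmetric] l_def[symmetric]
        using l mo0 moment_nonneg[of k D "real k" j x] D2 by (intro divide_nonneg_nonneg) auto
      have r_nonneg: "0 \<le> r j N" for j
        unfolding r_def x_def[symmetric] l_def[symmetric] M_def[symmetric]
        using l M1 moment_nonneg[of k D "real k - 1" j x] D2 k0 by (intro divide_nonneg_nonneg) auto
      have Us0: "0 \<le> Us N" unfolding Us_def using b s_nonneg by (intro add_nonneg_nonneg mult_nonneg_nonneg) auto
      have mo_le: "mo 0 x \<le> Phi * M * l * Qn N"
      proof -
        have "mo 0 x \<le> \<eta> * (Phi * mo1 1 x + (1 + 2 * real W) * mo1 0 x)"
          unfolding \<eta>_def using x1 by (intro moment_zero_convolution_le) simp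
        also have "\<dots> = Phi * M * l * Qn N"
          unfolding mor[of 1] M_def[symmetric] Qn_def l_def[symmetric] using Phi_pos l by (simp add: field_simps)
        finally show ?thesis .
      qed
      have S1: "(\<Sum>n\<in>window N. sw x y n) \<le> G / l * (Qn N * Us N) + real N"
      proof -
        have "\<bar>(\<Sum>n\<in>window N. sw x y n) - real N / real W * (\<Sum>C\<in>psets D x. wt C * (y (sprod C))\<^sup>2)\<bar>
          \<le> Lm\<^sup>2 * (x * x * (1 + ln (x * x)) ^ (16 * k))"
          unfolding Lm_def using x1 y0 by (intro sieve_sum_bound) auto
        also have "\<dots> \<le> Lm\<^sup>2 * Ep * (z + 1)"
        proof -
          have "1 * (x * x * (1 + ln (x * x)) ^ (16 * k)) \<le> Ep"
            unfolding Ep_def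
          proof (rule mult_right_mono[OF k0(2)])
            have "1 \<le> x * x" using x1 by (simp add: less_1_mult less_imp_le)
            then show "0 \<le> x * x * (1 + ln (x * x)) ^ (16 * k)" by simp
          qed
          then have "Lm\<^sup>2 * (x * x * (1 + ln (x * x)) ^ (16 * k)) * 1 \<le> Lm\<^sup>2 * Ep * (z + 1)"
            using z1 Ep0 by (intro mult_mono mult_left_mono) auto
          then show ?thesis by simp
        qed
        finally have 1: "(\<Sum>n\<in>window N. sw x y n) \<le> real N / real W * (\<Sum>C\<in>psets D x. wt C * (y (sprod C))\<^sup>2) + real N"
          using errP by linarith
        have 2: "(\<Sum>C\<in>psets D x. wt C * (y (sprod C))\<^sup>2) = mo 0 x * Us N"
          unfolding y_def main_sum_eq[OF x1] l(2)[symmetric] mos[of 1] mos[of 2] Us_def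
          using l by (simp add: field_simps power2_eq_square)
        have "real N / real W * (mo 0 x * Us N) \<le> real N / real W * (Phi * M * l * Qn N * Us N)"
          using mo_le Us0 by (intro mult_left_mono mult_right_mono) auto
        also have "\<dots> = G / l * (Qn N * Us N)" unfolding G_def using l by (simp add: field_simps power2_eq_square)
        finally show ?thesis using 1 unfolding 2 by linarith
      qed
      have S2: "G * Ln N - real N \<le> (\<Sum>n\<in>window N. sw x y n * lnp (n + h))" if h: "h \<in> H" for h
      proof -
        let ?m = "\<Sum>C\<in>psets D x. (\<Prod>p\<in>C. (real k - 1) / (real p - real k)) *
          ((\<Prod>p\<in>C. real p / (real p - 1)) * (\<Sum>m | m \<in> psets D (x / sprod C) \<and> m \<inter> C = {}.
            (\<Prod>p\<in>m. 1 / (real p - 1)) * y (sprod C * sprod m)))\<^sup>2"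
        have "\<bar>(\<Sum>n\<in>window N. sw x y n * lnp (n + h)) - real N / real (totient W) * ?m\<bar>
          \<le> Lm\<^sup>2 * (\<Sum>C\<in>psets D (x * x). real (16 * k) ^ card C * (errA (2 * N + h) (W * sprod C) + errA (N + h) (W * sprod C)))"
          unfolding Lm_def using x1 y0 h xxN by (intro sieve_sum_prime_bound) auto
        also have "\<dots> \<le> real N" unfolding xx using elim(4) h by (intro errL) auto
        finally have 1: "real N / real (totient W) * ?m - real N \<le> (\<Sum>n\<in>window N. sw x y n * lnp (n + h))" by linarith
        have "Phi\<^sup>2 * (mo1 2 x + b * (mo1 3 x / ln x) + b\<^sup>2 / 4 * (mo1 4 x / (ln x)\<^sup>2)) \<le> ?m"
          unfolding y_def by (rule prime_main_lower[OF x1 b])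
        moreover have "Phi\<^sup>2 * (mo1 2 x + b * (mo1 3 x / ln x) + b\<^sup>2 / 4 * (mo1 4 x / (ln x)\<^sup>2)) = Phi\<^sup>2 * M * l\<^sup>2 * Ln N"
          unfolding l(2)[symmetric] mor[of 2] mor[of 3] mor[of 4] Ln_def
          using l by (simp add: field_simps power2_eq_square power3_eq_cube power4_eq_xxxx)
        ultimately have "real N / real (totient W) * (Phi\<^sup>2 * M * l\<^sup>2 * Ln N) \<le> real N / real (totient W) * ?m"
          by (intro mult_left_mono) auto
        moreover have "real N / real (totient W) * (Phi\<^sup>2 * M * l\<^sup>2 * Ln N) = G * Ln N"
          unfolding G_def Phi_def using totient_W_ge1 W_pos by (simp add: power2_eq_square)
        ultimately show ?thesis using 1 by linarith
      qed
      have S3: "\<bar>\<Sum>n\<in>window N. sw x y n * liouville (n + h)\<bar> \<le> real N" if h: "h \<in> H" for h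
      proof -
        have "\<bar>\<Sum>n\<in>window N. sw x y n * liouville (n + h)\<bar>
          \<le> Lm\<^sup>2 * (\<Sum>C\<in>psets D (x * x). real (16 * k) ^ card C * (2 * errB (3 * N) (W * sprod C)))"
          unfolding Lm_def using x1 y0 HN[OF h] by (intro sieve_sum_liouville_bound) auto
        also have "\<dots> \<le> real N" unfolding xx using elim(5) by (intro errL) auto
        finally show ?thesis .
      qed
      let ?Q = "{q. (prime q \<and> D < q) \<and> real q \<le> z}"
      have S4: "(\<Sum>q\<in>?Q. \<Sum>n | n \<in> window N \<and> has_root n q. sw x y n) \<le> G / l * Vn N + real N"
      proof -
        define X where "X = b\<^sup>2 * (mo 0 x / l) + 2 * (1 + b)\<^sup>2 * \<eta> * M"
        have X0: "0 \<le> X" unfolding X_def using mo0 l M1 \<eta>0 b by (intro add_nonneg_nonneg mult_nonneg_nonneg) auto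
        have Xle: "X \<le> M * (b\<^sup>2 * Phi * Qn N + 2 * (1 + b)\<^sup>2 * \<eta>)"
        proof -
          have "mo 0 x / l \<le> Phi * M * Qn N" using mo_le l by (simp add: field_simps)
          then have "b\<^sup>2 * (mo 0 x / l) \<le> b\<^sup>2 * (Phi * M * Qn N)" by (intro mult_left_mono) auto
          then show ?thesis unfolding X_def by (simp add: algebra_simps)
        qed
        have each: "(\<Sum>n | n \<in> window N \<and> has_root n q. sw x y n) \<le> real N / real W * real k * X * (ln (real q) / real q) + Lm\<^sup>2 * Ep"
          if q: "q \<in> ?Q" for q
        proof -
          let ?m = "\<Sum>C | C \<in> psets D x \<and> q \<notin> C. wt C * (y (sprod C) - (if insert q C \<in> psets D x then y (q * sprod C) else 0))\<^sup>2"
          have q': "prime q" "D < q" "real q \<le> x" using q zx by auto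
          have "\<bar>(\<Sum>n | n \<in> window N \<and> has_root n q. sw x y n) - real N / real W * (real k / real q * ?m)\<bar> \<le> Lm\<^sup>2 * Ep"
            unfolding Lm_def Ep_def using x1 y0 q' by (intro sieve_sum_root_bound) auto
          moreover have "?m \<le> ln (real q) * X"
            unfolding X_def y_def l(2) M_def \<eta>_def by (rule root_main_upper[OF x1 b q'])
          then have "real N / real W * (real k / real q * ?m) \<le> real N / real W * (real k / real q * (ln (real q) * X))"
            by (intro mult_left_mono) auto
          moreover have "real N / real W * (real k / real q * (ln (real q) * X)) = real N / real W * real k * X * (ln (real q) / real q)"
            by simp
          ultimately show ?thesis by linarith
        qed
        have "(\<Sum>q\<in>?Q. \<Sum>n | n \<in> window N \<and> has_root n q. sw x y n)
          \<le> (\<Sum>q\<in>?Q. real N / real W * real k * X * (ln (real q) / real q) + Lm\<^sup>2 * Ep)"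
          by (rule sum_mono[OF each])
        also have "\<dots> = real N / real W * real k * X * (\<Sum>q\<in>?Q. ln (real q) / real q) + Lm\<^sup>2 * Ep * real (card ?Q)"
          unfolding sum.distrib sum_distrib_left[symmetric] sum_constant by (simp only: mult_ac)
        also have "\<dots> \<le> real N / real W * real k * X * (c * ln (real N) + E) + real N"
        proof (intro add_mono mult_left_mono)
          have "(\<Sum>q\<in>?Q. ln (real q) / real q) \<le> ln z + E" using E(2)[OF z1] by simp
          also have "ln z = c * ln (real N)" unfolding z_def using N3 by (simp add: ln_powr)
          finally show "(\<Sum>q\<in>?Q. ln (real q) / real q) \<le> c * ln (real N) + E" .
          have "card ?Q \<le> card {1..nat \<lfloor>z\<rfloor>}"
          proof (rule card_mono)
            show "?Q \<subseteq> {1..nat \<lfloor>z\<rfloor>}"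
            proof
              fix q assume q: "q \<in> ?Q"
              then have "1 \<le> q" "q \<le> nat \<lfloor>z\<rfloor>" using prime_ge_1_nat[of q] by (auto simp: le_nat_floor)
              then show "q \<in> {1..nat \<lfloor>z\<rfloor>}" by simp
            qed
          qed simp
          then have "real (card ?Q) \<le> z + 1" using z1 by simp linarith
          then have "Lm\<^sup>2 * Ep * real (card ?Q) \<le> Lm\<^sup>2 * Ep * (z + 1)" using Ep0 by (intro mult_left_mono) auto
          then show "Lm\<^sup>2 * Ep * real (card ?Q) \<le> real N" using errP by linarith
        qed (use X0 in auto)
        also have "real N / real W * real k * X * (c * ln (real N) + E)
           \<le> real N / real W * real k * (M * (b\<^sup>2 * Phi * Qn N + 2 * (1 + b)\<^sup>2 * \<eta>)) * (c * ln (real N) + E)"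
          using Xle lN c E(1) by (intro mult_right_mono mult_left_mono) auto
        also have "\<dots> = G / l * Vn N"
          unfolding G_def Vn_def l_def[symmetric] using l Phi_pos by (simp add: power2_eq_square mult_ac)
        finally show ?thesis by simp
      qed
      have ng: "\<not> (rough n z \<and> good n)" if "n \<in> window N" for n using neg that unfolding z_def by blast
      have par: "(real k - 1) * (\<Sum>h\<in>H. \<Sum>n\<in>window N. sw x y n * lnp (n + h))
        \<le> l3 * (real k / 2 * (\<Sum>n\<in>window N. sw x y n) + 1 / 2 * (\<Sum>h\<in>H. \<bar>\<Sum>n\<in>window N. sw x y n * liouville (n + h)\<bar>)
         + (real k)\<^sup>2 * (\<Sum>q\<in>?Q. \<Sum>n | n \<in> window N \<and> has_root n q. sw x y n))"
        unfolding l3_def using HN ng N3 by (intro parity_inequality) auto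
      have "G * lhs N \<le> (real k - 1) * (real k * (G * Ln N - real N))"
      proof -
        have "(real k - 1) * real k * real N \<le> (real k - 1) * real k * (G * \<nu> N)"
          using N\<nu> k0 by (intro mult_left_mono) auto
        then show ?thesis unfolding lhs_def by (simp add: algebra_simps)
      qed
      also have "\<dots> \<le> (real k - 1) * (\<Sum>h\<in>H. \<Sum>n\<in>window N. sw x y n * lnp (n + h))"
      proof (rule mult_left_mono[OF _ k0(3)])
        have "(\<Sum>h\<in>H. G * Ln N - real N) \<le> (\<Sum>h\<in>H. \<Sum>n\<in>window N. sw x y n * lnp (n + h))"
          using S2 by (rule sum_mono)
        then show "real k * (G * Ln N - real N) \<le> (\<Sum>h\<in>H. \<Sum>n\<in>window N. sw x y n * lnp (n + h))" using cardH by simp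
      qed
      also note par
      also have "l3 * (real k / 2 * (\<Sum>n\<in>window N. sw x y n) + 1 / 2 * (\<Sum>h\<in>H. \<bar>\<Sum>n\<in>window N. sw x y n * liouville (n + h)\<bar>)
         + (real k)\<^sup>2 * (\<Sum>q\<in>?Q. \<Sum>n | n \<in> window N \<and> has_root n q. sw x y n))
        \<le> l3 * (real k / 2 * (G / l * (Qn N * Us N) + real N) + 1 / 2 * (real k * real N) + (real k)\<^sup>2 * (G / l * Vn N + real N))"
      proof (intro mult_left_mono[OF _ l3] add_mono mult_left_mono S1 S4)
        have "(\<Sum>h\<in>H. \<bar>\<Sum>n\<in>window N. sw x y n * liouville (n + h)\<bar>) \<le> (\<Sum>h\<in>H. real N)" using S3 by (rule sum_mono)
        then show "(\<Sum>h\<in>H. \<bar>\<Sum>n\<in>window N. sw x y n * liouville (n + h)\<bar>) \<le> real k * real N" using cardH by simp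
      qed auto
      also have "\<dots> = G * (l3 / l * (real k / 2 * (Qn N * Us N) + (real k)\<^sup>2 * Vn N)) + l3 * (real k + (real k)\<^sup>2) * real N"
        using l by (simp add: field_simps)
      also have "\<dots> \<le> G * (l3 / l * (real k / 2 * (Qn N * Us N) + (real k)\<^sup>2 * Vn N)) + l3 * (real k + (real k)\<^sup>2) * (G * \<nu> N)"
        using N\<nu> l3 by (intro add_left_mono mult_left_mono) auto
      also have "\<dots> = G * rhs N" unfolding rhs_def l3_def[symmetric] l_def[symmetric] by (simp add: algebra_simps)
      finally have "lhs N \<le> rhs N" using G0 by simp
      then show False using elim(1) by simp
    qed
  qed
  then show ?thesis using c(1) by blast
qed

end

section \<open>Almost primes next to primes\<close>

lemma power_size_le_prod_mset:
  fixes A :: "nat multiset" and t :: real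
  assumes "0 \<le> t" "\<And>q. q \<in># A \<Longrightarrow> t \<le> real q"
  shows "t ^ size A \<le> real (prod_mset A)"
  using assms(2)
proof (induction A)
  case (add q A)
  have "t * t ^ size A \<le> real q * real (prod_mset A)"
    using add assms(1) by (intro mult_mono) auto
  then show ?case by simp
qed simp

text \<open>\<open>res_classes\<close> with trivial modulus 1 is reused for the small primes: by the
  Chinese remainder theorem the number of suitable v is a product of nonzero local counts.\<close>

lemma good_residue_exists:
  fixes H :: "nat set" and D :: nat
  assumes adm: "\<And>p::nat. prime p \<Longrightarrow> \<exists>a. \<forall>h\<in>H. \<not> p dvd a + h"
  defines "W \<equiv> sprod {p. prime p \<and> p \<le> D}"
  shows "\<exists>v<W. \<forall>h\<in>H. coprime (v + h) W"
proof -
  let ?C = "{p. prime p \<and> p \<le> D}" and ?S = "\<lambda>p::nat. {a. a < p \<and> (\<forall>h\<in>H. \<not> p dvd a + h)}"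
  have "card (res_classes 1 0 ?S ?C) = (\<Prod>p\<in>?C. card (?S p))"
    by (rule card_res_classes) auto
  also have "\<dots> \<noteq> 0"
  proof -
    have "card (?S p) \<noteq> 0" if p: "p \<in> ?C" for p
    proof -
      obtain a where a: "\<forall>h\<in>H. \<not> p dvd a + h" using adm p by blast
      have "a mod p \<in> ?S p" using a p by (auto simp: dvd_eq_mod_eq_0 mod_add_left_eq prime_gt_0_nat)
      then show ?thesis by (auto simp: card_eq_0_iff)
    qed
    then show ?thesis by (subst prod_zero_iff) auto
  qed
  finally have "card (res_classes 1 0 ?S ?C) \<noteq> 0" .
  then have "res_classes 1 0 ?S ?C \<noteq> {}" by auto
  then obtain v where v: "v \<in> res_classes 1 0 ?S ?C" by blast
  have "coprime (v + h) W" if h: "h \<in> H" for h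
    unfolding W_def sprod_def
  proof (rule prod_coprime_right)
    fix p assume p: "p \<in> ?C"
    have "\<not> p dvd v mod p + h" using v p h by (auto simp: res_classes_def)
    then have "\<not> p dvd v + h" by (simp add: dvd_eq_mod_eq_0 mod_add_left_eq)
    then have "coprime p (v + h)" using p by (intro prime_imp_coprime) auto
    then show "coprime (v + h) p" by (rule coprime_commute[THEN iffD1])
  qed
  moreover have "v < W" using v by (simp add: res_classes_def W_def)
  ultimately show ?thesis by blast
qed

context tuple_sieve
begin

lemma rough_prime_factor:
  assumes n: "n \<in> window N" and r: "rough n z" and h: "h \<in> H" and q: "prime q" "q dvd n + h"
  shows "z < real q"
proof (rule ccontr)
  assume z: "\<not> z < real q"
  have "has_root n q" unfolding has_root_def using h q by auto
  then have "q \<le> D" using r q z unfolding rough_def by (metis not_le linorder_not_less)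
  then have qW: "q dvd W" using q by (intro dvd_W) auto
  have "(n + h) mod W = (v + h) mod W" using n unfolding window_def by (metis (mono_tags, lifting) mem_Collect_eq mod_add_left_eq)
  then have "(n + h) mod q = (v + h) mod q" using qW by (metis mod_mod_cancel)
  then have "q dvd v + h" using q by (simp add: dvd_eq_mod_eq_0)
  then have "is_unit q" using vH[OF h] qW by (meson coprime_common_divisor)
  then show False using q by simp
qed

text \<open>From N = 3 on, 3 * N is at most N squared. So the prime p = n + h satisfies
  \<open>p powr (c / 2) \<le> N powr c\<close>, and n + h', whose prime factors all exceed
  \<open>N powr c\<close>, has at most 2 / c of them.\<close>

lemma good_gives_almost_prime:
  assumes c: "0 < c" and n: "n \<in> window N" and r: "rough n (real N powr c)" and N: "3 \<le> N" "D \<le> N"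
    and h: "h \<in> H" "h' \<in> H" "prime (n + h)" "liouville (n + h') = -1"
  shows "real (least_prime_factor (n + h')) > real (n + h) powr (c / 2)"
    "odd (bigOmega (n + h'))" "real (bigOmega (n + h')) \<le> 2 / c" "1 < n + h'"
proof -
  let ?m = "n + h'"
  have nN: "N < n" "n \<le> 2 * N" using n by (auto simp: window_def)
  have m: "1 < ?m" "?m \<noteq> 0" using nN N by auto
  then show "1 < n + h'" by simp
  have hN: "n + h \<le> 3 * N" "?m \<le> 3 * N" using HD[OF h(1)] HD[OF h(2)] nN N by auto
  have NN: "3 * real N \<le> real N ^ 2" using N by (simp add: power2_eq_square)
  have fac: "real N powr c < real q" if "q \<in> prime_factors ?m" for q
    using rough_prime_factor[OF n r h(2), of q] that by auto
  have ne: "prime_factors ?m \<noteq> {}"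
  proof -
    obtain q where "prime q" "q dvd ?m" using prime_factor_nat[of ?m] m by auto
    then have "q \<in> prime_factors ?m" using m by (simp add: prime_factors_dvd)
    then show ?thesis by blast
  qed
  have "least_prime_factor ?m \<in> prime_factors ?m"
    unfolding least_prime_factor_def using ne by (intro Min_in) auto
  from fac[OF this] have 1: "real N powr c < real (least_prime_factor ?m)" .
  have "real (n + h) powr (c / 2) \<le> (real N ^ 2) powr (c / 2)"
  proof (rule powr_mono2)
    have "real (n + h) \<le> 3 * real N" using hN by linarith
    then show "real (n + h) \<le> real N ^ 2" using NN by linarith
  qed (use c in auto)
  also have "\<dots> = real N powr c"
  proof -
    have "real N ^ 2 = real N powr 2" using N by simp
    then show ?thesis by (simp only: powr_powr) simp
  qed
  finally show "real (least_prime_factor (n + h')) > real (n + h) powr (c / 2)" using 1 by linarith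
  show "odd (bigOmega ?m)"
  proof
    assume "even (bigOmega ?m)"
    then show False using h(4) by (simp add: liouville_def)
  qed
  have "(real N powr c) ^ bigOmega ?m \<le> real (prod_mset (prime_factorization ?m))"
    unfolding bigOmega_def using fac by (intro power_size_le_prod_mset) (auto intro: less_imp_le)
  also have "prod_mset (prime_factorization ?m) = ?m" using m by (intro prod_mset_prime_factorization_nat) auto
  also have "real ?m \<le> 3 * real N" using hN by linarith
  also note NN
  also have "real N ^ 2 = real N powr 2" using N by simp
  also have "(real N powr c) ^ bigOmega ?m = real N powr (c * real (bigOmega ?m))"
    using N by (simp add: powr_realpow[symmetric] powr_powr)
  finally have "c * real (bigOmega ?m) \<le> 2" using N by (subst (asm) powr_le_cancel_iff) auto
  then show "real (bigOmega (n + h')) \<le> 2 / c" using c by (simp add: field_simps)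
qed

end

text \<open>The numerical inequality is assumed without strictness and without the factor
  \<open>exp (2 * k / D)\<close>. The room between \<theta>0 and \<theta> supplies the strictness,
  and a large D brings the factor close enough to 1. \<Delta> bounds differences of elements of H
  because the elements are nonnegative.\<close>

lemma almost_prime_pairs_of_tuple:
  fixes \<theta> \<theta>0 b :: real and H :: "nat set" and \<Delta> :: int
  assumes A: "condA \<theta>" and B: "condB \<theta>" and \<theta>: "0 < \<theta>0" "\<theta>0 < \<theta>" "\<theta>0 < 1"
    and H: "finite H" "2 \<le> card H" "\<And>h. h \<in> H \<Longrightarrow> even h"
    and \<Delta>: "\<And>h. h \<in> H \<Longrightarrow> int h \<le> \<Delta>"
    and adm: "\<And>p::nat. prime p \<Longrightarrow> \<exists>a. \<forall>h\<in>H. \<not> p dvd a + h"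
    and b: "0 \<le> b" and k: "k = real (card H)"
    and slack: "1 + 2 * b * beta_ratio k 1 + b\<^sup>2 * beta_ratio k 2
      \<le> \<theta>0 * (k * (k - 1) * (beta_ratio (k - 1) 2 + b * beta_ratio (k - 1) 3 + b\<^sup>2 / 4 * beta_ratio (k - 1) 4))"
  shows "\<exists>C::real. \<exists>c::real. c > 0 \<and> (\<exists>b::int. \<exists>d::int. odd b \<and> real_of_int b \<le> C \<and> even d
           \<and> 0 < \<bar>d\<bar> \<and> \<bar>d\<bar> \<le> \<Delta>
           \<and> infinite {p::nat. prime p \<and> int p + d > 1
                 \<and> real (least_prime_factor (nat (int p + d))) > real p powr c
                 \<and> int (bigOmega (nat (int p + d))) = b})"
proof -
  \<comment> \<open>Strictly above \<theta>0, yet below \<theta> and below 1, where the elementary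
    counting errors stay smaller than the main term.\<close>
  define \<tau> where "\<tau> = (\<theta>0 + min \<theta> 1) / 2"
  have \<tau>: "\<theta>0 < \<tau>" "0 < \<tau>" "\<tau> < \<theta>" "\<tau> < 1" using \<theta> by (auto simp: \<tau>_def min_def)
  let ?U = "1 + 2 * b * beta_ratio k 1 + b\<^sup>2 * beta_ratio k 2"
  let ?L = "k * (k - 1) * (beta_ratio (k - 1) 2 + b * beta_ratio (k - 1) 3 + b\<^sup>2 / 4 * beta_ratio (k - 1) 4)"
  have k2: "2 \<le> k" using H k by simp
  have br: "0 \<le> beta_ratio \<kappa> j" if "0 \<le> \<kappa>" for \<kappa> j
    unfolding beta_ratio_def using that by (intro prod_nonneg) auto
  have U1: "1 \<le> ?U" using b br[of k] k2 by simp
  have L0: "0 < ?L"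
  proof -
    have "0 < \<theta>0 * ?L" using slack U1 by linarith
    then show ?thesis using \<theta> zero_less_mult_pos by blast
  qed
  have lt: "?U < \<tau> * ?L"
    using slack mult_strict_right_mono[OF \<tau>(1) L0] by linarith
  have "((\<lambda>D::nat. exp (2 * k / real D) * ?U) \<longlongrightarrow> exp 0 * ?U) sequentially"
    by (intro tendsto_intros)
  then have "\<forall>\<^sub>F D::nat in sequentially. exp (2 * k / real D) * ?U < \<tau> * ?L"
    using lt by (intro order_tendstoD(2)) auto
  then have "\<forall>\<^sub>F D::nat in sequentially. exp (2 * k / real D) * ?U < \<tau> * ?L \<and> 2 * card H \<le> D \<and> Max H \<le> D"
    by (intro eventually_conj eventually_ge_at_top)
  then obtain D :: nat where D: "exp (2 * k / real D) * ?U < \<tau> * ?L" "2 * card H \<le> D" "Max H \<le> D"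
    using eventually_happens'[OF sequentially_bot] by blast
  define W where "W = sprod {p. prime p \<and> p \<le> D}"
  obtain v where v: "v < W" "\<forall>h\<in>H. coprime (v + h) W"
    using good_residue_exists[OF adm, of D] unfolding W_def by blast
  interpret S: tuple_sieve H "card H" D W v
  proof
    fix h assume "h \<in> H"
    then show "h \<le> D" using Max_ge[OF H(1)] D(3) by (meson order_trans)
  qed (use H D v W_def in auto)
  obtain c where c: "0 < c" and ev: "\<forall>\<^sub>F N in sequentially. \<exists>n\<in>S.window N. S.rough n (real N powr c) \<and> S.good n"
    using S.good_exists[OF A B \<tau>(2,3,4) b] D(1) unfolding k by blast
  define T where "T bb d = {p::nat. prime p \<and> int p + d > 1
                 \<and> real (least_prime_factor (nat (int p + d))) > real p powr (c / 2)
                 \<and> int (bigOmega (nat (int p + d))) = bb}" for bb d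
  define I where "I = {(bb, d). odd bb \<and> 0 \<le> bb \<and> bb \<le> \<lfloor>2 / c\<rfloor> \<and> even d \<and> 0 < \<bar>d\<bar> \<and> \<bar>d\<bar> \<le> \<Delta>}"
  have finI: "finite I"
    by (rule finite_subset[of _ "{0..\<lfloor>2 / c\<rfloor>} \<times> {-\<Delta>..\<Delta>}"]) (auto simp: I_def)
  \<comment> \<open>Every large window contributes a prime beyond N to one of these sets. As
    \<open>I\<close> is finite, one pair (b, d) must occur for infinitely many primes.\<close>
  have "infinite (\<Union>(bb, d)\<in>I. T bb d)"
    unfolding infinite_nat_iff_unbounded
  proof
    fix m :: nat
    have "\<forall>\<^sub>F N in sequentially. (\<exists>n\<in>S.window N. S.rough n (real N powr c) \<and> S.good n) \<and> max (max 3 D) m \<le> N"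
      using ev by (intro eventually_conj eventually_ge_at_top)
    then obtain N where N: "\<exists>n\<in>S.window N. S.rough n (real N powr c) \<and> S.good n" "max (max 3 D) m \<le> N"
      using eventually_happens'[OF sequentially_bot] by blast
    then obtain n h h' where n: "n \<in> S.window N" "S.rough n (real N powr c)"
      and h: "h \<in> H" "h' \<in> H" "h \<noteq> h'" "prime (n + h)" "liouville (n + h') = -1"
      unfolding S.good_def by blast
    have N3: "3 \<le> N" "D \<le> N" "m \<le> N" using N(2) by auto
    note g = S.good_gives_almost_prime[OF c n N3(1,2) h(1,2,4,5)]
    define d where "d = int h' - int h"
    have pd: "int (n + h) + d = int (n + h')" by (simp add: d_def)
    have d: "even d" "0 < \<bar>d\<bar>" "\<bar>d\<bar> \<le> \<Delta>"
      using H(3)[OF h(1)] H(3)[OF h(2)] h(3) \<Delta>[OF h(1)] \<Delta>[OF h(2)] by (auto simp: d_def)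
    have "n + h \<in> T (int (bigOmega (n + h'))) d"
      unfolding T_def mem_Collect_eq pd nat_int using h g by auto
    moreover have "(int (bigOmega (n + h')), d) \<in> I"
      unfolding I_def using d g by (auto simp: le_floor_iff)
    ultimately have "n + h \<in> (\<Union>(bb, d)\<in>I. T bb d)" by blast
    moreover have "m < n + h" using n N3 by (auto simp: S.window_def)
    ultimately show "\<exists>p>m. p \<in> (\<Union>(bb, d)\<in>I. T bb d)" by blast
  qed
  then obtain bb d where bd: "(bb, d) \<in> I" "infinite (T bb d)"
    using finI by (auto simp: finite_UN)
  show ?thesis
    using bd c unfolding T_def I_def
    by (intro exI[of _ "real_of_int bb"] exI[of _ "c / 2"] conjI exI[of _ bb] exI[of _ d]) auto
qed

section \<open>Numerical verification for the six tuples\<close>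

lemma beta_ratio_values:
  "beta_ratio \<kappa> (Suc 0) = 1 / (1 + \<kappa>)" "beta_ratio \<kappa> 2 = 1 / (1 + \<kappa>) * (2 / (2 + \<kappa>))"
  "beta_ratio \<kappa> 3 = 1 / (1 + \<kappa>) * (2 / (2 + \<kappa>)) * (3 / (3 + \<kappa>))"
  "beta_ratio \<kappa> 4 = 1 / (1 + \<kappa>) * (2 / (2 + \<kappa>)) * (3 / (3 + \<kappa>)) * (4 / (4 + \<kappa>))"
  by (simp_all add: beta_ratio_def numeral_eq_Suc)

text \<open>For p from 28 on, a = 1 works, because 1 + h is at most 27. Smaller p are left to
  evaluation, over all integers from 2 to 27, so that primality never has to be computed.\<close>

lemma tuple_admissible:
  fixes hs :: "nat list" and p :: nat
  assumes small: "\<forall>p\<in>set [2..<28]. \<exists>a\<in>set [0..<28]. \<forall>h\<in>set hs. (a + h) mod p \<noteq> 0"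
    and le: "\<forall>h\<in>set hs. h \<le> 26" and p: "prime p"
  shows "\<exists>a. \<forall>h\<in>set hs. \<not> p dvd a + h"
proof (cases "p < 28")
  case True
  then have "p \<in> set [2..<28]" using prime_ge_2_nat[OF p] by (simp only: set_upt atLeastLessThan_iff)
  from bspec[OF small this] obtain a where "\<forall>h\<in>set hs. (a + h) mod p \<noteq> 0" by (rule bexE)
  then have "\<forall>h\<in>set hs. \<not> p dvd a + h" by (simp only: dvd_eq_mod_eq_0 not_False_eq_True)
  then show ?thesis by (rule exI)
next
  case False
  have "\<forall>h\<in>set hs. \<not> p dvd 1 + h"
  proof
    fix h assume "h \<in> set hs"
    then have "1 + h < p" using le False by fastforce
    then show "\<not> p dvd 1 + h" by (auto dest: dvd_imp_le)
  qed
  then show ?thesis by blast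
qed

lemma tuple_checks:
  "\<forall>p\<in>set [2..<28]. \<exists>a\<in>set [0..<28]. \<forall>h\<in>set [0, 2, 6]. (a + h) mod p \<noteq> (0::nat)"
  "\<forall>p\<in>set [2..<28]. \<exists>a\<in>set [0..<28]. \<forall>h\<in>set [0, 2, 6, 8]. (a + h) mod p \<noteq> (0::nat)"
  "\<forall>p\<in>set [2..<28]. \<exists>a\<in>set [0..<28]. \<forall>h\<in>set [0, 2, 6, 8, 12]. (a + h) mod p \<noteq> (0::nat)"
  "\<forall>p\<in>set [2..<28]. \<exists>a\<in>set [0..<28]. \<forall>h\<in>set [0, 4, 6, 10, 12, 16]. (a + h) mod p \<noteq> (0::nat)"
  "\<forall>p\<in>set [2..<28]. \<exists>a\<in>set [0..<28]. \<forall>h\<in>set [0, 2, 6, 8, 12, 18, 20]. (a + h) mod p \<noteq> (0::nat)"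
  "\<forall>p\<in>set [2..<28]. \<exists>a\<in>set [0..<28]. \<forall>h\<in>set [0, 2, 6, 8, 12, 18, 20, 26]. (a + h) mod p \<noteq> (0::nat)"
  by code_simp+

theorem theorem8:
  fixes \<theta> \<theta>0 :: real and D :: int
  assumes pair: "(\<theta>0, D) \<in> {(0.924, 6), (0.739, 8), (0.643, 12), (0.584, 16), (0.544, 20), (0.516, 26)}"
    and gt: "\<theta> > \<theta>0"
    and A: "condA \<theta>"
    and B: "condB \<theta>"
  shows "\<exists>C::real. \<exists>c::real. c > 0 \<and> (\<exists>b::int. \<exists>d::int. odd b \<and> real_of_int b \<le> C \<and> even d
           \<and> 0 < \<bar>d\<bar> \<and> \<bar>d\<bar> \<le> D
           \<and> infinite {p::nat. prime p \<and> int p + d > 1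
                 \<and> real (least_prime_factor (nat (int p + d))) > real p powr c
                 \<and> int (bigOmega (nat (int p + d))) = b})"
proof -
  consider "\<theta>0 = 0.924" "D = 6" | "\<theta>0 = 0.739" "D = 8" | "\<theta>0 = 0.643" "D = 12"
    | "\<theta>0 = 0.584" "D = 16" | "\<theta>0 = 0.544" "D = 20" | "\<theta>0 = 0.516" "D = 26"
    using pair by auto
  then show ?thesis
    \<comment> \<open>In each case b is close to the value that maximises the quotient of the two sides of the numerical inequality.\<close>
  proof cases
    case 1
    show ?thesis
      by (rule almost_prime_pairs_of_tuple[OF A B _ gt, where H = "set [0, 2, 6]" and b = 3 and k = 3])
        (use 1 tuple_admissible[OF tuple_checks(1)] in \<open>auto simp: beta_ratio_values power2_eq_square\<close>)
  next
    case 2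
    show ?thesis
      by (rule almost_prime_pairs_of_tuple[OF A B _ gt, where H = "set [0, 2, 6, 8]" and b = 5 and k = 4])
        (use 2 tuple_admissible[OF tuple_checks(2)] in \<open>auto simp: beta_ratio_values power2_eq_square\<close>)
  next
    case 3
    show ?thesis
      by (rule almost_prime_pairs_of_tuple[OF A B _ gt, where H = "set [0, 2, 6, 8, 12]" and b = 7 and k = 5])
        (use 3 tuple_admissible[OF tuple_checks(3)] in \<open>auto simp: beta_ratio_values power2_eq_square\<close>)
  next
    case 4
    show ?thesis
      by (rule almost_prime_pairs_of_tuple[OF A B _ gt, where H = "set [0, 4, 6, 10, 12, 16]" and b = 10 and k = 6])
        (use 4 tuple_admissible[OF tuple_checks(4)] in \<open>auto simp: beta_ratio_values power2_eq_square\<close>)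
  next
    case 5
    show ?thesis
      by (rule almost_prime_pairs_of_tuple[OF A B _ gt, where H = "set [0, 2, 6, 8, 12, 18, 20]" and b = 15 and k = 7])
        (use 5 tuple_admissible[OF tuple_checks(5)] in \<open>auto simp: beta_ratio_values power2_eq_square\<close>)
  next
    case 6
    show ?thesis
      by (rule almost_prime_pairs_of_tuple[OF A B _ gt, where H = "set [0, 2, 6, 8, 12, 18, 20, 26]" and b = 22 and k = 8])
        (use 6 tuple_admissible[OF tuple_checks(6)] in \<open>auto simp: beta_ratio_values power2_eq_square\<close>)
  qed
qed

end
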